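(* Assume (A1)–(A4) listed in the context. Let $\Phi:\mathbb{R}^+\times\mathbb{R}\times\Omega\times\ell^2\to\ell^2$ be the continuous cocycle $\Phi(t,\tau,\omega,v_\tau)=v(t+\tau,\tau;\theta_{-\tau}\omega,v_\tau)$ generated by the random lattice system (with both non-autonomous deterministic and random forcing terms) $$\frac{dv}{dt}=-\nu(t)Av-\lambda(t)v-e^{-z(\theta_t\omega)}f(e^{z(\theta_t\omega)}v,t)+e^{-z(\theta_t\omega)}g(t)+z(\theta_t\omega)v,\quad t>\tau,\qquad v(\tau)=v_\tau\in\ell^2,$$ where $v(\cdot,\tau;\omega,v_\tau)$ denotes its mild solution. Then $\Phi$ has a unique $\mathcal{D}(\ell^2)$-pullback attractor.
   Context: $\ell^2$ is the Hilbert space of real sequences $u=(u_i)_{i\in\mathbb{Z}}$ with $\|u\|^2=\sum_i|u_i|^2<\infty$; $C_b(\mathbb{R},\ell^2)$ is the space of bounded continuous functions $\mathbb{R}\to\ell^2$. The system is obtained by $v(t)=u(t)e^{-z(\theta_t\omega)}$ from the stochastic lattice system $\frac{du_i}{dt}=\nu_i(t)(u_{i-1}-2u_i+u_{i+1})-\lambda_i(t)u_i-f_i(u_i,t)+g_i(t)+u_i\circ\frac{dw}{dt}$, $i\in\mathbb{Z}$ (Stratonovich). Notation: $(Av)_i=-v_{i-1}+2v_i-v_{i+1}$, $(\nu(t)Av)_i=\nu_i(t)(Av)_i$, $(\lambda(t)v)_i=\lambda_i(t)v_i$, $f(v,t)=(f_i(v_i,t))_i$, $g(t)=(g_i(t))_i$,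 with $f_i\in C(\mathbb{R}\times\mathbb{R},\mathbb{R})$, $g_i\in C(\mathbb{R},\mathbb{R})$. Assumptions. (A1) $\lambda_i,\nu_i\in L^1_{loc}(\mathbb{R})$ and there are positive constants $\lambda_0,\lambda^0,\nu_0,\nu^0$ with $\lambda_0\le\lambda_i(t)\le\lambda^0$, $\nu_0\le\nu_i(t)\le\nu^0$ for all $i\in\mathbb{Z}$, $t\in\mathbb{R}$. (A2) $f_i(x,t)$ is differentiable in $x$ and continuous in $t$; $f_i(0,t)=0$; $xf_i(x,t)\ge-\alpha_i^2(t)$ where $\alpha(t)=(\alpha_i(t))_i\in C_b(\mathbb{R},\ell^2)$; and there is a constant $\beta\ge0$ with $\partial_xf_i(x,t)\ge-\beta$ for all $x,t\in\mathbb{R}$, $i\in\mathbb{Z}$. (A3) There is a positive-valued continuous function $\zeta:\mathbb{R}^+\times\mathbb{R}\to\mathbb{R}^+$ with $\sup_{i\in\mathbb{Z}}\max_{x\in[-\iota,\iota]}|\partial_xf_i(x,t)|\le\zeta(\iota,t)$ for all $\iota\in\mathbb{R}^+$, $t\in\mathbb{R}$. (A4) $g=(g_i)_i\in C_b(\mathbb{R},\ell^2)$. Noise. Start from the Wiener space $\{\omega\in C(\mathbb{R},\mathbb{R}):\omega(0)=0\}$ with the Borel $\sigma$-algebra of the compact-open topology, Wiener measure $P$, shifts $\theta_t\omega(\cdot)=\omega(\cdot+t)-\omega(t)$, and $w(t)=\omega(t)$. Let $z(\omega)=-\int_{-\infty}^0e^r\omega(r)\,dr$ (so $z(\theta_t\omega)$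 is the stationary solution of $dz+z\,dt=dw$). $\Omega$ denotes a $\{\theta_t\}$-invariant subset of full $P$-measure (with the induced $\sigma$-algebra $\mathcal{F}$ and measure $P$) on which $t\mapsto z(\theta_t\omega)$ is continuous, $|z(\omega)|$ is tempered and, as $t\to\pm\infty$, $|\omega(t)|/|t|\to0$, $|z(\theta_t\omega)|/|t|\to0$ and $\frac1t\int_0^tz(\theta_s\omega)ds\to0$. Mild solution: a continuous $\ell^2$-valued function $v$ satisfying the system componentwise in integrated form. Under (A1)–(A4), for each $\tau\in\mathbb{R}$, $\omega\in\Omega$, $v_\tau\in\ell^2$ there is a unique mild solution $v(\cdot,\tau;\omega,v_\tau)$ on $[\tau,\infty)$, and $\Phi$ is a continuous cocycle, i.e.: $\Phi(\cdot,\tau,\cdot,\cdot)$ is $(\mathcal{B}(\mathbb{R}^+)\times\mathcal{F}\times\mathcal{B}(\ell^2),\mathcal{B}(\ell^2))$-measurable, $\Phi(0,\tau,\omega,\cdot)=\mathrm{id}$, $\Phi(t+s,\tau,\omega,\cdot)=\Phi(t,\tau+s,\theta_s\omega,\cdot)\circ\Phi(s,\tau,\omega,\cdot)$, and $\Phi(t,\tau,\omega,\cdot)$ is continuous. $\mathcal{D}(\ell^2)$ is the collection of all families $D=\{D(\tau,\omega):\tau\in\mathbb{R},\omega\in\Omega\}$ of bounded nonempty subsets of $\ell^2$ such that for every $\gamma>0$, $\lim_{s\to+\infty}e^{-\gamma s}\|D(\tau-s,\theta_{-s}\omega)\|^2=0$, where $\|D\|=\sup_{u\in D}\|u\|$ for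 a bounded set $D$. A $\mathcal{D}(\ell^2)$-pullback attractor for $\Phi$ is a family $\mathcal{A}\in\mathcal{D}(\ell^2)$ such that: each $\mathcal{A}(\tau,\omega)$ is compact and $\omega\mapsto\inf_{y\in\mathcal{A}(\tau,\omega)}\|x-y\|$ is measurable w.r.t. the $P$-completion of $\mathcal{F}$ for all $x\in\ell^2$, $\tau\in\mathbb{R}$; $\Phi(t,\tau,\omega,\mathcal{A}(\tau,\omega))=\mathcal{A}(\tau+t,\theta_t\omega)$ for all $t\ge0$; and for every $B\in\mathcal{D}(\ell^2)$ and all $\tau,\omega$, $\lim_{t\to\infty}d(\Phi(t,\tau-t,\theta_{-t}\omega,B(\tau-t,\theta_{-t}\omega)),\mathcal{A}(\tau,\omega))=0$, where $d(Y,Z)=\sup_{y\in Y}\inf_{x\in Z}\|y-x\|$. *)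

theory Defs
  imports "HOL-Probability.Probability"
begin

section \<open>The Hilbert space of square-summable bi-infinite real sequences\<close>

typedef ell2 = "{u :: int \<Rightarrow> real. (\<lambda>i. (u i)\<^sup>2) summable_on UNIV}"
  morphisms coord Abs_ell2
  by (rule exI[of _ "\<lambda>_. 0"]) simp

setup_lifting type_definition_ell2

lemma sq_summable_mult:
  fixes u v :: "int \<Rightarrow> real"
  assumes "(\<lambda>i. (u i)\<^sup>2) summable_on UNIV" "(\<lambda>i. (v i)\<^sup>2) summable_on UNIV"
  shows "(\<lambda>i. u i * v i) summable_on UNIV"
proof -
  have "(\<lambda>i. (u i)\<^sup>2 + (v i)\<^sup>2) summable_on UNIV"
    by (intro summable_on_add assms)
  then have "(\<lambda>i. norm (u i * v i)) summable_on UNIV"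
  proof (rule summable_on_comparison_test)
    fix i
    have "0 \<le> (\<bar>u i\<bar> - \<bar>v i\<bar>)\<^sup>2" "0 \<le> \<bar>u i\<bar> * \<bar>v i\<bar>" by simp_all
    then show "norm (u i * v i) \<le> (u i)\<^sup>2 + (v i)\<^sup>2"
      unfolding power2_diff power2_abs real_norm_def abs_mult by linarith
  qed simp
  then show ?thesis
    by (rule summable_on_iff_abs_summable_on_real[THEN iffD2])
qed

lemma sq_summable_add:
  fixes u v :: "int \<Rightarrow> real"
  assumes "(\<lambda>i. (u i)\<^sup>2) summable_on UNIV" "(\<lambda>i. (v i)\<^sup>2) summable_on UNIV"
  shows "(\<lambda>i. (u i + v i)\<^sup>2) summable_on UNIV"
proof -
  have "(\<lambda>i. ((u i)\<^sup>2 + (v i)\<^sup>2) + 2 * (u i * v i)) summable_on UNIV"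
    by (intro summable_on_add summable_on_cmult_right sq_summable_mult assms)
  then show ?thesis
    by (simp add: power2_sum algebra_simps)
qed

lemma sq_summable_scale:
  fixes u :: "int \<Rightarrow> real"
  assumes "(\<lambda>i. (u i)\<^sup>2) summable_on UNIV"
  shows "(\<lambda>i. (c * u i)\<^sup>2) summable_on UNIV"
  using summable_on_cmult_right[OF assms, of "c\<^sup>2"] by (simp add: power_mult_distrib)

instantiation ell2 :: real_inner
begin

lift_definition zero_ell2 :: ell2 is "\<lambda>_. 0" by simp

lift_definition plus_ell2 :: "ell2 \<Rightarrow> ell2 \<Rightarrow> ell2" is "\<lambda>u v i. u i + v i"
  by (rule sq_summable_add)

lift_definition uminus_ell2 :: "ell2 \<Rightarrow> ell2" is "\<lambda>u i. - u i" by simp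

lift_definition minus_ell2 :: "ell2 \<Rightarrow> ell2 \<Rightarrow> ell2" is "\<lambda>u v i. u i - v i"
proof -
  fix u v :: "int \<Rightarrow> real"
  assume "(\<lambda>i. (u i)\<^sup>2) summable_on UNIV" "(\<lambda>i. (v i)\<^sup>2) summable_on UNIV"
  then show "(\<lambda>i. (u i - v i)\<^sup>2) summable_on UNIV"
    using sq_summable_add[of u "\<lambda>i. - v i"] by simp
qed

lift_definition scaleR_ell2 :: "real \<Rightarrow> ell2 \<Rightarrow> ell2" is "\<lambda>c u i. c * u i"
  by (rule sq_summable_scale)

definition inner_ell2 :: "ell2 \<Rightarrow> ell2 \<Rightarrow> real"
  where "inner_ell2 u v = (\<Sum>\<^sub>\<infinity>i. coord u i * coord v i)"

definition norm_ell2 :: "ell2 \<Rightarrow> real"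
  where "norm_ell2 u = sqrt (inner u u)"

definition dist_ell2 :: "ell2 \<Rightarrow> ell2 \<Rightarrow> real"
  where "dist_ell2 u v = norm (u - v)"

definition sgn_ell2 :: "ell2 \<Rightarrow> ell2"
  where "sgn_ell2 u = inverse (norm u) *\<^sub>R u"

definition uniformity_ell2 :: "(ell2 \<times> ell2) filter"
  where "uniformity_ell2 = (INF e\<in>{0<..}. principal {(u, v). dist u v < e})"

definition open_ell2 :: "ell2 set \<Rightarrow> bool"
  where "open_ell2 S \<longleftrightarrow> (\<forall>u\<in>S. \<forall>\<^sub>F (u', v) in uniformity. u' = u \<longrightarrow> v \<in> S)"

instance
proof
  note S = coord[simplified mem_Collect_eq]
  have P: "(\<lambda>i. coord u i * coord v i) summable_on UNIV" for u v
    by (rule sq_summable_mult[OF S S])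
  fix u v w :: ell2 and a b :: real
  show "dist u v = norm (u - v)" by (rule dist_ell2_def)
  show "sgn u = inverse (norm u) *\<^sub>R u" by (rule sgn_ell2_def)
  show "uniformity = (INF e\<in>{0<..}. principal {(u :: ell2, v). dist u v < e})"
    by (rule uniformity_ell2_def)
  show "open U \<longleftrightarrow> (\<forall>u\<in>U. \<forall>\<^sub>F (u', v) in uniformity. u' = u \<longrightarrow> v \<in> U)" for U :: "ell2 set"
    by (rule open_ell2_def)
  show "norm u = sqrt (inner u u)" by (rule norm_ell2_def)
  show "u + v + w = u + (v + w)" by transfer (simp add: algebra_simps)
  show "u + v = v + u" by transfer (simp add: algebra_simps)
  show "0 + u = u" by transfer simp
  show "- u + u = 0" by transfer simp
  show "u - v = u + - v" by transfer simp
  show "a *\<^sub>R (u + v) = a *\<^sub>R u + a *\<^sub>R v" by transfer (simp add: algebra_simps)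
  show "(a + b) *\<^sub>R u = a *\<^sub>R u + b *\<^sub>R u" by transfer (simp add: algebra_simps)
  show "a *\<^sub>R b *\<^sub>R u = (a * b) *\<^sub>R u" by transfer (simp add: algebra_simps)
  show "1 *\<^sub>R u = u" by transfer simp
  show "inner u v = inner v u" by (simp add: inner_ell2_def mult.commute)
  show "inner (u + v) w = inner u w + inner v w"
    using infsum_add[OF P P] by (simp add: inner_ell2_def plus_ell2.rep_eq distrib_right)
  show "inner (a *\<^sub>R u) v = a * inner u v"
    by (simp add: inner_ell2_def scaleR_ell2.rep_eq mult.assoc infsum_cmult_right')
  show "0 \<le> inner u u" by (simp add: inner_ell2_def infsum_nonneg)
  show "inner u u = 0 \<longleftrightarrow> u = 0"
  proof
    assume "inner u u = 0"
    then have "coord u i * coord u i = 0" for i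
      by (intro nonneg_infsum_le_0D[where A = UNIV and f = "\<lambda>i. coord u i * coord u i"])
        (simp_all add: inner_ell2_def P)
    then show "u = 0" by (simp add: coord_inject[symmetric] zero_ell2.rep_eq fun_eq_iff)
  qed (simp add: inner_ell2_def zero_ell2.rep_eq)
qed

end

lemma norm_ell2_eq: "norm u = sqrt (\<Sum>\<^sub>\<infinity>i. (coord u i)\<^sup>2)"
  by (simp add: norm_ell2_def inner_ell2_def power2_eq_square)


section \<open>Two-sided Wiener space and the Ornstein--Uhlenbeck variable\<close>

definition path_space :: "(real \<Rightarrow> real) set"
  where "path_space = {\<omega>. continuous_on UNIV \<omega> \<and> \<omega> 0 = 0}"

definition compact_open_topology :: "(real \<Rightarrow> real) topology"
  where "compact_open_topology =
    topology_generated_by {{\<omega> \<in> path_space. \<omega> ` K \<subseteq> U} | K U. compact K \<and> open U}"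

definition path_sigma_algebra :: "(real \<Rightarrow> real) measure"
  where "path_sigma_algebra = sigma path_space {U. openin compact_open_topology U}"

text \<open>Wiener measure is the unique Borel probability on path space under which the increments over
  successive time intervals, negative times included, are independent and centred Gaussian with
  variance equal to the length of the interval.\<close>

definition wiener_measure :: "(real \<Rightarrow> real) measure \<Rightarrow> bool"
  where "wiener_measure P \<longleftrightarrow>
    prob_space P \<and>
    sets P = sets path_sigma_algebra \<and>
    (\<forall>s t. s < t \<longrightarrow> distributed P lborel (\<lambda>\<omega>. \<omega> t - \<omega> s) (normal_density 0 (sqrt (t - s)))) \<and>
    (\<forall>(n::nat) t. (\<forall>k<n. t k < t (Suc k)) \<longrightarrow>
      prob_space.indep_vars P (\<lambda>_. borel) (\<lambda>k \<omega>. \<omega> (t (Suc k)) - \<omega> (t k)) {..<n})"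

definition shift :: "real \<Rightarrow> (real \<Rightarrow> real) \<Rightarrow> real \<Rightarrow> real"  (\<open>\<theta>\<close>)
  where "\<theta> t \<omega> = (\<lambda>s. \<omega> (s + t) - \<omega> t)"

definition ou :: "(real \<Rightarrow> real) \<Rightarrow> real"
  where "ou \<omega> = - (LBINT r:{..0}. exp r * \<omega> r)"

definition noise_paths :: "(real \<Rightarrow> real) measure \<Rightarrow> (real \<Rightarrow> real) set \<Rightarrow> bool"
  where "noise_paths P \<Omega> \<longleftrightarrow>
    \<Omega> \<in> sets P \<and> measure P \<Omega> = 1 \<and>
    (\<forall>t. \<theta> t ` \<Omega> = \<Omega>) \<and>
    (\<forall>\<omega>\<in>\<Omega>.
      continuous_on UNIV (\<lambda>t. ou (\<theta> t \<omega>)) \<and>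
      (\<forall>\<gamma>>0. ((\<lambda>t. exp (- \<gamma> * t) * \<bar>ou (\<theta> (- t) \<omega>)\<bar>) \<longlongrightarrow> 0) at_top) \<and>
      (\<forall>F\<in>{at_top, at_bot}.
        ((\<lambda>t. \<bar>\<omega> t\<bar> / \<bar>t\<bar>) \<longlongrightarrow> 0) F \<and>
        ((\<lambda>t. \<bar>ou (\<theta> t \<omega>)\<bar> / \<bar>t\<bar>) \<longlongrightarrow> 0) F \<and>
        ((\<lambda>t. 1 / t * (LBINT s=0..t. ou (\<theta> s \<omega>))) \<longlongrightarrow> 0) F))"


section \<open>The lattice system\<close>

text \<open>Coefficients and nonlinearity are indexed first by the site: \<open>\<nu> i t\<close>,
  \<open>lam i t\<close>, \<open>f i x t\<close>.\<close>

definition bounded_coefficients :: "(int \<Rightarrow> real \<Rightarrow> real) \<Rightarrow> (int \<Rightarrow> real \<Rightarrow> real) \<Rightarrow> bool"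
  where "bounded_coefficients \<nu> lam \<longleftrightarrow>
    (\<forall>i a b. lam i absolutely_integrable_on {a..b} \<and> \<nu> i absolutely_integrable_on {a..b}) \<and>
    (\<exists>lam_lo lam_hi \<nu>_lo \<nu>_hi. 0 < lam_lo \<and> 0 < lam_hi \<and> 0 < \<nu>_lo \<and> 0 < \<nu>_hi \<and>
      (\<forall>i t. lam_lo \<le> lam i t \<and> lam i t \<le> lam_hi \<and> \<nu>_lo \<le> \<nu> i t \<and> \<nu> i t \<le> \<nu>_hi))"

definition dissipative_nonlinearity :: "(int \<Rightarrow> real \<Rightarrow> real \<Rightarrow> real) \<Rightarrow> bool"
  where "dissipative_nonlinearity f \<longleftrightarrow>
    (\<forall>i. continuous_on UNIV (\<lambda>(x, t). f i x t)) \<and>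
    (\<forall>i x t. (\<lambda>y. f i y t) differentiable (at x)) \<and>
    (\<forall>i t. f i 0 t = 0) \<and>
    (\<exists>\<alpha>\<in>bcontfun. \<forall>i x t. x * f i x t \<ge> - (coord (\<alpha> t) i)\<^sup>2) \<and>
    (\<exists>\<beta>\<ge>0. \<forall>i x t. deriv (\<lambda>y. f i y t) x \<ge> - \<beta>)"

definition locally_bounded_derivative :: "(int \<Rightarrow> real \<Rightarrow> real \<Rightarrow> real) \<Rightarrow> bool"
  where "locally_bounded_derivative f \<longleftrightarrow>
    (\<exists>\<zeta>. continuous_on ({0..} \<times> UNIV) (\<lambda>(\<iota>, t). \<zeta> \<iota> t) \<and>
      (\<forall>\<iota>\<ge>0. \<forall>t. \<zeta> \<iota> t > 0) \<and>
      (\<forall>\<iota>\<ge>0. \<forall>t i. \<forall>x\<in>{-\<iota>..\<iota>}. \<bar>deriv (\<lambda>y. f i y t) x\<bar> \<le> \<zeta> \<iota> t))"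

definition lap :: "(int \<Rightarrow> real) \<Rightarrow> int \<Rightarrow> real"
  where "lap v i = - v (i - 1) + 2 * v i - v (i + 1)"

definition lattice_rhs ::
  "(int \<Rightarrow> real \<Rightarrow> real) \<Rightarrow> (int \<Rightarrow> real \<Rightarrow> real) \<Rightarrow> (int \<Rightarrow> real \<Rightarrow> real \<Rightarrow> real) \<Rightarrow> (real \<Rightarrow> ell2) \<Rightarrow>
    (real \<Rightarrow> real) \<Rightarrow> real \<Rightarrow> ell2 \<Rightarrow> int \<Rightarrow> real"
  where "lattice_rhs \<nu> lam f g \<omega> t v i =
    - \<nu> i t * lap (coord v) i - lam i t * coord v i
    - exp (- ou (\<theta> t \<omega>)) * f i (exp (ou (\<theta> t \<omega>)) * coord v i) t
    + exp (- ou (\<theta> t \<omega>)) * coord (g t) i + ou (\<theta> t \<omega>) * coord v i"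

definition mild_solution ::
  "(int \<Rightarrow> real \<Rightarrow> real) \<Rightarrow> (int \<Rightarrow> real \<Rightarrow> real) \<Rightarrow> (int \<Rightarrow> real \<Rightarrow> real \<Rightarrow> real) \<Rightarrow> (real \<Rightarrow> ell2) \<Rightarrow>
    real \<Rightarrow> (real \<Rightarrow> real) \<Rightarrow> ell2 \<Rightarrow> (real \<Rightarrow> ell2) \<Rightarrow> bool"
  where "mild_solution \<nu> lam f g \<tau> \<omega> v\<tau> v \<longleftrightarrow>
    continuous_on {\<tau>..} v \<and> v \<tau> = v\<tau> \<and>
    (\<forall>i. \<forall>t\<ge>\<tau>.
      (\<lambda>s. lattice_rhs \<nu> lam f g \<omega> s (v s) i) absolutely_integrable_on {\<tau>..t} \<and>
      coord (v t) i = coord v\<tau> i + integral {\<tau>..t} (\<lambda>s. lattice_rhs \<nu> lam f g \<omega> s (v s) i))"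

text \<open>A mild solution is only determined on \<open>{\<tau>..}\<close>, so the description operator is applied to its
  value at time \<open>t \<ge> \<tau>\<close> rather than to the solution as a total function.\<close>

definition solution ::
  "(int \<Rightarrow> real \<Rightarrow> real) \<Rightarrow> (int \<Rightarrow> real \<Rightarrow> real) \<Rightarrow> (int \<Rightarrow> real \<Rightarrow> real \<Rightarrow> real) \<Rightarrow> (real \<Rightarrow> ell2) \<Rightarrow>
    real \<Rightarrow> real \<Rightarrow> (real \<Rightarrow> real) \<Rightarrow> ell2 \<Rightarrow> ell2"
  where "solution \<nu> lam f g t \<tau> \<omega> v\<tau> = (THE y. \<exists>v. mild_solution \<nu> lam f g \<tau> \<omega> v\<tau> v \<and> y = v t)"

definition cocycle ::
  "(int \<Rightarrow> real \<Rightarrow> real) \<Rightarrow> (int \<Rightarrow> real \<Rightarrow> real) \<Rightarrow> (int \<Rightarrow> real \<Rightarrow> real \<Rightarrow> real) \<Rightarrow> (real \<Rightarrow> ell2) \<Rightarrow>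
    real \<Rightarrow> real \<Rightarrow> (real \<Rightarrow> real) \<Rightarrow> ell2 \<Rightarrow> ell2"
  where "cocycle \<nu> lam f g t \<tau> \<omega> v\<tau> = solution \<nu> lam f g (t + \<tau>) \<tau> (\<theta> (- \<tau>) \<omega>) v\<tau>"


section \<open>Pullback attractors\<close>

text \<open>Families of sets are total functions; only their values at \<open>\<omega> \<in> \<Omega>\<close> are meaningful.\<close>

type_synonym family = "real \<Rightarrow> (real \<Rightarrow> real) \<Rightarrow> ell2 set"

definition set_norm :: "ell2 set \<Rightarrow> real"
  where "set_norm D = (SUP u\<in>D. norm u)"

definition tempered_families :: "(real \<Rightarrow> real) set \<Rightarrow> family set"
  where "tempered_families \<Omega> = {D. \<forall>\<tau>. \<forall>\<omega>\<in>\<Omega>.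
    bounded (D \<tau> \<omega>) \<and> D \<tau> \<omega> \<noteq> {} \<and>
    (\<forall>\<gamma>>0. ((\<lambda>s. exp (- \<gamma> * s) * (set_norm (D (\<tau> - s) (\<theta> (- s) \<omega>)))\<^sup>2) \<longlongrightarrow> 0) at_top)}"

definition hausdorff_semidist :: "ell2 set \<Rightarrow> ell2 set \<Rightarrow> ennreal"
  where "hausdorff_semidist Y Z = (SUP y\<in>Y. ennreal (infdist y Z))"

definition pullback_attractor ::
  "(real \<Rightarrow> real) measure \<Rightarrow> (real \<Rightarrow> real) set \<Rightarrow>
    (real \<Rightarrow> real \<Rightarrow> (real \<Rightarrow> real) \<Rightarrow> ell2 \<Rightarrow> ell2) \<Rightarrow> family \<Rightarrow> bool"
  where "pullback_attractor P \<Omega> \<Phi> A \<longleftrightarrow>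
    A \<in> tempered_families \<Omega> \<and>
    (\<forall>\<tau>. \<forall>\<omega>\<in>\<Omega>. compact (A \<tau> \<omega>)) \<and>
    (\<forall>x \<tau>. (\<lambda>\<omega>. infdist x (A \<tau> \<omega>)) \<in> borel_measurable (completion (restrict_space P \<Omega>))) \<and>
    (\<forall>t\<ge>0. \<forall>\<tau>. \<forall>\<omega>\<in>\<Omega>. \<Phi> t \<tau> \<omega> ` A \<tau> \<omega> = A (\<tau> + t) (\<theta> t \<omega>)) \<and>
    (\<forall>B\<in>tempered_families \<Omega>. \<forall>\<tau>. \<forall>\<omega>\<in>\<Omega>.
      ((\<lambda>t. hausdorff_semidist
          (\<Phi> t (\<tau> - t) (\<theta> (- t) \<omega>) ` B (\<tau> - t) (\<theta> (- t) \<omega>)) (A \<tau> \<omega>)) \<longlongrightarrow> 0) at_top)"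

end

theory Submission
  imports Defs
begin

text \<open>Since \<open>\<nu> i\<close> depends on the site, \<open>\<nu> A\<close> is not dissipative in \<open>ell2\<close> and an energy estimate is not
  available.  The squares \<open>w i = (v i)\<^sup>2\<close> however satisfy the cooperative system of inequalities
  \<open>w' i \<le> \<nu> i (w (i - 1) - 2 w i + w (i + 1)) + (2 z - lam_lo) w i + exp (- 2 z) h i\<close>, up to small errors.
  Convolving the data with a slowly decaying geometric weight turns them into supersolutions of
  this system at the price of an arbitrarily small loss in the decay rate.  This bounds each
  \<open>(v i)\<^sup>2\<close> by a term forgetting the initial value exponentially and a term that is summable over the
  sites and, as \<open>z\<close> grows sublinearly, converges when the initial time tends to \<open>- \<infinity>\<close>.  Its limit defines a
  compact box in \<open>ell2\<close> that attracts a tempered absorbing ball, and the attractor is the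
  omega-limit set of this ball.\<close>


section \<open>The sequence space\<close>

text \<open>The factor \<open>\<nu> i\<close> stands outside the difference operator, so summation
  by parts would leave differences of \<open>\<nu>\<close> without a sign; at a single site Young's
  inequality works for every nonnegative \<open>\<nu> i\<close>. The dissipation
  \<open>2 * lam_lo\<close> pays for everything: one quarter goes to the reaction and forcing terms,
  one quarter to the coupling, and half remains in \<open>rate\<close>. As \<open>solution\<close>
  is a description operator, well-posedness is part of the proof. The reaction is only locally
  Lipschitz: its argument is cut off at level \<open>R\<close>, the resulting system is solved by
  Picard iteration, and the site bound, which does not contain \<open>R\<close>, removes the
  cut-off. All solutions are explicit pointwise limits, so their measurability in the path comes
  from the construction. In a fibre \<open>(\<tau>, \<omega>)\<close> all pulled-back solutions see
  the same path \<open>ou_path \<tau> \<omega>\<close> and only the initial time moves, so the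
  dynamics reduces to deterministic estimates along one path.\<close>

lemmas coord_simps = zero_ell2.rep_eq plus_ell2.rep_eq uminus_ell2.rep_eq minus_ell2.rep_eq
  scaleR_ell2.rep_eq

lemma coord_summable: "(\<lambda>i. (coord u i)\<^sup>2) summable_on UNIV"
  using coord by simp

lemma norm_sq_ell2: "(norm u)\<^sup>2 = (\<Sum>\<^sub>\<infinity>i. (coord u i)\<^sup>2)"
  by (simp add: norm_ell2_eq infsum_nonneg)

lemma sum_coord_sq_le: "finite J \<Longrightarrow> (\<Sum>i\<in>J. (coord u i)\<^sup>2) \<le> (norm u)\<^sup>2"
  unfolding norm_sq_ell2 by (rule finite_sum_le_infsum[OF coord_summable]) auto

lemma abs_coord_le_norm: "\<bar>coord u i\<bar> \<le> norm u"
  using sum_coord_sq_le[of "{i}" u] by (simp add: power2_le_iff_abs_le)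

text \<open>Norm bounds are proved through finite partial sums throughout: these pass to pointwise
  limits and under integrals, where infinite sums would need a separate convergence
  argument.\<close>

lemma ell2_normI:
  assumes "0 \<le> C" "\<And>J. finite J \<Longrightarrow> (\<Sum>i\<in>J. (coord u i)\<^sup>2) \<le> C\<^sup>2"
  shows "norm u \<le> C"
proof -
  have "(norm u)\<^sup>2 \<le> C\<^sup>2"
    unfolding norm_sq_ell2 by (rule infsum_le_finite_sums[OF coord_summable]) (use assms in auto)
  then show ?thesis using assms(1) by (rule power2_le_imp_le)
qed

lemma ell2_ext: "(\<And>i. coord u i = coord v i) \<Longrightarrow> u = v"
  by (simp add: coord_inject[symmetric] fun_eq_iff)

text \<open>\<open>Abs_ell2\<close> is meaningful only on square-summable sequences; bounded finite
  partial sums are the form in which summability is at hand later.\<close>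

lemma coord_Abs_ell2_bounded:
  assumes "\<And>J. finite J \<Longrightarrow> (\<Sum>i\<in>J. (y i)\<^sup>2) \<le> B"
  shows "coord (Abs_ell2 y) = y"
proof (rule Abs_ell2_inverse)
  show "y \<in> {u. (\<lambda>i. (u i)\<^sup>2) summable_on UNIV}"
    using nonneg_bounded_partial_sums_imp_summable_on[of UNIV "\<lambda>i. (y i)\<^sup>2" B]
      eventually_finite_subsets_at_top_weakI[of UNIV "\<lambda>J. (\<Sum>i\<in>J. (y i)\<^sup>2) \<le> B"] assms by auto
qed

lemma ell2_dominated:
  assumes "\<And>i. \<bar>y i\<bar> \<le> coord x i"
  shows "coord (Abs_ell2 y) = y" "norm (Abs_ell2 y) \<le> norm x"
proof -
  have le: "(\<Sum>i\<in>J. (y i)\<^sup>2) \<le> (norm x)\<^sup>2" if "finite J" for J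
  proof -
    have "(\<Sum>i\<in>J. (y i)\<^sup>2) \<le> (\<Sum>i\<in>J. (coord x i)\<^sup>2)"
      by (intro sum_mono) (metis abs_le_square_iff assms abs_ge_self order_trans)
    then show ?thesis using sum_coord_sq_le[OF that, of x] by linarith
  qed
  show *: "coord (Abs_ell2 y) = y" by (rule coord_Abs_ell2_bounded) (rule le)
  show "norm (Abs_ell2 y) \<le> norm x" by (rule ell2_normI) (simp_all add: * le)
qed

lemma bounded_linear_coord: "bounded_linear (\<lambda>u. coord u i)"
  by (rule bounded_linear_intro[where K=1]) (auto simp: coord_simps abs_coord_le_norm)

lemmas continuous_on_coord = bounded_linear.continuous_on[OF bounded_linear_coord]

lemmas tendsto_coord = bounded_linear.tendsto[OF bounded_linear_coord]

instance ell2 :: complete_space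
proof
  fix X :: "nat \<Rightarrow> ell2"
  assume C: "Cauchy X"
  have "Cauchy (\<lambda>n. coord (X n) i)" for i
  proof (rule metric_CauchyI)
    fix e :: real assume "0 < e"
    then obtain M where "\<forall>m\<ge>M. \<forall>n\<ge>M. dist (X m) (X n) < e" using C by (meson metric_CauchyD)
    moreover have "dist (coord (X m) i) (coord (X n) i) \<le> dist (X m) (X n)" for m n
      using abs_coord_le_norm[of "X m - X n" i] by (simp add: dist_norm coord_simps)
    ultimately show "\<exists>M. \<forall>m\<ge>M. \<forall>n\<ge>M. dist (coord (X m) i) (coord (X n) i) < e"
      by (meson order_le_less_trans)
  qed
  then have "\<exists>l. (\<lambda>n. coord (X n) i) \<longlonglongrightarrow> l" for i
    using Cauchy_convergent convergent_def by blast
  then obtain y where y: "\<And>i. (\<lambda>n. coord (X n) i) \<longlonglongrightarrow> y i" by metis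
  \<comment> \<open>Used twice: with \<open>u = 0\<close> it makes the coordinatewise limit
    square-summable, with \<open>u = X m\<close> it turns the Cauchy estimate into convergence in
    norm.\<close>
  have lim: "(\<Sum>i\<in>J. (coord u i - y i)\<^sup>2) \<le> e\<^sup>2"
    if "finite J" "\<And>n. n \<ge> N \<Longrightarrow> norm (u - X n) \<le> e" "0 \<le> e" for J u e and N :: nat
  proof (rule tendsto_upperbound)
    show "(\<lambda>n. \<Sum>i\<in>J. (coord u i - coord (X n) i)\<^sup>2) \<longlonglongrightarrow> (\<Sum>i\<in>J. (coord u i - y i)\<^sup>2)"
      by (intro tendsto_intros y)
    show "\<forall>\<^sub>F n in sequentially. (\<Sum>i\<in>J. (coord u i - coord (X n) i)\<^sup>2) \<le> e\<^sup>2"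
      using sum_coord_sq_le[OF that(1), of "u - X n" for n] that(2,3)
      by (intro eventually_sequentiallyI[of N]) (smt (verit, best) minus_ell2.rep_eq norm_ge_zero power_mono sum.cong)
  qed auto
  obtain B where B: "\<And>n. norm (X n) \<le> B"
    using Cauchy_Bseq[OF C] by (auto simp: Bseq_def)
  have B0: "0 \<le> B" using B[of 0] norm_ge_zero order_trans by blast
  have cy: "coord (Abs_ell2 y) = y"
    by (rule coord_Abs_ell2_bounded[where B="B\<^sup>2"])
      (use lim[of _ 0 0 B] B B0 in \<open>auto simp: coord_simps\<close>)
  have "X \<longlonglongrightarrow> Abs_ell2 y"
  proof (rule metric_LIMSEQ_I)
    fix e :: real assume "0 < e"
    then obtain M where M: "\<forall>m\<ge>M. \<forall>n\<ge>M. dist (X m) (X n) < e/2"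
      using C by (meson half_gt_zero metric_CauchyD)
    have "norm (X m - Abs_ell2 y) \<le> e/2" if "m \<ge> M" for m
      by (rule ell2_normI)
        (use M that \<open>0<e\<close> lim[of _ M "X m" "e/2"] in \<open>auto simp: coord_simps cy dist_norm less_imp_le\<close>)
    then show "\<exists>no. \<forall>n\<ge>no. dist (X n) (Abs_ell2 y) < e"
      using \<open>0<e\<close> by (auto simp: dist_norm intro!: exI[of _ M]) (smt (verit) field_sum_of_halves)
  qed
  then show "convergent X" by (auto simp: convergent_def)
qed

lemma tail_coord_sq_less:
  assumes "0 < e"
  obtains J where "finite J" "\<And>K. finite K \<Longrightarrow> K \<inter> J = {} \<Longrightarrow> (\<Sum>i\<in>K. (coord u i)\<^sup>2) < e"
proof -
  obtain J where J: "finite J" "dist (\<Sum>i\<in>J. (coord u i)\<^sup>2) (\<Sum>\<^sub>\<infinity>i. (coord u i)\<^sup>2) \<le> e/2"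
    using infsum_finite_approximation[OF coord_summable, of "e/2" u] assms by auto
  have "(\<Sum>i\<in>K. (coord u i)\<^sup>2) < e" if "finite K" "K \<inter> J = {}" for K
  proof -
    have "(\<Sum>i\<in>K. (coord u i)\<^sup>2) + (\<Sum>i\<in>J. (coord u i)\<^sup>2) \<le> (norm u)\<^sup>2"
      using sum_coord_sq_le[of "K \<union> J" u] that J(1) by (simp add: sum.union_disjoint)
    then show ?thesis using J(2) assms unfolding norm_sq_ell2 dist_real_def by linarith
  qed
  then show ?thesis using that J(1) by blast
qed

text \<open>On a box with square-summable half-sides the norm topology is that of pointwise convergence,
  so Tychonoff's theorem applies.\<close>

lemma compact_ell2_box: "compact {u. \<forall>i. \<bar>coord u i\<bar> \<le> coord r i}"
proof -
  define S where "S = Pi\<^sub>E UNIV (\<lambda>i. {- coord r i..coord r i})"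
  have "compactin (product_topology (\<lambda>i. euclidean) UNIV) S"
    unfolding S_def by (subst compactin_PiE) auto
  then have S: "compact S"
    by (simp add: euclidean_product_topology)
  have cS: "coord (Abs_ell2 y) = y" if "y \<in> S" for y
    by (rule ell2_dominated(1)[of _ r]) (use that in \<open>auto simp: S_def abs_le_iff PiE_iff minus_le_iff\<close>)
  have "continuous_on S Abs_ell2"
    unfolding continuous_on_def
  proof (intro ballI)
    fix y assume y: "y \<in> S"
    have ptw: "((\<lambda>x. x i) \<longlongrightarrow> y i) (at y within S)" for i
    proof -
      have "continuous_on S (\<lambda>x. x i)"
        by (rule continuous_on_subset[OF continuous_on_product_coordinates subset_UNIV])
      then show ?thesis using y by (simp only: continuous_on_def)
    qed
    show "(Abs_ell2 \<longlongrightarrow> Abs_ell2 y) (at y within S)"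
    proof (rule tendstoI)
      fix e :: real assume e: "0 < e"
      \<comment> \<open>Sites in \<open>J\<close> are controlled by pointwise convergence; off
        \<open>J\<close> the difference is at most \<open>2 * coord r i\<close>, so the tail
        contributes less than \<open>4 * (e\<^sup>2/16)\<close>.\<close>
      obtain J where J: "finite J" "\<And>K. finite K \<Longrightarrow> K \<inter> J = {} \<Longrightarrow> (\<Sum>i\<in>K. (coord r i)\<^sup>2) < e\<^sup>2/16"
        using tail_coord_sq_less[of "e\<^sup>2/16" r] e by auto
      have "((\<lambda>x. \<Sum>i\<in>J. (x i - y i)\<^sup>2) \<longlongrightarrow> (\<Sum>i\<in>J. (y i - y i)\<^sup>2)) (at y within S)"
        by (intro tendsto_intros ptw)
      then have "\<forall>\<^sub>F x in at y within S. (\<Sum>i\<in>J. (x i - y i)\<^sup>2) < e\<^sup>2/4"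
        by (rule order_tendstoD) (use e in auto)
      moreover have "\<forall>\<^sub>F x in at y within S. x \<in> S" by (simp add: eventually_at_filter)
      ultimately show "\<forall>\<^sub>F x in at y within S. dist (Abs_ell2 x) (Abs_ell2 y) < e"
      proof eventually_elim
        case (elim x)
        have "norm (Abs_ell2 x - Abs_ell2 y) \<le> sqrt (e\<^sup>2/2)"
        proof (rule ell2_normI)
          fix K :: "int set" assume K: "finite K"
          have "(\<Sum>i\<in>K. (x i - y i)\<^sup>2) = (\<Sum>i\<in>K\<inter>J. (x i - y i)\<^sup>2) + (\<Sum>i\<in>K-J. (x i - y i)\<^sup>2)"
            using sum.Int_Diff[OF K, of _ J] by blast
          also have "(\<Sum>i\<in>K\<inter>J. (x i - y i)\<^sup>2) \<le> (\<Sum>i\<in>J. (x i - y i)\<^sup>2)"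
            by (rule sum_mono2) (use J in auto)
          also have "(\<Sum>i\<in>K-J. (x i - y i)\<^sup>2) \<le> (\<Sum>i\<in>K-J. 4 * (coord r i)\<^sup>2)"
          proof (rule sum_mono)
            fix i
            have "\<bar>x i - y i\<bar> \<le> \<bar>2 * coord r i\<bar>"
              using y elim(2) by (auto simp: S_def PiE_iff) (smt (verit))
            then show "(x i - y i)\<^sup>2 \<le> 4 * (coord r i)\<^sup>2"
              using abs_le_square_iff[of "x i - y i" "2 * coord r i"] by (simp add: power_mult_distrib)
          qed
          also have "\<dots> < 4 * (e\<^sup>2/16)"
            using J(2)[of "K - J"] K by (simp add: sum_distrib_left[symmetric] mult.commute Int_commute)
          finally have "(\<Sum>i\<in>K. (x i - y i)\<^sup>2) < e\<^sup>2/2" using elim(1) by simp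
          then show "(\<Sum>i\<in>K. (coord (Abs_ell2 x - Abs_ell2 y) i)\<^sup>2) \<le> (sqrt (e\<^sup>2/2))\<^sup>2"
            by (simp add: coord_simps cS y elim(2))
        qed simp
        also have "\<dots> < e" using e by (intro real_less_lsqrt) auto
        finally show ?case by (simp add: dist_norm)
      qed
    qed
  qed
  then have "compact (Abs_ell2 ` S)" using S by (rule compact_continuous_image)
  moreover have "Abs_ell2 ` S = {u. \<forall>i. \<bar>coord u i\<bar> \<le> coord r i}"
  proof (intro equalityI subsetI)
    fix u assume "u \<in> Abs_ell2 ` S"
    then show "u \<in> {u. \<forall>i. \<bar>coord u i\<bar> \<le> coord r i}"
      by (auto simp: cS) (auto simp: S_def PiE_iff abs_le_iff minus_le_iff)
  next
    fix u assume "u \<in> {u. \<forall>i. \<bar>coord u i\<bar> \<le> coord r i}"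
    then have "coord u \<in> S" by (auto simp: S_def PiE_iff abs_le_iff minus_le_iff)
    then show "u \<in> Abs_ell2 ` S" using coord_inverse[of u] by (metis image_eqI)
  qed
  ultimately show ?thesis by simp
qed

text \<open>Finitely supported rational sequences are dense. Coding them by a radius and a list of
  rationals makes the index type countable, so that \<open>from_nat\<close> enumerates them; lists
  of the wrong length do no harm.\<close>

lemma ell2_separable:
  obtains q :: "nat \<Rightarrow> ell2" where "\<And>u e. 0 < e \<Longrightarrow> \<exists>k. dist (q k) u < e"
proof -
  define F where "F = (\<lambda>(n::nat, xs) i. if \<bar>i\<bar> \<le> int n then real_of_rat (xs ! nat (i + int n)) else 0)"
  have cF: "coord (Abs_ell2 (F p)) = F p" for p
  proof (rule coord_Abs_ell2_bounded)
    obtain n xs where p: "p = (n, xs)" by fastforce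
    fix J :: "int set" assume J: "finite J"
    have "(\<Sum>i\<in>J. (F p i)\<^sup>2) = (\<Sum>i\<in>J\<inter>{-int n..int n}. (F p i)\<^sup>2)"
      by (rule sum.mono_neutral_right) (use J in \<open>auto simp: p F_def\<close>)
    also have "\<dots> \<le> (\<Sum>i\<in>{-int n..int n}. (F p i)\<^sup>2)" by (rule sum_mono2) auto
    finally show "(\<Sum>i\<in>J. (F p i)\<^sup>2) \<le> (\<Sum>i\<in>{-int (fst p)..int (fst p)}. (F p i)\<^sup>2)"
      by (simp add: p)
  qed
  have dense: "\<exists>p. dist (Abs_ell2 (F p)) u < e" if e: "0 < e" for u e
  proof -
    obtain J where J: "finite J" "\<And>K. finite K \<Longrightarrow> K \<inter> J = {} \<Longrightarrow> (\<Sum>i\<in>K. (coord u i)\<^sup>2) < e\<^sup>2/4"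
      using tail_coord_sq_less[of "e\<^sup>2/4" u] e by auto
    obtain n :: nat where n: "\<And>i. i \<in> J \<Longrightarrow> \<bar>i\<bar> \<le> int n"
    proof
      fix i assume "i \<in> J"
      then have "\<bar>i\<bar> \<le> Max (insert 0 (abs ` J))" using J(1) by (intro Max_ge) auto
      then show "\<bar>i\<bar> \<le> int (nat (Max (insert 0 (abs ` J))))" by linarith
    qed
    \<comment> \<open>With \<open>2 * n + 1\<close> sites, each off by at most \<open>d\<close>, the
      total \<open>(2 * n + 1) * d\<^sup>2\<close> is at most
      \<open>((2 * n + 1) * d)\<^sup>2 = e\<^sup>2/4\<close>.\<close>
    define d where "d = e / (2 * real (2 * n + 1))"
    have d: "0 < d" using e by (simp add: d_def)
    have "\<exists>q. \<bar>real_of_rat q - c\<bar> < d" for c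
      using of_rat_dense[of c "c + d"] d by (auto simp: abs_if) (smt (verit))
    then obtain q where q: "\<And>c. \<bar>real_of_rat (q c) - c\<bar> < d" by metis
    define xs where "xs = map (\<lambda>k. q (coord u (int k - int n))) [0..<2*n+1]"
    have Fin: "\<bar>F (n, xs) i - coord u i\<bar> < d" if "\<bar>i\<bar> \<le> int n" for i
    proof -
      have "nat (i + int n) < 2*n+1" using that by linarith
      then have "xs ! nat (i + int n) = q (coord u i)"
        using that unfolding xs_def by (subst nth_map) (auto simp del: upt_Suc)
      then show ?thesis using that q by (simp add: F_def)
    qed
    have "norm (Abs_ell2 (F (n, xs)) - u) \<le> sqrt (e\<^sup>2/2)"
    proof (rule ell2_normI)
      fix K :: "int set" assume K: "finite K"
      let ?I = "{-int n..int n}"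
      have "(\<Sum>i\<in>K. (F (n,xs) i - coord u i)\<^sup>2)
        = (\<Sum>i\<in>K\<inter>?I. (F (n,xs) i - coord u i)\<^sup>2) + (\<Sum>i\<in>K-?I. (F (n,xs) i - coord u i)\<^sup>2)"
        using sum.Int_Diff[OF K, of _ ?I] by blast
      also have "(\<Sum>i\<in>K\<inter>?I. (F (n,xs) i - coord u i)\<^sup>2) \<le> (\<Sum>i\<in>?I. (F (n,xs) i - coord u i)\<^sup>2)"
        by (rule sum_mono2) auto
      also have "\<dots> \<le> (\<Sum>i\<in>?I. d\<^sup>2)"
        proof (rule sum_mono)
        fix i assume "i \<in> ?I"
        then have "\<bar>F (n,xs) i - coord u i\<bar> < d" by (intro Fin) auto
        then show "(F (n,xs) i - coord u i)\<^sup>2 \<le> d\<^sup>2"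
          using d by (simp add: abs_le_square_iff[symmetric])
      qed
      also have "\<dots> = real (2 * n + 1) * d\<^sup>2" by (simp add: algebra_simps)
      also have "\<dots> \<le> (real (2 * n + 1))\<^sup>2 * d\<^sup>2"
        by (intro mult_right_mono self_le_power) auto
      also have "\<dots> = e\<^sup>2/4" proof -
        have "2 * (real (2 * n + 1) * d) = e" by (simp add: d_def field_simps)
        then have "(2 * (real (2 * n + 1) * d))\<^sup>2 = e\<^sup>2" by simp
        then show ?thesis by (simp only: power_mult_distrib) simp
      qed
      also have "(\<Sum>i\<in>K-?I. (F (n,xs) i - coord u i)\<^sup>2) = (\<Sum>i\<in>K-?I. (coord u i)\<^sup>2)"
        by (rule sum.cong) (auto simp: F_def)
      also have "\<dots> < e\<^sup>2/4" by (rule J(2)) (use K n in force)+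
      finally show "(\<Sum>i\<in>K. (coord (Abs_ell2 (F (n, xs)) - u) i)\<^sup>2) \<le> (sqrt (e\<^sup>2/2))\<^sup>2"
        by (simp add: coord_simps cF)
    qed simp
    also have "\<dots> < e" using e by (intro real_less_lsqrt) auto
    finally show ?thesis by (auto simp: dist_norm)
  qed
  show ?thesis
    by (rule that[of "\<lambda>k. Abs_ell2 (F (from_nat k))"]) (metis dense from_nat_to_nat)
qed

text \<open>The sequence is dominated by a combination of three translates of
  \<open>\<bar>x\<bar>\<close>, each with at most the norm of \<open>x\<close>. Estimates for the
  lattice coupling have this shape; \<open>a = 0\<close> also covers diagonal operators.\<close>

lemma ell2_neighbour_bound:
  assumes a: "0 \<le> a" and b: "0 \<le> b"
    and y: "\<And>i. \<bar>y i\<bar> \<le> a * \<bar>coord x (i - 1)\<bar> + b * \<bar>coord x i\<bar> + a * \<bar>coord x (i + 1)\<bar>"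
  shows "coord (Abs_ell2 y) = y" "norm (Abs_ell2 y) \<le> (2 * a + b) * norm x"
proof -
  have sh: "coord (Abs_ell2 (\<lambda>i. \<bar>coord x (i + k)\<bar>)) = (\<lambda>i. \<bar>coord x (i + k)\<bar>)"
    "norm (Abs_ell2 (\<lambda>i. \<bar>coord x (i + k)\<bar>)) \<le> norm x" for k
  proof -
    have le: "(\<Sum>i\<in>J. \<bar>coord x (i + k)\<bar>\<^sup>2) \<le> (norm x)\<^sup>2" if "finite J" for J
    proof -
      have "(\<Sum>i\<in>J. \<bar>coord x (i + k)\<bar>\<^sup>2) = (\<Sum>i\<in>(\<lambda>i. i + k) ` J. (coord x i)\<^sup>2)"
        by (subst sum.reindex) (auto simp: inj_on_def)
      then show ?thesis using sum_coord_sq_le[of "(\<lambda>i. i + k) ` J" x] that by simp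
    qed
    show *: "coord (Abs_ell2 (\<lambda>i. \<bar>coord x (i + k)\<bar>)) = (\<lambda>i. \<bar>coord x (i + k)\<bar>)"
      by (rule coord_Abs_ell2_bounded) (rule le)
    show "norm (Abs_ell2 (\<lambda>i. \<bar>coord x (i + k)\<bar>)) \<le> norm x"
      by (rule ell2_normI) (use le in \<open>simp_all add: *\<close>)
  qed
  define X where "X = a *\<^sub>R Abs_ell2 (\<lambda>i. \<bar>coord x (i + - 1)\<bar>)
    + b *\<^sub>R Abs_ell2 (\<lambda>i. \<bar>coord x (i + 0)\<bar>) + a *\<^sub>R Abs_ell2 (\<lambda>i. \<bar>coord x (i + 1)\<bar>)"
  have cX: "\<bar>y i\<bar> \<le> coord X i" for i
    using y[of i] sh(1)[of "-1"] sh(1)[of 0] sh(1)[of 1] by (simp add: X_def coord_simps)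
  show "coord (Abs_ell2 y) = y" by (rule ell2_dominated(1)) (rule cX)
  have "norm (Abs_ell2 y) \<le> norm X" by (rule ell2_dominated(2)) (rule cX)
  also have "\<dots> \<le> a * norm x + b * norm x + a * norm x"
    unfolding X_def using a b
    by (intro order_trans[OF norm_triangle_ineq] add_mono order_refl)
      (auto simp del: add_0_right add_uminus_conv_diff intro!: mult_left_mono sh(2))
  finally show "norm (Abs_ell2 y) \<le> (2 * a + b) * norm x" by (simp add: algebra_simps)
qed


section \<open>Integral inequalities\<close>

lemma absolutely_integrable_mult_continuous:
  fixes f c :: "real \<Rightarrow> real"
  assumes "f absolutely_integrable_on {a..b}" "continuous_on {a..b} c"
  shows "(\<lambda>s. f s * c s) absolutely_integrable_on {a..b}"
proof -
  have "(\<lambda>s. c s * f s) absolutely_integrable_on {a..b}"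
  proof (rule absolutely_integrable_bounded_measurable_product_real)
    show "c \<in> borel_measurable (lebesgue_on {a..b})"
      by (rule continuous_imp_measurable_on_sets_lebesgue[OF assms(2)]) simp
    show "bounded (c ` {a..b})"
      using assms(2) compact_continuous_image compact_imp_bounded by blast
  qed (use assms in auto)
  then show ?thesis by (simp add: mult.commute)
qed

text \<open>Minkowski's integral inequality without an \<open>ell2\<close>-valued integral: pairing
  the vector of integrals with itself on a finite set of sites bounds its squared length by its
  length times \<open>integral {a..b} \<psi>\<close>, and one factor cancels.\<close>

lemma ell2_integral_norm_le:
  fixes G :: "real \<Rightarrow> ell2"
  assumes G: "\<And>i. (\<lambda>s. coord (G s) i) integrable_on {a..b}"
    and \<psi>: "\<psi> integrable_on {a..b}" "\<And>s. s \<in> {a..b} \<Longrightarrow> norm (G s) \<le> \<psi> s"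
  defines "y \<equiv> \<lambda>i. integral {a..b} (\<lambda>s. coord (G s) i)"
  shows "coord (Abs_ell2 y) = y" "norm (Abs_ell2 y) \<le> integral {a..b} \<psi>"
proof -
  define I where "I = integral {a..b} \<psi>"
  have I0: "0 \<le> I" unfolding I_def
    by (rule integral_nonneg[OF \<psi>(1)]) (meson \<psi>(2) norm_ge_zero order_trans)
  have le: "(\<Sum>i\<in>J. (y i)\<^sup>2) \<le> I\<^sup>2" if J: "finite J" for J
  proof -
    let ?S = "L2_set y J"
    have "(\<Sum>i\<in>J. (y i)\<^sup>2) = integral {a..b} (\<lambda>s. \<Sum>i\<in>J. y i * coord (G s) i)"
      by (subst integral_sum) (use J G in \<open>auto simp: y_def power2_eq_square intro!: integrable_on_mult_right\<close>)
    also have "\<dots> \<le> integral {a..b} (\<lambda>s. ?S * \<psi> s)"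
    proof (rule integral_le)
      show "(\<lambda>s. \<Sum>i\<in>J. y i * coord (G s) i) integrable_on {a..b}"
        by (intro integrable_sum J integrable_on_mult_right G)
      show "(\<lambda>s. ?S * \<psi> s) integrable_on {a..b}" by (intro integrable_on_mult_right \<psi>)
      fix s assume s: "s \<in> {a..b}"
      have "(\<Sum>i\<in>J. y i * coord (G s) i) \<le> (\<Sum>i\<in>J. \<bar>y i\<bar> * \<bar>coord (G s) i\<bar>)"
        by (intro sum_mono) (metis abs_ge_self abs_mult)
      also have "\<dots> \<le> ?S * L2_set (coord (G s)) J" by (rule L2_set_mult_ineq)
      also have "\<dots> \<le> ?S * \<psi> s"
      proof (rule mult_left_mono)
        have "L2_set (coord (G s)) J \<le> norm (G s)"
          unfolding L2_set_def by (rule real_le_lsqrt) (use sum_coord_sq_le[OF J] in \<open>auto intro: sum_nonneg\<close>)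
        then show "L2_set (coord (G s)) J \<le> \<psi> s" using \<psi>(2)[OF s] by linarith
      qed simp
      finally show "(\<Sum>i\<in>J. y i * coord (G s) i) \<le> ?S * \<psi> s" .
    qed
    also have "\<dots> = ?S * I" by (simp add: I_def)
    finally have *: "(\<Sum>i\<in>J. (y i)\<^sup>2) \<le> ?S * I" .
    have sq: "(\<Sum>i\<in>J. (y i)\<^sup>2) = ?S\<^sup>2" by (simp add: L2_set_def sum_nonneg)
    have "?S \<le> I"
    proof (cases "?S = 0")
      case False
      then have "0 < ?S" using L2_set_nonneg[of y J] by linarith
      then show ?thesis using * sq by (simp add: power2_eq_square)
    qed (use I0 in simp)
    then show ?thesis unfolding sq by (intro power_mono) auto
  qed
  show c: "coord (Abs_ell2 y) = y" by (rule coord_Abs_ell2_bounded) (rule le)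
  show "norm (Abs_ell2 y) \<le> integral {a..b} \<psi>"
    unfolding I_def[symmetric] by (rule ell2_normI) (use I0 le in \<open>simp_all add: c\<close>)
qed

lemma has_integral_exp_linear:
  fixes \<kappa> a t :: real
  assumes "\<kappa> \<noteq> 0" "a \<le> t"
  shows "((\<lambda>s. exp (\<kappa> * (s - c))) has_integral (exp (\<kappa> * (t - c)) - exp (\<kappa> * (a - c))) / \<kappa>) {a..t}"
proof -
  have "((\<lambda>s. exp (\<kappa> * (s - c)) / \<kappa>) has_vector_derivative exp (\<kappa> * (s - c))) (at s within {a..t})" for s
    unfolding has_real_derivative_iff_has_vector_derivative[symmetric]
    using assms by (auto intro!: derivative_eq_intros)
  from fundamental_theorem_of_calculus[OF assms(2) this] show ?thesis
    by (simp add: diff_divide_distrib)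
qed

lemma integral_exp_le:
  fixes \<kappa> a t :: real
  assumes "0 < \<kappa>" "a \<le> t"
  shows "integral {a..t} (\<lambda>s. exp (\<kappa> * (s - c))) \<le> exp (\<kappa> * (t - c)) / \<kappa>"
  using has_integral_exp_linear[of \<kappa> a t c] assms by (simp add: integral_unique divide_right_mono)

text \<open>At a maximum of \<open>exp (- (\<kappa> * (t - a))) * \<phi> t\<close> the integral term
  is at most the fraction \<open>L / \<kappa> \<le> 1/2\<close> of \<open>\<phi>\<close> at that
  point and is absorbed; hence \<open>\<kappa> = 2 * L + 1\<close> and the factor 2.\<close>

lemma gronwall_exp:
  fixes \<phi> :: "real \<Rightarrow> real"
  assumes cont: "continuous_on {a..b} \<phi>" and A: "0 \<le> A" and L: "0 \<le> L"
    and le: "\<And>t. t \<in> {a..b} \<Longrightarrow> \<phi> t \<le> A + L * integral {a..t} \<phi>"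
    and t: "t \<in> {a..b}"
  shows "\<phi> t \<le> 2 * A * exp ((2 * L + 1) * (t - a))"
proof -
  define \<kappa> where "\<kappa> = 2 * L + 1"
  have \<kappa>: "0 < \<kappa>" "L / \<kappa> \<le> 1/2" using L by (auto simp: \<kappa>_def field_simps)
  define \<psi> where "\<psi> t = exp (- (\<kappa> * (t - a))) * \<phi> t" for t
  have "continuous_on {a..b} \<psi>"
    unfolding \<psi>_def by (intro continuous_intros cont)
  then obtain t0 where t0: "t0 \<in> {a..b}" "\<And>s. s \<in> {a..b} \<Longrightarrow> \<psi> s \<le> \<psi> t0"
    using continuous_attains_sup[of "{a..b}" \<psi>] t by auto
  have \<phi>: "\<phi> s = exp (\<kappa> * (s - a)) * \<psi> s" for s by (simp add: \<psi>_def exp_minus)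
  have "\<psi> t0 \<le> 2 * A"
  proof (cases "\<psi> t0 \<le> 0")
    case True then show ?thesis using A by linarith
  next
    case False
    have sub: "{a..t0} \<subseteq> {a..b}" using t0(1) by auto
    have "integral {a..t0} \<phi> \<le> integral {a..t0} (\<lambda>s. \<psi> t0 * exp (\<kappa> * (s - a)))"
    proof (rule integral_le)
      show "\<phi> integrable_on {a..t0}"
        by (rule integrable_continuous_real[OF continuous_on_subset[OF cont sub]])
      show "(\<lambda>s. \<psi> t0 * exp (\<kappa> * (s - a))) integrable_on {a..t0}"
        by (intro integrable_continuous_real continuous_intros)
      show "\<phi> s \<le> \<psi> t0 * exp (\<kappa> * (s - a))" if "s \<in> {a..t0}" for s
        using t0(2)[of s] that sub by (auto simp: \<phi>[of s] mult.commute)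
    qed
    also have "\<dots> \<le> \<psi> t0 * (exp (\<kappa> * (t0 - a)) / \<kappa>)"
      unfolding integral_mult_right
      by (rule mult_left_mono) (use integral_exp_le[OF \<kappa>(1), of a t0 a] t0(1) False in auto)
    finally have "L * integral {a..t0} \<phi> \<le> (L / \<kappa>) * (\<psi> t0 * exp (\<kappa> * (t0 - a)))"
      using mult_left_mono[OF _ L] by (metis mult.assoc mult.commute times_divide_eq_left)
    also have "\<dots> \<le> 1/2 * (\<psi> t0 * exp (\<kappa> * (t0 - a)))"
      using \<kappa>(2) False by (intro mult_right_mono) auto
    finally have "\<phi> t0 \<le> A + \<phi> t0 / 2" using le[OF t0(1)] by (simp add: \<phi>[of t0] mult.commute)
    then have 1: "\<phi> t0 \<le> 2 * A" by simp
    have "\<psi> t0 \<le> \<phi> t0"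
      using t0(1) \<kappa>(1) False unfolding \<phi>[of t0] by (simp add: mult_le_cancel_right1)
    then show ?thesis using 1 by linarith
  qed
  then have "\<psi> t \<le> 2 * A" using t0(2)[OF t] by linarith
  then have "exp (\<kappa> * (t - a)) * \<psi> t \<le> exp (\<kappa> * (t - a)) * (2 * A)" by (rule mult_left_mono) simp
  then show ?thesis unfolding \<phi>[of t] unfolding \<kappa>_def by (simp only: mult.commute)
qed

lemma integral_diff_eq:
  fixes d :: "real \<Rightarrow> real"
  assumes d: "d integrable_on {a..b}" and D: "\<And>t. t \<in> {a..b} \<Longrightarrow> D t = D a + integral {a..t} d"
    and st: "a \<le> s" "s \<le> t" "t \<le> b"
  shows "D t - D s = integral {s..t} d"
proof -
  have "integral {a..s} d + integral {s..t} d = integral {a..t} d"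
    using st by (intro Henstock_Kurzweil_Integration.integral_combine integrable_on_subinterval[OF d]) auto
  then show ?thesis using D[of s] D[of t] st by auto
qed

lemma square_of_indefinite_integral:
  fixes p p' :: "real \<Rightarrow> real"
  assumes p': "p' absolutely_integrable_on {a..b}" and M: "\<And>t. t \<in> {a..b} \<Longrightarrow> \<bar>p' t\<bar> \<le> M"
    and p: "\<And>t. t \<in> {a..b} \<Longrightarrow> p t = p a + integral {a..t} p'"
  shows "continuous_on {a..b} p"
    and "(\<lambda>t. 2 * p t * p' t) absolutely_integrable_on {a..b}"
    and "\<And>t. t \<in> {a..b} \<Longrightarrow> (p t)\<^sup>2 = (p a)\<^sup>2 + integral {a..t} (\<lambda>t. 2 * p t * p' t)"
proof -
  have int: "p' integrable_on {a..b}" using p' by (rule absolutely_integrable_on_def[THEN iffD1, THEN conjunct1])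
  have "continuous_on {a..b} (\<lambda>t. p a + integral {a..t} p')"
    by (intro continuous_intros indefinite_integral_continuous_1 int)
  then show cont: "continuous_on {a..b} p" by (rule continuous_on_eq) (rule p[symmetric])
  then have "continuous_on {a..b} (\<lambda>t. 2 * p t)" by (intro continuous_intros)
  from absolutely_integrable_mult_continuous[OF p' this]
  show ai: "(\<lambda>t. 2 * p t * p' t) absolutely_integrable_on {a..b}" by (simp add: mult.commute)
  then have int2: "(\<lambda>t. 2 * p t * p' t) integrable_on {a..b}"
    by (rule absolutely_integrable_on_def[THEN iffD1, THEN conjunct1])
  define h where "h t = (p t)\<^sup>2 - integral {a..t} (\<lambda>t. 2 * p t * p' t)" for t
  have lip: "\<bar>p t - p s\<bar> \<le> M * (t - s)" if "a \<le> s" "s \<le> t" "t \<le> b" for s t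
  proof -
    have "\<bar>integral {s..t} p'\<bar> \<le> M * (t - s)"
    proof -
      have "p' integrable_on {s..t}" by (rule integrable_on_subinterval[OF int]) (use that in auto)
      then have "norm (integral {s..t} p') \<le> integral {s..t} (\<lambda>_. M)"
        by (rule integral_norm_bound_integral) (use that M in auto)
      then show ?thesis using that by (simp add: mult.commute)
    qed
    then show ?thesis using integral_diff_eq[OF int p, of s t] that by auto
  qed
  \<comment> \<open>Both parts of the increment are integrals over \<open>{s..t}\<close>; together
    the integrand is \<open>(p t + p s - 2 * p r) * p' r\<close>, whose first factor is of order
    \<open>t - s\<close> because \<open>p\<close> is Lipschitz.\<close>
  have quad: "\<bar>h t - h s\<bar> \<le> 2 * M * M * (t - s)\<^sup>2" if st: "a \<le> s" "s \<le> t" "t \<le> b" for s t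
  proof -
    have sub: "{s..t} \<subseteq> {a..b}" using st by auto
    have i1: "p' integrable_on {s..t}" "(\<lambda>t. 2 * p t * p' t) integrable_on {s..t}"
      using integrable_on_subinterval[OF int sub] integrable_on_subinterval[OF int2 sub] by auto
    have M0: "0 \<le> M" using M[of s] st by auto
    have "h t - h s = (p t)\<^sup>2 - (p s)\<^sup>2 - integral {s..t} (\<lambda>t. 2 * p t * p' t)"
      using integral_diff_eq[OF int2, of "\<lambda>t. integral {a..t} (\<lambda>t. 2 * p t * p' t)" s t] st
      by (simp add: h_def)
    also have "(p t)\<^sup>2 - (p s)\<^sup>2 = (p t + p s) * integral {s..t} p'"
      using integral_diff_eq[OF int p, of s t] st by (simp add: power2_eq_square algebra_simps)
    also have "(p t + p s) * integral {s..t} p' - integral {s..t} (\<lambda>t. 2 * p t * p' t)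
      = integral {s..t} (\<lambda>r. (p t + p s) * p' r - 2 * p r * p' r)"
      by (subst integral_diff) (use i1 in \<open>auto intro!: integrable_on_mult_right\<close>)
    finally have eq: "h t - h s = integral {s..t} (\<lambda>r. (p t + p s) * p' r - 2 * p r * p' r)" .
    have "norm (integral {s..t} (\<lambda>r. (p t + p s) * p' r - 2 * p r * p' r)) \<le> integral {s..t} (\<lambda>r. 2 * M * M * (t - s))"
    proof (rule integral_norm_bound_integral)
      fix r assume r: "r \<in> {s..t}"
      have "\<bar>p t + p s - 2 * p r\<bar> \<le> \<bar>p t - p r\<bar> + \<bar>p r - p s\<bar>" by linarith
      also have "\<dots> \<le> M * (t - r) + M * (r - s)" using lip[of r t] lip[of s r] r st by auto
      also have "\<dots> \<le> 2 * M * (t - s)" using M0 r st by (simp add: algebra_simps mult_left_mono)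
      finally have "\<bar>p t + p s - 2 * p r\<bar> * \<bar>p' r\<bar> \<le> 2 * M * (t - s) * M"
        using M[of r] r st M0 by (intro mult_mono) auto
      then show "norm ((p t + p s) * p' r - 2 * p r * p' r) \<le> 2 * M * M * (t - s)"
        by (simp add: abs_mult[symmetric] algebra_simps)
    qed (use i1 in \<open>auto intro!: integrable_diff integrable_on_mult_right\<close>)
    then show ?thesis using st by (simp add: eq power2_eq_square algebra_simps)
  qed
  have "(h has_field_derivative 0) (at x within {a..b})" if x: "x \<in> {a..b}" for x
    unfolding has_field_derivative_iff
  proof (rule tendsto_0_le[where K=1])
    show "((\<lambda>y. 2 * M * M * (y - x)) \<longlongrightarrow> 0) (at x within {a..b})"
      by (auto intro!: tendsto_eq_intros)
    have le: "\<bar>h y - h x\<bar> \<le> 2 * M * M * (y - x)\<^sup>2" if "y \<in> {a..b}" for y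
      using quad[of x y] quad[of y x] x that by (cases "x \<le> y") (auto simp: power2_commute abs_minus_commute)
    then show "\<forall>\<^sub>F y in at x within {a..b}. norm ((h y - h x) / (y - x)) \<le> norm (2 * M * M * (y - x)) * 1"
      unfolding eventually_at_filter
    proof (intro always_eventually allI impI)
      fix y assume y: "y \<noteq> x" "y \<in> {a..b}"
      have "\<bar>h y - h x\<bar> / \<bar>y - x\<bar> \<le> 2 * M * M * (y - x)\<^sup>2 / \<bar>y - x\<bar>"
        by (rule divide_right_mono) (use le[OF y(2)] in auto)
      also have "\<dots> = 2 * M * M * \<bar>y - x\<bar>"
        using y(1) by (simp add: power2_eq_square abs_mult_self_eq[symmetric, of "y - x"] del: abs_mult_self_eq)
      also have "\<dots> = \<bar>2 * M * M * (y - x)\<bar>" by (simp add: abs_mult)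
      finally show "norm ((h y - h x) / (y - x)) \<le> norm (2 * M * M * (y - x)) * 1" by simp
    qed
  qed
  then have "\<exists>c. \<forall>x\<in>{a..b}. h x = c"
    by (intro has_field_derivative_zero_constant) auto
  then show "(p t)\<^sup>2 = (p a)\<^sup>2 + integral {a..t} (\<lambda>t. 2 * p t * p' t)" if "t \<in> {a..b}" for t
  proof -
    have "h t = h a" using \<open>\<exists>c. _\<close> that by auto
    then show ?thesis by (simp add: h_def)
  qed
qed

text \<open>Integrate \<open>d\<close> from the last time before \<open>t\<close> at which \<open>D \<le> 0\<close>.\<close>

lemma le_integral_if_deriv_le_where_positive:
  fixes D d e :: "real \<Rightarrow> real"
  assumes cont: "continuous_on {a..b} D" and d: "d integrable_on {a..b}"
    and D: "\<And>t. t \<in> {a..b} \<Longrightarrow> D t = D a + integral {a..t} d" and Da: "D a \<le> 0"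
    and e: "e integrable_on {a..b}" "\<And>s. s \<in> {a..b} \<Longrightarrow> 0 \<le> e s"
    and de: "\<And>s. s \<in> {a..b} \<Longrightarrow> 0 < D s \<Longrightarrow> d s \<le> e s"
    and t: "t \<in> {a..b}"
  shows "D t \<le> integral {a..t} e"
proof (cases "D t \<le> 0")
  case True
  have "0 \<le> integral {a..t} e"
    by (rule integral_nonneg) (use e t integrable_on_subinterval[OF e(1), of a t] in auto)
  then show ?thesis using True by linarith
next
  case False
  define Z where "Z = {s \<in> {a..t}. D s \<le> 0}"
  have "compact Z"
  proof -
    have "continuous_on {a..t} D" by (rule continuous_on_subset[OF cont]) (use t in auto)
    then have "closed Z" unfolding Z_def by (intro continuous_on_closed_Collect_le) auto
    moreover have "bounded Z" by (rule bounded_subset[of "{a..t}"]) (auto simp: Z_def)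
    ultimately show ?thesis by (simp add: compact_eq_bounded_closed)
  qed
  moreover have "a \<in> Z" using Da t by (auto simp: Z_def)
  ultimately obtain s where s: "s \<in> Z" "\<And>r. r \<in> Z \<Longrightarrow> r \<le> s"
    using compact_attains_sup[of Z] by blast
  have st: "a \<le> s" "s \<le> t" "t \<le> b" "D s \<le> 0" using s(1) t by (auto simp: Z_def)
  have pos: "0 < D r" if "r \<in> {s..t} - {s}" for r
    using s(2)[of r] that st by (force simp: Z_def not_le[symmetric])
  have sub: "{s..t} \<subseteq> {a..b}" using st by auto
  have "D t - D s = integral {s..t} d" using integral_diff_eq[OF d D] st by auto
  \<comment> \<open>At \<open>s\<close> itself \<open>D\<close> is not positive, so the bound of
    \<open>d\<close> by \<open>e\<close> is not known there; changing the integrand at one point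
    repairs this.\<close>
  also have "\<dots> = integral {s..t} (\<lambda>r. if r = s then e r else d r)"
    by (rule integral_spike[of "{s}"]) auto
  also have "\<dots> \<le> integral {s..t} e"
  proof (rule integral_le)
    show "(\<lambda>r. if r = s then e r else d r) integrable_on {s..t}"
      by (rule integrable_spike[OF integrable_on_subinterval[OF d sub], of "{s}"]) auto
    show "e integrable_on {s..t}" by (rule integrable_on_subinterval[OF e(1) sub])
  qed (use pos de sub in auto)
  also have "\<dots> \<le> integral {a..t} e"
  proof (rule integral_subset_le)
    show "e integrable_on {s..t}" by (rule integrable_on_subinterval[OF e(1) sub])
    show "e integrable_on {a..t}" by (rule integrable_on_subinterval[OF e(1)]) (use t in auto)
  qed (use st e in auto)
  finally show ?thesis using st by linarith
qed

section \<open>Measurability of integrals depending on a parameter\<close>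

lemma borel_measurable_Caratheodory:
  fixes c :: "real \<Rightarrow> 'a \<Rightarrow> real"
  assumes cont: "\<And>\<omega>. \<omega> \<in> space M \<Longrightarrow> continuous_on UNIV (\<lambda>s. c s \<omega>)"
    and meas: "\<And>s. c s \<in> borel_measurable M"
  shows "(\<lambda>(\<omega>, s). c s \<omega>) \<in> borel_measurable (M \<Otimes>\<^sub>M borel)"
proof (rule borel_measurable_LIMSEQ_real)
  \<comment> \<open>Rounding the time down to the grid of mesh \<open>1 / Suc n\<close> makes
    \<open>F n\<close> a countable case distinction over measurable functions of
    \<open>\<omega>\<close>; continuity in time gives the limit.\<close>
  define F where "F n = (\<lambda>(\<omega>, s::real). c (real_of_int \<lfloor>real (Suc n) * s\<rfloor> / real (Suc n)) \<omega>)" for n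
  show "F n \<in> borel_measurable (M \<Otimes>\<^sub>M borel)" for n
  proof -
    have "(\<lambda>p::'a \<times> real. c (real_of_int \<lfloor>real (Suc n) * snd p\<rfloor> / real (Suc n)) (fst p)) \<in> borel_measurable (M \<Otimes>\<^sub>M borel)"
    proof (rule measurable_compose_countable[where g="\<lambda>p. \<lfloor>real (Suc n) * snd p\<rfloor>"])
      show "(\<lambda>p. c (real_of_int i / real (Suc n)) (fst p)) \<in> borel_measurable (M \<Otimes>\<^sub>M borel)" for i
        using meas by measurable
    qed measurable
    then show ?thesis by (simp add: F_def case_prod_beta')
  qed
  fix p :: "'a \<times> real" assume "p \<in> space (M \<Otimes>\<^sub>M borel)"
  then obtain \<omega> s where p: "p = (\<omega>, s)" "\<omega> \<in> space M" by (auto simp: space_pair_measure)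
  have "(\<lambda>n. real_of_int \<lfloor>real (Suc n) * s\<rfloor> / real (Suc n)) \<longlonglongrightarrow> s"
  proof (rule tendsto_sandwich)
    show "\<forall>\<^sub>F n in sequentially. s - 1 / real (Suc n) \<le> real_of_int \<lfloor>real (Suc n) * s\<rfloor> / real (Suc n)"
    proof (intro always_eventually allI)
      fix n
      have "real (Suc n) * s - 1 \<le> real_of_int \<lfloor>real (Suc n) * s\<rfloor>" by linarith
      then have "(real (Suc n) * s - 1) / real (Suc n) \<le> real_of_int \<lfloor>real (Suc n) * s\<rfloor> / real (Suc n)"
        by (rule divide_right_mono) simp
      then show "s - 1 / real (Suc n) \<le> real_of_int \<lfloor>real (Suc n) * s\<rfloor> / real (Suc n)"
        by (simp add: diff_divide_distrib)
    qed
    show "\<forall>\<^sub>F n in sequentially. real_of_int \<lfloor>real (Suc n) * s\<rfloor> / real (Suc n) \<le> s"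
      by (auto intro!: always_eventually simp: pos_divide_le_eq mult.commute simp del: of_nat_Suc)
    show "(\<lambda>n. s - 1 / real (Suc n)) \<longlonglongrightarrow> s"
      using tendsto_diff[OF tendsto_const LIMSEQ_inverse_real_of_nat, of s] by (simp add: inverse_eq_divide)
  qed simp
  then have "(\<lambda>n. c (real_of_int \<lfloor>real (Suc n) * s\<rfloor> / real (Suc n)) \<omega>) \<longlonglongrightarrow> c s \<omega>"
    using cont[OF p(2)] by (auto simp: continuous_on_eq_continuous_at isCont_tendsto_compose[where g="\<lambda>s. c s \<omega>"])
  then show "(\<lambda>n. F n p) \<longlonglongrightarrow> (case p of (\<omega>, s) \<Rightarrow> c s \<omega>)" by (simp add: F_def p)
qed

text \<open>\<open>\<nu>\<close> is only Lebesgue measurable. It is replaced by a Borel function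
  equal to it almost everywhere, so that the integrand becomes measurable on the product with
  \<open>lborel\<close> and parameter integrals are measurable.\<close>

lemma borel_measurable_integral_Caratheodory:
  fixes c :: "real \<Rightarrow> 'a \<Rightarrow> real"
  assumes cont: "\<And>\<omega>. \<omega> \<in> space M \<Longrightarrow> continuous_on {a..b} (\<lambda>s. c s \<omega>)"
    and meas: "\<And>s. s \<in> {a..b} \<Longrightarrow> c s \<in> borel_measurable M"
    and \<nu>: "\<nu> absolutely_integrable_on {a..b}"
  shows "(\<lambda>\<omega>. integral {a..b} (\<lambda>s. \<nu> s * c s \<omega>)) \<in> borel_measurable M"
proof (cases "a \<le> b")
  case False then show ?thesis by simp
next
  case True
  \<comment> \<open>Freezing the time outside \<open>{a..b}\<close> gives a function continuous on
    the whole line without changing the integral.\<close>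
  define c' where "c' s = c (max a (min b s))" for s
  have c'1: "continuous_on UNIV (\<lambda>s. c' s \<omega>)" if "\<omega> \<in> space M" for \<omega>
    unfolding c'_def by (rule continuous_on_compose2[OF cont[OF that]]) (use True in \<open>auto intro!: continuous_intros\<close>)
  have c'2: "c' s \<in> borel_measurable M" for s
    unfolding c'_def by (rule meas) (use True in auto)
  have "(\<lambda>s. indicator {a..b} s * \<nu> s) \<in> borel_measurable lebesgue"
    using \<nu> by (auto simp: set_integrable_def dest: borel_measurable_integrable)
  then obtain \<nu>' where \<nu>': "\<nu>' \<in> borel_measurable lborel" "AE s in lborel. indicator {a..b} s * \<nu> s = \<nu>' s"
    using completion_ex_borel_measurable_real by blast
  have jm: "(\<lambda>(\<omega>, s). c' s \<omega>) \<in> borel_measurable (M \<Otimes>\<^sub>M lborel)"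
    using borel_measurable_Caratheodory[of M c', OF c'1 c'2] by simp
  have "(\<lambda>(\<omega>, s). \<nu>' s * c' s \<omega>) \<in> borel_measurable (M \<Otimes>\<^sub>M lborel)"
    using jm \<nu>'(1) by (simp add: case_prod_beta')
  then have "(\<lambda>\<omega>. \<integral>s. \<nu>' s * c' s \<omega> \<partial>lborel) \<in> borel_measurable M"
    by (rule lborel.borel_measurable_lebesgue_integral)
  moreover have "integral {a..b} (\<lambda>s. \<nu> s * c s \<omega>) = (\<integral>s. \<nu>' s * c' s \<omega> \<partial>lborel)" if \<omega>: "\<omega> \<in> space M" for \<omega>
  proof -
    have ai: "(\<lambda>s. \<nu> s * c s \<omega>) absolutely_integrable_on {a..b}"
      by (rule absolutely_integrable_mult_continuous[OF \<nu> cont[OF \<omega>]])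
    have m: "(\<lambda>s. c' s \<omega>) \<in> borel_measurable borel"
      using c'1[OF \<omega>] by (rule borel_measurable_continuous_onI)
    have "integral {a..b} (\<lambda>s. \<nu> s * c s \<omega>) = (\<integral>s. indicator {a..b} s *\<^sub>R (\<nu> s * c s \<omega>) \<partial>lebesgue)"
      using set_lebesgue_integral_eq_integral(2)[OF ai] by (simp add: set_lebesgue_integral_def)
    also have "\<dots> = (\<integral>s. \<nu>' s * c' s \<omega> \<partial>lebesgue)"
    proof (rule integral_cong_AE)
      show "(\<lambda>s. indicator {a..b} s *\<^sub>R (\<nu> s * c s \<omega>)) \<in> borel_measurable lebesgue"
        using ai by (auto simp: set_integrable_def dest: borel_measurable_integrable)
      show "(\<lambda>s. \<nu>' s * c' s \<omega>) \<in> borel_measurable lebesgue"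
        using \<nu>'(1) m by (intro measurable_completion) simp
      have "AE s in lebesgue. indicator {a..b} s * \<nu> s = \<nu>' s"
        using \<nu>'(2) by (rule AE_completion)
      then show "AE s in lebesgue. indicator {a..b} s *\<^sub>R (\<nu> s * c s \<omega>) = \<nu>' s * c' s \<omega>"
      proof eventually_elim
        case (elim s)
        then show ?case by (cases "s \<in> {a..b}") (auto simp: c'_def)
      qed
    qed
    also have "\<dots> = (\<integral>s. \<nu>' s * c' s \<omega> \<partial>lborel)"
      by (rule integral_completion) (use \<nu>'(1) m in simp)
    finally show ?thesis .
  qed
  ultimately show ?thesis by (subst measurable_cong)
qed


section \<open>Lattice systems with a Lipschitz reaction term\<close>

instance ell2 :: banach ..

definition lrhs ::
  "(int \<Rightarrow> real \<Rightarrow> real) \<Rightarrow> (int \<Rightarrow> real \<Rightarrow> real) \<Rightarrow> (int \<Rightarrow> real \<Rightarrow> real \<Rightarrow> real) \<Rightarrow> real \<Rightarrow> ell2 \<Rightarrow> int \<Rightarrow> real"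
  where "lrhs \<nu> lam N t v i = - \<nu> i t * lap (coord v) i - lam i t * coord v i + N i (coord v i) t"

text \<open>Integrability is left out because it is automatic for continuous \<open>v\<close> in the
  setting of \<open>lattice_field\<close>, see \<open>lrhs_integrable\<close>. The horizon
  \<open>T\<close> is there because Lipschitz constants are uniform only on bounded time
  intervals.\<close>

definition solves_on ::
  "(int \<Rightarrow> real \<Rightarrow> real) \<Rightarrow> (int \<Rightarrow> real \<Rightarrow> real) \<Rightarrow> (int \<Rightarrow> real \<Rightarrow> real \<Rightarrow> real) \<Rightarrow>
    real \<Rightarrow> real \<Rightarrow> ell2 \<Rightarrow> (real \<Rightarrow> ell2) \<Rightarrow> bool"
  where "solves_on \<nu> lam N \<tau> T u v \<longleftrightarrow> continuous_on {\<tau>..T} v \<and>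
    (\<forall>t\<in>{\<tau>..T}. \<forall>i. coord (v t) i = coord u i + integral {\<tau>..t} (\<lambda>s. lrhs \<nu> lam N s (v s) i))"

text \<open>All data are explicit arguments because in \<open>measurable_picard\<close> the term
  \<open>N\<close> varies with the path, and each path gives another instance of
  \<open>lattice_field\<close>.\<close>

primrec picard ::
  "(int \<Rightarrow> real \<Rightarrow> real) \<Rightarrow> (int \<Rightarrow> real \<Rightarrow> real) \<Rightarrow> (int \<Rightarrow> real \<Rightarrow> real \<Rightarrow> real) \<Rightarrow>
    real \<Rightarrow> ell2 \<Rightarrow> nat \<Rightarrow> real \<Rightarrow> ell2"
  where
    "picard \<nu> lam N \<tau> u 0 = (\<lambda>t. u)"
  | "picard \<nu> lam N \<tau> u (Suc n) = (\<lambda>t. Abs_ell2 (\<lambda>i. coord u i +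
        integral {\<tau>..t} (\<lambda>s. lrhs \<nu> lam N s (picard \<nu> lam N \<tau> u n s) i)))"

text \<open>\<open>N_zero\<close> places the value of the field at the state 0 in
  \<open>ell2\<close>; together with a Lipschitz bound uniform over the sites this makes the whole
  right-hand side map into \<open>ell2\<close>.\<close>

locale lattice_field =
  fixes \<nu> lam :: "int \<Rightarrow> real \<Rightarrow> real" and N :: "int \<Rightarrow> real \<Rightarrow> real \<Rightarrow> real"
    and nu_hi lam_hi :: real and G :: "real \<Rightarrow> ell2"
  assumes \<nu>_int: "\<And>i a b. \<nu> i absolutely_integrable_on {a..b}"
    and lam_int: "\<And>i a b. lam i absolutely_integrable_on {a..b}"
    and \<nu>_bounds: "\<And>i t. 0 \<le> \<nu> i t" "\<And>i t. \<nu> i t \<le> nu_hi"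
    and lam_bounds: "\<And>i t. 0 \<le> lam i t" "\<And>i t. lam i t \<le> lam_hi"
    and N_cont: "\<And>i. continuous_on UNIV (\<lambda>(x, t). N i x t)"
    and N_zero: "\<And>i t. N i 0 t = coord (G t) i"
    and G_cont: "continuous_on UNIV G"
    and N_lip: "\<And>a b. \<exists>L\<ge>0. \<forall>t\<in>{a..b}. \<forall>i x y. \<bar>N i x t - N i y t\<bar> \<le> L * \<bar>x - y\<bar>"
begin

definition field :: "real \<Rightarrow> ell2 \<Rightarrow> ell2"
  where "field t v = Abs_ell2 (lrhs \<nu> lam N t v)"

text \<open>Differences of the right-hand side at two states obey a neighbour bound, which gives the
  Lipschitz estimate. Taken against the state 0, where the value is \<open>G t\<close>, the same
  bound shows square-summability, without which \<open>field\<close> would be an unspecified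
  value.\<close>

lemma field_lipschitz_aux:
  obtains L where "0 \<le> L" "\<And>t v. t \<in> {a..b} \<Longrightarrow> coord (field t v) = lrhs \<nu> lam N t v"
    "\<And>t v w. t \<in> {a..b} \<Longrightarrow> norm (field t v - field t w) \<le> L * norm (v - w)"
proof -
  obtain L where L: "0 \<le> L" "\<And>t i x y. t \<in> {a..b} \<Longrightarrow> \<bar>N i x t - N i y t\<bar> \<le> L * \<bar>x - y\<bar>"
    using N_lip[of a b] by blast
  define B where "B = 2 * nu_hi + lam_hi + L"
  have hi: "0 \<le> nu_hi" "0 \<le> lam_hi" using \<nu>_bounds[of 0 0] lam_bounds[of 0 0] by linarith+
  then have B: "0 \<le> B" using L(1) by (simp add: B_def)
  have nb: "\<bar>lrhs \<nu> lam N t v i - lrhs \<nu> lam N t w i\<bar>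
      \<le> nu_hi * \<bar>coord (v - w) (i - 1)\<bar> + B * \<bar>coord (v - w) i\<bar> + nu_hi * \<bar>coord (v - w) (i + 1)\<bar>"
    if t: "t \<in> {a..b}" for t v w i
  proof -
    define d where "d = coord (v - w)"
    have "lrhs \<nu> lam N t v i - lrhs \<nu> lam N t w i
      = \<nu> i t * (d (i - 1) - 2 * d i + d (i + 1)) - lam i t * d i + (N i (coord v i) t - N i (coord w i) t)"
      by (simp add: lrhs_def lap_def d_def coord_simps algebra_simps)
    also have "\<bar>\<dots>\<bar> \<le> \<bar>\<nu> i t * (d (i - 1) - 2 * d i + d (i + 1))\<bar> + \<bar>lam i t * d i\<bar> + \<bar>N i (coord v i) t - N i (coord w i) t\<bar>"
      by linarith
    also have "\<bar>\<nu> i t * (d (i - 1) - 2 * d i + d (i + 1))\<bar> \<le> nu_hi * (\<bar>d (i - 1)\<bar> + 2 * \<bar>d i\<bar> + \<bar>d (i + 1)\<bar>)"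
      unfolding abs_mult using \<nu>_bounds[of i t] by (intro mult_mono) auto
    also have "\<bar>lam i t * d i\<bar> \<le> lam_hi * \<bar>d i\<bar>"
      unfolding abs_mult using lam_bounds[of i t] by (intro mult_right_mono) auto
    also have "\<bar>N i (coord v i) t - N i (coord w i) t\<bar> \<le> L * \<bar>d i\<bar>"
      using L(2)[OF t, of i "coord v i" "coord w i"] by (simp add: d_def coord_simps)
    finally show ?thesis unfolding d_def[symmetric] by (simp add: B_def algebra_simps)
  qed
  have c0: "lrhs \<nu> lam N t 0 i = coord (G t) i" for t i
    by (simp add: lrhs_def lap_def coord_simps N_zero)
  have cf: "coord (field t v) = lrhs \<nu> lam N t v" if t: "t \<in> {a..b}" for t v
  proof -
    define y where "y i = lrhs \<nu> lam N t v i - lrhs \<nu> lam N t 0 i" for i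
    have "coord (Abs_ell2 y) = y"
      by (rule ell2_neighbour_bound(1)[OF hi(1) B]) (unfold y_def, rule nb[OF t])
    then have "coord (Abs_ell2 y + G t) = lrhs \<nu> lam N t v"
      by (auto simp: coord_simps y_def c0)
    then show ?thesis unfolding field_def by (metis coord_inverse)
  qed
  have "norm (field t v - field t w) \<le> (2 * nu_hi + B) * norm (v - w)" if t: "t \<in> {a..b}" for t v w
  proof -
    define y where "y i = lrhs \<nu> lam N t v i - lrhs \<nu> lam N t w i" for i
    have cy: "coord (Abs_ell2 y) = y" and "norm (Abs_ell2 y) \<le> (2 * nu_hi + B) * norm (v - w)"
      using ell2_neighbour_bound[OF hi(1) B, of y "v - w"] nb[OF t] by (auto simp: y_def)
    moreover have "Abs_ell2 y = field t v - field t w"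
      by (rule ell2_ext) (simp add: cy coord_simps cf[OF t] y_def)
    ultimately show ?thesis by simp
  qed
  with cf hi B show ?thesis by (intro that[of "2 * nu_hi + B"]) auto
qed

lemma coord_field: "coord (field t v) = lrhs \<nu> lam N t v"
  using field_lipschitz_aux[of t t] by (metis atLeastAtMost_iff order_refl)

lemma field_lipschitz:
  obtains L where "0 \<le> L" "\<And>t v w. t \<in> {a..b} \<Longrightarrow> norm (field t v - field t w) \<le> L * norm (v - w)"
  by (rule field_lipschitz_aux[of a b]) (rule that)

lemma lrhs_integrable:
  assumes v: "continuous_on {a..b} v"
  shows "(\<lambda>s. lrhs \<nu> lam N s (v s) i) absolutely_integrable_on {a..b}"
proof -
  have "continuous_on {a..b} (\<lambda>s. (coord (v s) i, s))"
    by (intro continuous_intros continuous_on_coord v)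
  then have "continuous_on {a..b} (\<lambda>s. N i (coord (v s) i) s)"
    using continuous_on_compose2[OF N_cont[of i], of "{a..b}" "\<lambda>s. (coord (v s) i, s)"]
    by auto
  then have "(\<lambda>s. N i (coord (v s) i) s) absolutely_integrable_on {a..b}"
    by (rule absolutely_integrable_continuous_real)
  moreover have "(\<lambda>s. \<nu> i s * - lap (coord (v s)) i) absolutely_integrable_on {a..b}"
    unfolding lap_def
    by (rule absolutely_integrable_mult_continuous[OF \<nu>_int]) (intro continuous_intros continuous_on_coord v)
  moreover have "(\<lambda>s. lam i s * - coord (v s) i) absolutely_integrable_on {a..b}"
    by (rule absolutely_integrable_mult_continuous[OF lam_int]) (intro continuous_intros continuous_on_coord v)
  ultimately have "(\<lambda>s. \<nu> i s * - lap (coord (v s)) i + lam i s * - coord (v s) i + N i (coord (v s) i) s)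
      absolutely_integrable_on {a..b}"
    by (intro set_integral_add)
  then show ?thesis by (simp add: lrhs_def)
qed

lemma lrhs_integrable_on:
  "continuous_on {a..b} v \<Longrightarrow> (\<lambda>s. lrhs \<nu> lam N s (v s) i) integrable_on {a..b}"
  using lrhs_integrable by (rule absolutely_integrable_on_def[THEN iffD1, THEN conjunct1])

lemma field_bounded:
  assumes v: "continuous_on {a..b} v"
  obtains M where "0 \<le> M" "\<And>s. s \<in> {a..b} \<Longrightarrow> norm (field s (v s)) \<le> M"
proof -
  obtain L where L: "0 \<le> L" "\<And>t v w. t \<in> {a..b} \<Longrightarrow> norm (field t v - field t w) \<le> L * norm (v - w)"
    by (rule field_lipschitz[of a b]) (rule that)
  have "bounded (v ` {a..b})" using v compact_continuous_image compact_imp_bounded by blast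
  then obtain B where B': "\<forall>s\<in>{a..b}. norm (v s) \<le> B" by (auto simp: bounded_iff simp del: picard.simps)
  note B = bspec[OF B']
  have "bounded (G ` {a..b})"
    using continuous_on_subset[OF G_cont] compact_continuous_image compact_imp_bounded by blast
  then obtain C where C': "\<forall>s\<in>{a..b}. norm (G s) \<le> C" by (auto simp: bounded_iff simp del: picard.simps)
  note C = bspec[OF C']
  have f0: "field s 0 = G s" for s
    by (rule ell2_ext) (simp add: coord_field lrhs_def lap_def coord_simps N_zero)
  have "norm (field s (v s)) \<le> L * B + C" if s: "s \<in> {a..b}" for s
  proof -
    have "norm (field s (v s)) \<le> norm (field s (v s) - field s 0) + norm (field s 0)"
      by (metis add.commute norm_triangle_sub)
    also have "\<dots> \<le> L * norm (v s) + norm (G s)" using L(2)[OF s, of "v s" 0] by (simp add: f0)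
    also have "\<dots> \<le> L * B + C" using B[OF s] C[OF s] L(1) by (intro add_mono mult_left_mono) auto
    finally show ?thesis .
  qed
  then show ?thesis by (intro that[of "max 0 (L * B + C)"]) (auto simp: le_max_iff_disj)
qed

section \<open>The Picard operator and its iterates\<close>

definition pic :: "real \<Rightarrow> ell2 \<Rightarrow> (real \<Rightarrow> ell2) \<Rightarrow> real \<Rightarrow> ell2"
  where "pic \<tau> u v t = Abs_ell2 (\<lambda>i. coord u i + integral {\<tau>..t} (\<lambda>s. lrhs \<nu> lam N s (v s) i))"

text \<open>Integration is done coordinate by coordinate; \<open>ell2_integral_norm_le\<close>
  bounds the vector of integrals over \<open>{s..t}\<close> by \<open>M * (t - s)\<close>, which
  yields both square-summability and Lipschitz continuity in time.\<close>

lemma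
  assumes v: "continuous_on {\<tau>..T} v"
  shows coord_pic: "\<And>t. t \<in> {\<tau>..T} \<Longrightarrow> coord (pic \<tau> u v t) = (\<lambda>i. coord u i + integral {\<tau>..t} (\<lambda>s. lrhs \<nu> lam N s (v s) i))"
    and continuous_pic: "continuous_on {\<tau>..T} (pic \<tau> u v)"
proof -
  obtain M where M: "0 \<le> M" "\<And>s. s \<in> {\<tau>..T} \<Longrightarrow> norm (field s (v s)) \<le> M"
    by (rule field_bounded[OF v]) (rule that)
  have int: "(\<lambda>r. coord (field r (v r)) i) integrable_on {s..t}" if "{s..t} \<subseteq> {\<tau>..T}" for s t i
    unfolding coord_field by (rule lrhs_integrable_on[OF continuous_on_subset[OF v that]])
  define Y where "Y s t = Abs_ell2 (\<lambda>i. integral {s..t} (\<lambda>r. lrhs \<nu> lam N r (v r) i))" for s t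
  have Y: "coord (Y s t) = (\<lambda>i. integral {s..t} (\<lambda>r. lrhs \<nu> lam N r (v r) i))"
      "s \<le> t \<Longrightarrow> norm (Y s t) \<le> M * (t - s)" if "{s..t} \<subseteq> {\<tau>..T}" for s t
  proof -
    have *: "coord (Y s t) = (\<lambda>i. integral {s..t} (\<lambda>r. lrhs \<nu> lam N r (v r) i)) \<and> norm (Y s t) \<le> integral {s..t} (\<lambda>_. M)"
      using ell2_integral_norm_le[of "\<lambda>r. field r (v r)" s t "\<lambda>_. M",
          OF int[OF that] integrable_const_ivl M(2)[OF subsetD[OF that]]]
      unfolding coord_field Y_def by blast
    then show "coord (Y s t) = (\<lambda>i. integral {s..t} (\<lambda>r. lrhs \<nu> lam N r (v r) i))" by simp
    show "norm (Y s t) \<le> M * (t - s)" if "s \<le> t" using * that by (simp add: mult.commute)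
  qed
  show cp: "coord (pic \<tau> u v t) = (\<lambda>i. coord u i + integral {\<tau>..t} (\<lambda>s. lrhs \<nu> lam N s (v s) i))"
    if t: "t \<in> {\<tau>..T}" for t
  proof -
    have "coord (u + Y \<tau> t) = (\<lambda>i. coord u i + integral {\<tau>..t} (\<lambda>s. lrhs \<nu> lam N s (v s) i))"
      using Y(1)[of \<tau> t] t by (auto simp: coord_simps)
    then show ?thesis unfolding pic_def by (metis coord_inverse)
  qed
  have lip: "norm (pic \<tau> u v t - pic \<tau> u v s) \<le> M * (t - s)" if "\<tau> \<le> s" "s \<le> t" "t \<le> T" for s t
  proof -
    have sub: "{s..t} \<subseteq> {\<tau>..T}" using that by auto
    have "pic \<tau> u v t - pic \<tau> u v s = Y s t"
    proof (rule ell2_ext)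
      fix i
      have "integral {\<tau>..s} (\<lambda>s. lrhs \<nu> lam N s (v s) i) + integral {s..t} (\<lambda>s. lrhs \<nu> lam N s (v s) i)
        = integral {\<tau>..t} (\<lambda>s. lrhs \<nu> lam N s (v s) i)"
        by (rule Henstock_Kurzweil_Integration.integral_combine)
          (use that in \<open>auto intro!: lrhs_integrable_on continuous_on_subset[OF v]\<close>)
      then show "coord (pic \<tau> u v t - pic \<tau> u v s) i = coord (Y s t) i"
        using that Y(1)[OF sub] by (simp add: coord_simps cp)
    qed
    then show ?thesis using Y(2)[OF sub] that by simp
  qed
  have "M-lipschitz_on {\<tau>..T} (pic \<tau> u v)"
  proof (rule lipschitz_onI)
    fix x y assume "x \<in> {\<tau>..T}" "y \<in> {\<tau>..T}"
    then show "dist (pic \<tau> u v x) (pic \<tau> u v y) \<le> M * dist x y"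
      using lip[of x y] lip[of y x] by (cases "x \<le> y") (auto simp: dist_norm norm_minus_commute)
  qed (rule M)
  then show "continuous_on {\<tau>..T} (pic \<tau> u v)" by (rule lipschitz_on_continuous_on)
qed

text \<open>The one estimate behind the dependence on the initial value, the convergence of the
  iterates and the identification of their limit as a fixed point.\<close>

lemma pic_diff_le:
  assumes v: "continuous_on {\<tau>..T} v" and w: "continuous_on {\<tau>..T} w" and t: "t \<in> {\<tau>..T}"
    and L: "\<And>s v w. s \<in> {\<tau>..T} \<Longrightarrow> norm (field s v - field s w) \<le> L * norm (v - w)"
  shows "norm (pic \<tau> u v t - pic \<tau> u' w t) \<le> norm (u - u') + L * integral {\<tau>..t} (\<lambda>s. norm (v s - w s))"
proof -
  have sub: "{\<tau>..t} \<subseteq> {\<tau>..T}" using t by auto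
  note v' = continuous_on_subset[OF v sub] and w' = continuous_on_subset[OF w sub]
  define Y where "Y = Abs_ell2 (\<lambda>i. integral {\<tau>..t} (\<lambda>s. coord (field s (v s) - field s (w s)) i))"
  have i: "(\<lambda>s. coord (field s (v s) - field s (w s)) i) integrable_on {\<tau>..t}" for i
    unfolding coord_simps coord_field by (intro integrable_diff lrhs_integrable_on v' w')
  have "(\<lambda>s. L * norm (v s - w s)) integrable_on {\<tau>..t}"
    by (intro integrable_continuous_real continuous_intros v' w')
  then have Y: "coord Y = (\<lambda>i. integral {\<tau>..t} (\<lambda>s. coord (field s (v s) - field s (w s)) i))"
      "norm Y \<le> integral {\<tau>..t} (\<lambda>s. L * norm (v s - w s))"
    unfolding Y_def using ell2_integral_norm_le[OF i, of "\<lambda>s. L * norm (v s - w s)"] L sub by auto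
  have "pic \<tau> u v t - pic \<tau> u' w t = (u - u') + Y"
  proof (rule ell2_ext)
    fix i
    have "coord Y i = integral {\<tau>..t} (\<lambda>s. lrhs \<nu> lam N s (v s) i) - integral {\<tau>..t} (\<lambda>s. lrhs \<nu> lam N s (w s) i)"
      unfolding Y coord_simps coord_field by (intro integral_diff lrhs_integrable_on v' w')
    then show "coord (pic \<tau> u v t - pic \<tau> u' w t) i = coord ((u - u') + Y) i"
      using t by (simp add: coord_simps coord_pic[OF v] coord_pic[OF w])
  qed
  also have "norm \<dots> \<le> norm (u - u') + norm Y" by (rule norm_triangle_ineq)
  finally show ?thesis using Y(2) by simp
qed

lemma solves_on_iff_pic:
  "solves_on \<nu> lam N \<tau> T u v \<longleftrightarrow> continuous_on {\<tau>..T} v \<and> (\<forall>t\<in>{\<tau>..T}. v t = pic \<tau> u v t)"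
  unfolding solves_on_def by (auto simp: coord_pic intro!: ell2_ext)

lemma solves_on_dependence:
  obtains L where "0 \<le> L"
    "\<And>u u' v v' t. solves_on \<nu> lam N \<tau> T u v \<Longrightarrow> solves_on \<nu> lam N \<tau> T u' v' \<Longrightarrow> t \<in> {\<tau>..T} \<Longrightarrow>
      norm (v t - v' t) \<le> L * norm (u - u')"
proof -
  obtain L where L: "0 \<le> L" "\<And>s v w. s \<in> {\<tau>..T} \<Longrightarrow> norm (field s v - field s w) \<le> L * norm (v - w)"
    by (rule field_lipschitz[of \<tau> T]) (rule that)
  have "norm (v t - v' t) \<le> 2 * exp ((2 * L + 1) * (T - \<tau>)) * norm (u - u')"
    if s: "solves_on \<nu> lam N \<tau> T u v" "solves_on \<nu> lam N \<tau> T u' v'" and t: "t \<in> {\<tau>..T}" for u u' v v' t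
  proof -
    have "norm (v t - v' t) \<le> 2 * norm (u - u') * exp ((2 * L + 1) * (t - \<tau>))"
    proof (rule gronwall_exp[OF _ norm_ge_zero L(1) _ t])
      show "continuous_on {\<tau>..T} (\<lambda>t. norm (v t - v' t))"
        using s by (intro continuous_intros) (auto simp: solves_on_def)
      fix t assume t: "t \<in> {\<tau>..T}"
      show "norm (v t - v' t) \<le> norm (u - u') + L * integral {\<tau>..t} (\<lambda>t. norm (v t - v' t))"
        using pic_diff_le[of \<tau> T v v' t L u u'] s t L(2) by (auto simp: solves_on_iff_pic)
    qed
    also have "\<dots> \<le> 2 * norm (u - u') * exp ((2 * L + 1) * (T - \<tau>))"
      using t L(1) by (intro mult_left_mono) (auto intro!: mult_left_mono)
    finally show ?thesis by (simp add: mult_ac)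
  qed
  then show ?thesis by (intro that[of "2 * exp ((2 * L + 1) * (T - \<tau>))"]) auto
qed

lemma solves_on_unique:
  assumes "solves_on \<nu> lam N \<tau> T u v" "solves_on \<nu> lam N \<tau> T u v'" "t \<in> {\<tau>..T}"
  shows "v t = v' t"
  using solves_on_dependence[of \<tau> T] assms by (metis norm_le_zero_iff cancel_comm_monoid_add_class.diff_cancel
    eq_iff_diff_eq_0 mult_zero_right norm_zero)

lemma picard_Suc: "picard \<nu> lam N \<tau> u (Suc n) = pic \<tau> u (picard \<nu> lam N \<tau> u n)"
  by (auto simp: pic_def)

lemma continuous_picard: "continuous_on {\<tau>..T} (picard \<nu> lam N \<tau> u n)"
  by (induction n) (auto simp: picard_Suc intro!: continuous_pic simp del: picard.simps(2))

text \<open>In the weight \<open>exp (\<kappa> * (t - \<tau>))\<close> with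
  \<open>\<kappa> = 2 * L + 1\<close> each iteration halves the bound on the increments, so the
  iterates converge on all of \<open>{\<tau>..T}\<close> and no short intervals have to be
  glued.\<close>

lemma picard_uniform_limit:
  obtains v where "uniform_limit {\<tau>..T} (picard \<nu> lam N \<tau> u) v sequentially"
proof -
  let ?p = "picard \<nu> lam N \<tau> u"
  obtain L where L: "0 \<le> L" "\<And>s v w. s \<in> {\<tau>..T} \<Longrightarrow> norm (field s v - field s w) \<le> L * norm (v - w)"
    by (rule field_lipschitz[of \<tau> T]) (rule that)
  define \<kappa> where "\<kappa> = 2 * L + 1"
  have \<kappa>: "0 < \<kappa>" "L / \<kappa> \<le> 1/2" using L by (auto simp: \<kappa>_def field_simps)
  have "bounded ((\<lambda>t. ?p 1 t - ?p 0 t) ` {\<tau>..T})"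
    by (intro compact_imp_bounded compact_continuous_image continuous_intros continuous_picard) auto
  then obtain K where K': "\<forall>t\<in>{\<tau>..T}. norm (?p 1 t - ?p 0 t) \<le> K" by (auto simp: bounded_iff simp del: picard.simps)
  note K = bspec[OF K']
  have cp: "continuous_on {\<tau>..T} (?p n)" for n by (rule continuous_picard)
  have est: "norm (?p (Suc n) t - ?p n t) \<le> K * exp (\<kappa> * (t - \<tau>)) * (1/2)^n" if "t \<in> {\<tau>..T}" for n t
    using that
  proof (induction n arbitrary: t)
    case 0
    have "K \<ge> 0" using K[OF 0] norm_ge_zero order_trans by blast
    then have "K * 1 \<le> K * exp (\<kappa> * (t - \<tau>))" using \<kappa>(1) 0 by (intro mult_left_mono) auto
    then show ?case using K[OF 0] by (simp del: picard.simps)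
  next
    case (Suc n)
    have K0: "K \<ge> 0" using K[OF Suc.prems] norm_ge_zero order_trans by blast
    have "norm (?p (Suc (Suc n)) t - ?p (Suc n) t) \<le> norm (u - u) + L * integral {\<tau>..t} (\<lambda>s. norm (?p (Suc n) s - ?p n s))"
      using pic_diff_le[OF cp[of "Suc n"] cp[of n] Suc.prems L(2), of u u]
      unfolding picard_Suc by blast
    also have "integral {\<tau>..t} (\<lambda>s. norm (?p (Suc n) s - ?p n s)) \<le> integral {\<tau>..t} (\<lambda>s. (K * (1/2)^n) * exp (\<kappa> * (s - \<tau>)))"
    proof (rule integral_le)
      show "(\<lambda>s. norm (?p (Suc n) s - ?p n s)) integrable_on {\<tau>..t}"
        by (intro integrable_continuous_real continuous_intros continuous_picard)
      show "(\<lambda>s. (K * (1/2)^n) * exp (\<kappa> * (s - \<tau>))) integrable_on {\<tau>..t}"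
        by (intro integrable_continuous_real continuous_intros)
      show "norm (?p (Suc n) s - ?p n s) \<le> (K * (1/2)^n) * exp (\<kappa> * (s - \<tau>))" if "s \<in> {\<tau>..t}" for s
        using Suc.IH[of s] Suc.prems that by (simp add: mult_ac del: picard.simps)
    qed
    also have "\<dots> \<le> (K * (1/2)^n) * (exp (\<kappa> * (t - \<tau>)) / \<kappa>)"
      unfolding integral_mult_right
      by (rule mult_left_mono) (use integral_exp_le[OF \<kappa>(1), of \<tau> t \<tau>] Suc.prems K0 in auto)
    finally have "norm (?p (Suc (Suc n)) t - ?p (Suc n) t) \<le> L * ((K * (1/2)^n) * (exp (\<kappa> * (t - \<tau>)) / \<kappa>))"
      using L(1) by (simp add: mult_left_mono del: picard.simps)
    also have "\<dots> = (L / \<kappa>) * (K * exp (\<kappa> * (t - \<tau>)) * (1/2)^n)" by simp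
    also have "\<dots> \<le> 1/2 * (K * exp (\<kappa> * (t - \<tau>)) * (1/2)^n)"
      using \<kappa>(2) K0 by (intro mult_right_mono) auto
    finally show ?case by (simp del: picard.simps)
  qed
  define C where "C = K * exp (\<kappa> * (T - \<tau>))"
  have "uniform_limit {\<tau>..T} (\<lambda>n t. \<Sum>k<n. (?p (Suc k) t - ?p k t)) (\<lambda>t. \<Sum>k. (?p (Suc k) t - ?p k t)) sequentially"
  proof (rule Weierstrass_m_test)
    fix n t assume t: "t \<in> {\<tau>..T}"
    have "K \<ge> 0" using K[OF t] norm_ge_zero order_trans by blast
    then have "K * exp (\<kappa> * (t - \<tau>)) * (1/2)^n \<le> C * (1/2)^n"
      unfolding C_def using t \<kappa>(1) by (intro mult_right_mono mult_left_mono) auto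
    then show "norm (?p (Suc n) t - ?p n t) \<le> C * (1/2)^n" using est[OF t, of n] by linarith
  qed (auto intro!: summable_mult summable_geometric)
  then have "uniform_limit {\<tau>..T} (\<lambda>n t. (\<Sum>k<n. (?p (Suc k) t - ?p k t)) + u) (\<lambda>t. (\<Sum>k. (?p (Suc k) t - ?p k t)) + u) sequentially"
    by (intro uniform_limit_intros)
  moreover have "(\<Sum>k<n. (?p (Suc k) t - ?p k t)) + u = ?p n t" for n t
    by (subst sum_lessThan_telescope) (simp add: picard.simps(1))
  ultimately show ?thesis by (intro that[of "\<lambda>t. (\<Sum>k. (?p (Suc k) t - ?p k t)) + u"]) simp
qed

text \<open>A pointwise limit does not refer to a horizon, so one function solves the system on
  every \<open>{\<tau>..T}\<close>.\<close>

definition sol :: "real \<Rightarrow> ell2 \<Rightarrow> real \<Rightarrow> ell2"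
  where "sol \<tau> u t = lim (\<lambda>n. picard \<nu> lam N \<tau> u n t)"

lemma picard_tendsto_sol: "\<And>t. \<tau> \<le> t \<Longrightarrow> (\<lambda>n. picard \<nu> lam N \<tau> u n t) \<longlonglongrightarrow> sol \<tau> u t"
  and solves_on_sol: "solves_on \<nu> lam N \<tau> T u (sol \<tau> u)"
proof -
  let ?p = "picard \<nu> lam N \<tau> u" and ?v = "sol \<tau> u"
  have ul: "uniform_limit {\<tau>..T} ?p ?v sequentially" for T
  proof -
    obtain w where w: "uniform_limit {\<tau>..T} ?p w sequentially" by (rule picard_uniform_limit) (rule that)
    have "w t = ?v t" if "t \<in> {\<tau>..T}" for t
      using tendsto_uniform_limitI[OF w that] by (simp add: sol_def limI)
    then show ?thesis using w by (subst uniform_limit_cong'[where i=w]) auto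
  qed
  show lim: "(\<lambda>n. ?p n t) \<longlonglongrightarrow> ?v t" if "\<tau> \<le> t" for t
    using tendsto_uniform_limitI[OF ul[of t]] that by simp
  have cp: "continuous_on {\<tau>..T} (?p n)" for n by (rule continuous_picard)
  have cv: "continuous_on {\<tau>..T} ?v"
    by (rule uniform_limit_theorem[OF _ ul]) (auto intro!: always_eventually continuous_picard)
  obtain L where L: "0 \<le> L" "\<And>s v w. s \<in> {\<tau>..T} \<Longrightarrow> norm (field s v - field s w) \<le> L * norm (v - w)"
    by (rule field_lipschitz[of \<tau> T]) (rule that)
  \<comment> \<open>Both sides are limits of the next iterate: the left by convergence, the right
    because uniform convergence makes the integral in \<open>pic_diff_le\<close> vanish.\<close>
  have "?v t = pic \<tau> u ?v t" if t: "t \<in> {\<tau>..T}" for t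
  proof (rule LIMSEQ_unique)
    show "(\<lambda>n. ?p (Suc n) t) \<longlonglongrightarrow> ?v t" using LIMSEQ_Suc[OF lim[of t]] t by simp
    have "uniform_limit {\<tau>..t} ?p ?v sequentially" by (rule ul)
    then have "uniform_limit {\<tau>..t} (\<lambda>n s. norm (?p n s - ?v s)) (\<lambda>s. 0) sequentially"
      by (auto simp: uniform_limit_iff dist_norm)
    then have "(\<lambda>n. integral {\<tau>..t} (\<lambda>s. norm (?p n s - ?v s))) \<longlonglongrightarrow> integral {\<tau>..t} (\<lambda>s. 0)"
    proof -
      assume ul0: "uniform_limit {\<tau>..t} (\<lambda>n s. norm (?p n s - ?v s)) (\<lambda>s. 0) sequentially"
      obtain I J where IJ: "\<And>n. ((\<lambda>s. norm (?p n s - ?v s)) has_integral I n) {\<tau>..t}" "((\<lambda>s. 0) has_integral J) {\<tau>..t}"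
        "I \<longlonglongrightarrow> J"
      proof (rule uniform_limit_integral[OF ul0])
        show "continuous_on {\<tau>..t} (\<lambda>s. norm (?p n s - ?v s))" for n
          by (intro continuous_intros continuous_picard continuous_on_subset[OF cv]) (use t in auto)
      qed (auto)
      then show ?thesis by (metis (no_types, lifting) ext integral_unique)
    qed
    then have "(\<lambda>n. L * integral {\<tau>..t} (\<lambda>s. norm (?p n s - ?v s))) \<longlonglongrightarrow> 0"
      by (intro tendsto_eq_intros) auto
    moreover have "norm (pic \<tau> u (?p n) t - pic \<tau> u ?v t) \<le> L * integral {\<tau>..t} (\<lambda>s. norm (?p n s - ?v s))" for n
      using pic_diff_le[OF cp[of n] cv t L(2), of u u] by simp
    ultimately have "(\<lambda>n. pic \<tau> u (?p n) t - pic \<tau> u ?v t) \<longlonglongrightarrow> 0"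
      by (rule Lim_null_comparison[OF always_eventually[OF allI], rotated])
    then show "(\<lambda>n. ?p (Suc n) t) \<longlonglongrightarrow> pic \<tau> u ?v t"
      unfolding picard_Suc by (rule LIM_zero_cancel)
  qed
  then show "solves_on \<nu> lam N \<tau> T u ?v" unfolding solves_on_iff_pic using cv by blast
qed

end


section \<open>Site-wise comparison\<close>

text \<open>The right-hand side solves the linear equation with growth rate \<open>p\<close> at each site and, by the
  factor \<open>2 + \<epsilon>\<close>, is a supersolution of the coupled system.  The supremum of the difference with
  weight \<open>exp (- \<kappa> (t - \<tau>))\<close> over all sites and times is then at most half of itself.\<close>

lemma (in lattice_field) solves_on_sq_le:
  fixes k p :: "real \<Rightarrow> real" and h :: "int \<Rightarrow> real \<Rightarrow> real" and b :: "int \<Rightarrow> real"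
  assumes sol: "solves_on \<nu> lam N \<tau> T u v" and t: "t \<in> {\<tau>..T}"
    and lam_lo: "\<And>i t. lam_lo \<le> lam i t"
    and N: "\<And>i x t. t \<in> {\<tau>..T} \<Longrightarrow> 2 * x * N i x t \<le> k t * x\<^sup>2 + h i t"
    and k: "continuous_on {\<tau>..T} k" and p: "continuous_on {\<tau>..T} p"
    and h: "\<And>i. continuous_on {\<tau>..T} (h i)" "\<And>i t. 0 \<le> h i t"
      "\<And>i t. h (i - 1) t + h (i + 1) t \<le> (2 + \<epsilon>) * h i t"
    and b: "\<And>i. (coord u i)\<^sup>2 \<le> b i" "\<And>i. b (i - 1) + b (i + 1) \<le> (2 + \<epsilon>) * b i"
    and \<epsilon>: "0 \<le> \<epsilon>" and kp: "\<And>t. t \<in> {\<tau>..T} \<Longrightarrow> k t - 2 * lam_lo + nu_hi * \<epsilon> \<le> p t"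
  shows "(coord (v t) i)\<^sup>2 \<le>
    exp (integral {\<tau>..t} p) * (b i + integral {\<tau>..t} (\<lambda>s. exp (- integral {\<tau>..s} p) * h i s))"
proof -
  have hi: "0 \<le> nu_hi" using \<nu>_bounds[of 0 0] by linarith
  have \<tau>T: "\<tau> \<le> T" using t by auto
  have cv: "continuous_on {\<tau>..T} v" using sol by (simp add: solves_on_def)
  define w where "w i t = (coord (v t) i)\<^sup>2" for i t
  \<comment> \<open>Variation of constants: \<open>W\<close> starts at \<open>b\<close> and solves
    \<open>W' = p * W + h\<close> site by site, while the neighbour conditions on \<open>b\<close>
    and \<open>h\<close> are inherited by \<open>C\<close> and \<open>W\<close>.\<close>
  define Q where "Q t = integral {\<tau>..t} p" for t
  define C where "C i t = b i + integral {\<tau>..t} (\<lambda>s. exp (- Q s) * h i s)" for i t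
  define W where "W i t = exp (Q t) * C i t" for i t
  define r where "r i t = lrhs \<nu> lam N t (v t) i" for i t
  have b0: "0 \<le> b i" for i using b(1)[of i] zero_le_power2 order_trans by blast
  have dQ: "(Q has_vector_derivative p t) (at t within {\<tau>..T})" if "t \<in> {\<tau>..T}" for t
    unfolding Q_def by (rule integral_has_vector_derivative[OF p that])
  have cQ: "continuous_on {\<tau>..T} Q"
    unfolding continuous_on_eq_continuous_within using dQ has_vector_derivative_continuous by blast
  have ceh: "continuous_on {\<tau>..T} (\<lambda>s. exp (- Q s) * h i s)" for i
    by (intro continuous_intros cQ h)
  have dC: "(C i has_vector_derivative exp (- Q t) * h i t) (at t within {\<tau>..T})" if "t \<in> {\<tau>..T}" for t i
    unfolding C_def using integral_has_vector_derivative[OF ceh that, of i]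
    by (auto intro!: derivative_eq_intros)
  have cC: "continuous_on {\<tau>..T} (C i)" for i
    unfolding continuous_on_eq_continuous_within using dC has_vector_derivative_continuous by blast
  have cW: "continuous_on {\<tau>..T} (W i)" for i
    unfolding W_def by (intro continuous_intros cQ cC)
  have dW: "(W i has_vector_derivative p t * W i t + h i t) (at t within {\<tau>..T})" if "t \<in> {\<tau>..T}" for t i
    using dQ[OF that] dC[OF that, of i]
    unfolding W_def has_real_derivative_iff_has_vector_derivative[symmetric]
    by (auto intro!: derivative_eq_intros simp: exp_minus algebra_simps)
  have C0: "0 \<le> C i t" if t: "t \<in> {\<tau>..T}" for i t
  proof -
    have "continuous_on {\<tau>..t} (\<lambda>s. exp (- Q s) * h i s)" by (rule continuous_on_subset[OF ceh]) (use t in auto)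
    then have "0 \<le> integral {\<tau>..t} (\<lambda>s. exp (- Q s) * h i s)"
      by (intro integral_nonneg integrable_continuous_real) (auto simp: h(2))
    then show ?thesis using b0[of i] by (simp add: C_def)
  qed
  have W0: "0 \<le> W i t" if "t \<in> {\<tau>..T}" for i t using C0[OF that] by (simp add: W_def)
  have Csup: "C (i - 1) t + C (i + 1) t \<le> (2 + \<epsilon>) * C i t" if t: "t \<in> {\<tau>..T}" for i t
  proof -
    have int: "(\<lambda>s. exp (- Q s) * h i s) integrable_on {\<tau>..t}" for i
      by (rule integrable_continuous_real[OF continuous_on_subset[OF ceh]]) (use t in auto)
    have "integral {\<tau>..t} (\<lambda>s. exp (- Q s) * h (i - 1) s) + integral {\<tau>..t} (\<lambda>s. exp (- Q s) * h (i + 1) s)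
      = integral {\<tau>..t} (\<lambda>s. exp (- Q s) * h (i - 1) s + exp (- Q s) * h (i + 1) s)"
      by (rule integral_add[symmetric, OF int int])
    also have "\<dots> \<le> integral {\<tau>..t} (\<lambda>s. (2 + \<epsilon>) * (exp (- Q s) * h i s))"
    proof (rule integral_le)
      fix s
      have "exp (- Q s) * (h (i - 1) s + h (i + 1) s) \<le> exp (- Q s) * ((2 + \<epsilon>) * h i s)"
        by (rule mult_left_mono[OF h(3)]) simp
      then show "exp (- Q s) * h (i - 1) s + exp (- Q s) * h (i + 1) s \<le> (2 + \<epsilon>) * (exp (- Q s) * h i s)"
        by (simp add: algebra_simps)
    qed (intro integrable_add integrable_on_mult_right int)+
    also have "\<dots> = (2 + \<epsilon>) * integral {\<tau>..t} (\<lambda>s. exp (- Q s) * h i s)" by (rule integral_mult_right)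
    finally show ?thesis using b(2)[of i] unfolding C_def distrib_left by linarith
  qed
  have Wsup: "W (i - 1) t + W (i + 1) t \<le> (2 + \<epsilon>) * W i t" if t: "t \<in> {\<tau>..T}" for i t
    using mult_left_mono[OF Csup[OF t, of i], of "exp (Q t)"] by (simp add: W_def algebra_simps)
  obtain B where "\<forall>t\<in>{\<tau>..T}. norm (v t) \<le> B"
    using compact_imp_bounded[OF compact_continuous_image[OF cv]] unfolding bounded_iff by auto
  note B = this[rule_format]
  have B0: "0 \<le> B" using B[OF t] norm_ge_zero order_trans by blast
  obtain M1 where M1: "\<And>t. t \<in> {\<tau>..T} \<Longrightarrow> norm (field t (v t)) \<le> M1"
    by (rule field_bounded[OF cv]) (rule that)
  have "bounded (k ` {\<tau>..T})" by (intro compact_imp_bounded compact_continuous_image k) auto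
  then obtain Kk where Kk: "\<forall>t\<in>{\<tau>..T}. \<bar>k t\<bar> \<le> Kk" by (auto simp: bounded_iff)
  have rb: "\<bar>r i t\<bar> \<le> M1" if "t \<in> {\<tau>..T}" for i t
    using abs_coord_le_norm[of "field t (v t)" i] M1[OF that] by (simp add: coord_field r_def)
  have ri: "r i absolutely_integrable_on {\<tau>..T}" for i
    unfolding r_def by (rule lrhs_integrable[OF cv])
  have u: "coord u i = coord (v \<tau>) i" for i
    using sol \<tau>T by (simp add: solves_on_def)
  have vr: "coord (v t) i = coord (v \<tau>) i + integral {\<tau>..t} (r i)" if "t \<in> {\<tau>..T}" for i t
    using sol that unfolding u[symmetric] by (simp add: solves_on_def r_def[abs_def])
  have wi: "(\<lambda>t. 2 * coord (v t) i * r i t) integrable_on {\<tau>..T}" for i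
    using square_of_indefinite_integral(2)[OF ri rb vr, of i]
    by (rule absolutely_integrable_on_def[THEN iffD1, THEN conjunct1])
  have w: "w i t = w i \<tau> + integral {\<tau>..t} (\<lambda>t. 2 * coord (v t) i * r i t)" if "t \<in> {\<tau>..T}" for i t
    unfolding w_def by (rule square_of_indefinite_integral(3)[OF ri rb vr that])
  have cw: "continuous_on {\<tau>..T} (w i)" for i
    unfolding w_def by (intro continuous_intros continuous_on_coord cv)
  \<comment> \<open>The growth constant for \<open>D = w - W\<close>: \<open>2 * nu_hi\<close> from
    the two neighbours, the rest from the diagonal term. The choice
    \<open>\<kappa> = 2 * K + 1\<close> makes the gain \<open>K / \<kappa>\<close> at most one
    half.\<close>
  define K where "K = 2 * nu_hi + Kk + \<bar>2 * lam_lo\<bar>"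
  have Kk0: "0 \<le> Kk" using Kk t by force
  have K0: "0 \<le> K" using hi Kk0 by (simp add: K_def)
  define \<kappa> where "\<kappa> = 2 * K + 1"
  have \<kappa>: "0 < \<kappa>" "K / \<kappa> \<le> 1/2" using K0 by (auto simp: \<kappa>_def field_simps)
  define D where "D i t = w i t - W i t" for i t
  \<comment> \<open>Inserting 0 makes the supremum nonnegative. It is finite since \<open>W\<close>
    is nonnegative and the squares are bounded by \<open>B\<^sup>2\<close> at all sites at once, by
    continuity of \<open>v\<close> in the norm.\<close>
  define S where "S = insert 0 {exp (- (\<kappa> * (t - \<tau>))) * D i t | i t. t \<in> {\<tau>..T}}"
  define M where "M = Sup S"
  have bdd: "bdd_above S"
  proof (rule bdd_aboveI)
    fix x assume "x \<in> S"
    then consider "x = 0" | i t where "t \<in> {\<tau>..T}" "x = exp (- (\<kappa> * (t - \<tau>))) * D i t" by (auto simp: S_def)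
    then show "x \<le> B\<^sup>2"
    proof cases
      case 2
      have "\<bar>coord (v t) i\<bar> \<le> B" using abs_coord_le_norm B[OF 2(1)] order_trans by blast
      then have "w i t \<le> B\<^sup>2" unfolding w_def by (metis abs_le_square_iff abs_of_nonneg B0)
      then have "D i t \<le> B\<^sup>2" using W0[OF 2(1), of i] by (simp add: D_def)
      moreover have "exp (- (\<kappa> * (t - \<tau>))) \<le> 1" using \<kappa>(1) 2(1) by simp
      ultimately have "exp (- (\<kappa> * (t - \<tau>))) * D i t \<le> exp (- (\<kappa> * (t - \<tau>))) * B\<^sup>2"
        "exp (- (\<kappa> * (t - \<tau>))) * B\<^sup>2 \<le> 1 * B\<^sup>2"
        by - (rule mult_left_mono[OF _ exp_ge_zero] mult_right_mono[OF _ zero_le_power2], assumption)+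
      then show ?thesis unfolding 2(2) by linarith
    qed simp
  qed
  have ee: "exp a * (exp (- a) * x) = x" for a x :: real by (simp add: exp_minus)
  have M0: "0 \<le> M" unfolding M_def by (rule cSup_upper[OF _ bdd]) (simp add: S_def)
  have DM: "D i t \<le> M * exp (\<kappa> * (t - \<tau>))" if "t \<in> {\<tau>..T}" for i t
  proof -
    have "exp (- (\<kappa> * (t - \<tau>))) * D i t \<le> M"
      unfolding M_def by (rule cSup_upper[OF _ bdd]) (use that in \<open>auto simp: S_def\<close>)
    then have "exp (\<kappa> * (t - \<tau>)) * (exp (- (\<kappa> * (t - \<tau>))) * D i t) \<le> exp (\<kappa> * (t - \<tau>)) * M"
      by (rule mult_left_mono) simp
    then show ?thesis unfolding ee by (simp add: mult.commute)
  qed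
  have Dle: "D i t \<le> integral {\<tau>..t} (\<lambda>s. K * M * exp (\<kappa> * (s - \<tau>)))" if t: "t \<in> {\<tau>..T}" for i t
  proof (rule le_integral_if_deriv_le_where_positive[where d = "\<lambda>s. 2 * coord (v s) i * r i s - (p s * W i s + h i s)"])
    show "continuous_on {\<tau>..T} (D i)" unfolding D_def by (intro continuous_intros cw cW)
    have iW: "(\<lambda>s. p s * W i s + h i s) integrable_on {\<tau>..T}"
      by (intro integrable_continuous_real continuous_intros p cW h)
    show "(\<lambda>s. 2 * coord (v s) i * r i s - (p s * W i s + h i s)) integrable_on {\<tau>..T}"
      by (intro integrable_diff wi iW)
    show "D i t = D i \<tau> + integral {\<tau>..t} (\<lambda>s. 2 * coord (v s) i * r i s - (p s * W i s + h i s))"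
      if t: "t \<in> {\<tau>..T}" for t
    proof -
      have sub: "{\<tau>..t} \<subseteq> {\<tau>..T}" using t by auto
      have "((\<lambda>s. p s * W i s + h i s) has_integral W i t - W i \<tau>) {\<tau>..t}"
      proof (rule fundamental_theorem_of_calculus)
        show "(W i has_vector_derivative p s * W i s + h i s) (at s within {\<tau>..t})" if "s \<in> {\<tau>..t}" for s
          using has_vector_derivative_within_subset[OF dW sub] that sub by blast
      qed (use t in auto)
      then have "W i t = W i \<tau> + integral {\<tau>..t} (\<lambda>s. p s * W i s + h i s)"
        by (simp add: integral_unique)
      moreover have "integral {\<tau>..t} (\<lambda>s. 2 * coord (v s) i * r i s - (p s * W i s + h i s))
        = integral {\<tau>..t} (\<lambda>s. 2 * coord (v s) i * r i s) - integral {\<tau>..t} (\<lambda>s. p s * W i s + h i s)"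
        by (intro integral_diff integrable_on_subinterval[OF wi sub] integrable_on_subinterval[OF iW sub])
      ultimately show ?thesis using w[OF t, of i] by (simp add: D_def)
    qed
    show "D i \<tau> \<le> 0"
      using b(1)[of i] by (simp add: D_def w_def W_def C_def Q_def u)
    show "(\<lambda>s. K * M * exp (\<kappa> * (s - \<tau>))) integrable_on {\<tau>..T}"
      by (intro integrable_continuous_real continuous_intros)
    show "0 \<le> K * M * exp (\<kappa> * (s - \<tau>))" for s using K0 M0 by simp
    show "t \<in> {\<tau>..T}" by (rule t)
    fix s assume s: "s \<in> {\<tau>..T}" and pos: "0 < D i s"
    define E where "E = M * exp (\<kappa> * (s - \<tau>))"
    have E: "D j s \<le> E" for j unfolding E_def by (rule DM[OF s])
    define n where "n = \<nu> i s"
    have n: "0 \<le> n" "n \<le> nu_hi" using \<nu>_bounds by (auto simp: n_def)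
    let ?x = "\<lambda>j. coord (v s) j"
    have "2 * ?x i * r i s = n * (2 * ?x i * ?x (i - 1) + 2 * ?x i * ?x (i + 1) - 4 * (?x i)\<^sup>2)
        - 2 * lam i s * (?x i)\<^sup>2 + 2 * ?x i * N i (?x i) s"
      by (simp add: r_def lrhs_def lap_def n_def power2_eq_square algebra_simps)
    \<comment> \<open>Young's inequality bounds the coupling by the discrete Laplacian of the
      squares, in which the neighbours enter with a nonnegative sign.\<close>
    moreover have "n * (2 * ?x i * ?x (i - 1) + 2 * ?x i * ?x (i + 1) - 4 * (?x i)\<^sup>2)
        \<le> n * (w (i - 1) s + w (i + 1) s - 2 * w i s)"
    proof (rule mult_left_mono[OF _ n(1)])
      have "0 \<le> (?x i - ?x (i - 1))\<^sup>2" "0 \<le> (?x i - ?x (i + 1))\<^sup>2" by simp_all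
      then show "2 * ?x i * ?x (i - 1) + 2 * ?x i * ?x (i + 1) - 4 * (?x i)\<^sup>2 \<le> w (i - 1) s + w (i + 1) s - 2 * w i s"
        unfolding w_def power2_diff by linarith
    qed
    moreover have "2 * lam i s * (?x i)\<^sup>2 \<ge> 2 * lam_lo * w i s"
      unfolding w_def using lam_lo[of i s] by (intro mult_right_mono) auto
    moreover have "2 * ?x i * N i (?x i) s \<le> k s * w i s + h i s"
      using N[OF s, of "?x i" i] by (simp add: w_def)
    ultimately have 1: "2 * ?x i * r i s \<le> n * (w (i - 1) s + w (i + 1) s - 2 * w i s) - 2 * lam_lo * w i s + (k s * w i s + h i s)"
      by linarith
    \<comment> \<open>Here \<open>W\<close> pays for the coupling: the factor
      \<open>2 + \<epsilon>\<close> leaves only \<open>\<epsilon> * W i s\<close>, which the choice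
      of \<open>p\<close> in \<open>kp\<close> covers.\<close>
    have "n * (W (i - 1) s + W (i + 1) s - 2 * W i s) \<le> n * (\<epsilon> * W i s)"
      using Wsup[OF s, of i] n by (intro mult_left_mono) (auto simp: algebra_simps)
    also have "\<dots> \<le> nu_hi * (\<epsilon> * W i s)"
      using n W0[OF s, of i] \<epsilon> by (intro mult_right_mono) auto
    finally have 2: "n * (W (i - 1) s + W (i + 1) s - 2 * W i s) \<le> nu_hi * \<epsilon> * W i s" by simp
    have 3: "(k s - 2 * lam_lo + nu_hi * \<epsilon>) * W i s \<le> p s * W i s"
      by (rule mult_right_mono[OF kp[OF s] W0[OF s]])
    have "2 * ?x i * r i s - (p s * W i s + h i s)
      \<le> n * (D (i - 1) s + D (i + 1) s - 2 * D i s) + (k s - 2 * lam_lo) * D i s"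
      using 1 2 3 by (simp add: D_def algebra_simps)
    \<comment> \<open>As \<open>D i s\<close> is positive, the term \<open>- 2 * D i s\<close> may
      be dropped; this is the comparison principle for the coupling.\<close>
    also have "n * (D (i - 1) s + D (i + 1) s - 2 * D i s) \<le> n * (2 * E)"
      using E[of "i - 1"] E[of "i + 1"] pos n by (intro mult_left_mono) auto
    also have "n * (2 * E) \<le> nu_hi * (2 * E)"
      using n E[of i] pos by (intro mult_right_mono) auto
    also have "(k s - 2 * lam_lo) * D i s \<le> (Kk + \<bar>2 * lam_lo\<bar>) * E"
      using Kk[rule_format, OF s] pos E[of i] Kk0 by (intro mult_mono) auto
    finally show "2 * ?x i * r i s - (p s * W i s + h i s) \<le> K * M * exp (\<kappa> * (s - \<tau>))"
      by (simp add: K_def E_def algebra_simps)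
  qed
  have "M \<le> M / 2"
  proof -
    have "x \<le> M / 2" if "x \<in> S" for x
    proof -
      from that consider "x = 0" | i t where "t \<in> {\<tau>..T}" "x = exp (- (\<kappa> * (t - \<tau>))) * D i t" by (auto simp: S_def)
      then show ?thesis
      proof cases
        case 2
        have "D i t \<le> (K * M) * integral {\<tau>..t} (\<lambda>s. exp (\<kappa> * (s - \<tau>)))"
          using Dle[OF 2(1), of i] by simp
        also have "\<dots> \<le> (K * M) * (exp (\<kappa> * (t - \<tau>)) / \<kappa>)"
          by (rule mult_left_mono) (use integral_exp_le[OF \<kappa>(1), of \<tau> t \<tau>] 2 K0 M0 in auto)
        also have "\<dots> = (K / \<kappa>) * (M * exp (\<kappa> * (t - \<tau>)))" by simp
        also have "\<dots> \<le> 1/2 * (M * exp (\<kappa> * (t - \<tau>)))"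
          by (rule mult_right_mono[OF \<kappa>(2)]) (use M0 in auto)
        finally have "exp (- (\<kappa> * (t - \<tau>))) * D i t \<le> exp (- (\<kappa> * (t - \<tau>))) * (1/2 * (M * exp (\<kappa> * (t - \<tau>))))"
          by (rule mult_left_mono) simp
        also have "exp (- (\<kappa> * (t - \<tau>))) * (1/2 * (M * exp (\<kappa> * (t - \<tau>)))) = M / 2"
          using ee[of "\<kappa> * (t - \<tau>)" "M / 2"] by (simp add: mult_ac)
        finally show ?thesis using 2(2) by simp
      qed (use M0 in simp)
    qed
    then have "Sup S \<le> M / 2" by (intro cSup_least) (auto simp: S_def)
    then show ?thesis by (simp add: M_def)
  qed
  then have "M = 0" using M0 by linarith
  then have "D i t \<le> 0" using DM[OF t, of i] by simp
  then show ?thesis by (simp add: D_def w_def W_def C_def Q_def)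
qed

section \<open>Geometric weights over the sites\<close>

definition damp :: "real \<Rightarrow> int \<Rightarrow> ell2 \<Rightarrow> ell2"
  where "damp q i u = Abs_ell2 (\<lambda>k. q ^ nat \<bar>i - k\<bar> * coord u k)"

text \<open>A squared norm instead of the convolution in \<open>spread_has_sum\<close>, to obtain continuity in \<open>u\<close>.\<close>

definition spread :: "real \<Rightarrow> ell2 \<Rightarrow> int \<Rightarrow> real"
  where "spread q u i = (norm (damp q i u))\<^sup>2"

lemma
  assumes q: "0 \<le> q" "q \<le> 1"
  shows coord_damp: "coord (damp q i u) = (\<lambda>k. q ^ nat \<bar>i - k\<bar> * coord u k)"
    and bounded_linear_damp: "bounded_linear (damp q i)"
proof -
  have c: "coord (damp q i u) = (\<lambda>k. q ^ nat \<bar>i - k\<bar> * coord u k)" and n: "norm (damp q i u) \<le> norm u" for u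
  proof -
    have "q ^ nat \<bar>i - k\<bar> * \<bar>coord u k\<bar> \<le> \<bar>coord u k\<bar>" for k
      by (intro mult_left_le_one_le) (use q in \<open>auto simp: power_le_one\<close>)
    then have "\<bar>q ^ nat \<bar>i - k\<bar> * coord u k\<bar> \<le> 0 * \<bar>coord u (k - 1)\<bar> + 1 * \<bar>coord u k\<bar> + 0 * \<bar>coord u (k + 1)\<bar>" for k
      using q by (simp add: abs_mult)
    from ell2_neighbour_bound[OF _ _ this]
    show "coord (damp q i u) = (\<lambda>k. q ^ nat \<bar>i - k\<bar> * coord u k)" "norm (damp q i u) \<le> norm u"
      by (simp_all add: damp_def)
  qed
  show "coord (damp q i u) = (\<lambda>k. q ^ nat \<bar>i - k\<bar> * coord u k)" by (rule c)
  show "bounded_linear (damp q i)"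
    by (rule bounded_linear_intro[where K=1]) (auto simp: c n coord_simps algebra_simps intro!: ell2_ext)
qed

lemma spread_nonneg: "0 \<le> spread q u i"
  by (simp add: spread_def)

lemma continuous_on_spread:
  assumes "0 \<le> q" "q \<le> 1" "continuous_on S v"
  shows "continuous_on S (\<lambda>t. spread q (v t) i)"
  unfolding spread_def
  by (intro continuous_intros bounded_linear.continuous_on[OF bounded_linear_damp] assms)

lemma coord_sq_le_spread:
  assumes "0 \<le> q" "q \<le> 1"
  shows "(coord u i)\<^sup>2 \<le> spread q u i"
  using sum_coord_sq_le[of "{i}" "damp q i u"] by (simp add: spread_def coord_damp assms)

lemma spread_has_sum:
  assumes "0 \<le> q" "q \<le> 1"
  shows "((\<lambda>k. (q\<^sup>2) ^ nat \<bar>i - k\<bar> * (coord u k)\<^sup>2) has_sum spread q u i) UNIV"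
  using has_sum_infsum[OF coord_summable[of "damp q i u"]]
  by (simp add: spread_def norm_sq_ell2 coord_damp assms power_mult_distrib power_mult[symmetric] mult.commute)

text \<open>Away from the centre \<open>k\<close> the weight is an eigenfunction of the neighbour
  sum with eigenvalue \<open>x + 1 / x\<close>; at the centre the sum is \<open>2 * x\<close>, which
  is no larger because \<open>x \<le> 1\<close>.\<close>

lemma geometric_neighbours_le:
  fixes i k :: int and x :: real
  assumes x: "0 < x" "x \<le> 1"
  shows "x ^ nat \<bar>i - 1 - k\<bar> + x ^ nat \<bar>i + 1 - k\<bar> \<le> (x + 1 / x) * x ^ nat \<bar>i - k\<bar>"
proof -
  have step: "x ^ n + x ^ Suc (Suc n) = (x + 1 / x) * x ^ Suc n" for n
    using x by (simp add: field_simps)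
  consider "i = k" | n where "i - k = int (Suc n)" | n where "k - i = int (Suc n)"
    by (metis linorder_neqE_linordered_idom diff_gt_0_iff_gt pos_int_cases gr0_conv_Suc)
  then show ?thesis
  proof cases
    case 1
    have "x * x \<le> 1" using x by (simp add: mult_le_one)
    then have "x \<le> 1 / x" using x by (simp add: field_simps)
    then show ?thesis using 1 by simp
  next
    case 2
    then have "nat \<bar>i - 1 - k\<bar> = n" "nat \<bar>i + 1 - k\<bar> = Suc (Suc n)" "nat \<bar>i - k\<bar> = Suc n" by auto
    then show ?thesis using step[of n] by (simp only:)
  next
    case 3
    then have "nat \<bar>i + 1 - k\<bar> = n" "nat \<bar>i - 1 - k\<bar> = Suc (Suc n)" "nat \<bar>i - k\<bar> = Suc n" by auto
    then show ?thesis using step[of n] by (simp only:)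
  qed
qed

text \<open>The weights of the convolution have this property by
  \<open>geometric_neighbours_le\<close>, and it survives summation against the nonnegative
  \<open>(coord u k)\<^sup>2\<close>.\<close>

lemma spread_neighbours_le:
  assumes q: "0 < q" "q \<le> 1" and \<epsilon>: "q\<^sup>2 + 1 / q\<^sup>2 \<le> 2 + \<epsilon>"
  shows "spread q u (i - 1) + spread q u (i + 1) \<le> (2 + \<epsilon>) * spread q u i"
proof -
  have S: "((\<lambda>k. (q\<^sup>2) ^ nat \<bar>i - k\<bar> * (coord u k)\<^sup>2) has_sum spread q u i) UNIV" for i
    by (rule spread_has_sum) (use q in auto)
  show ?thesis
  proof (rule has_sum_mono[OF has_sum_add[OF S S] has_sum_cmult_right[OF S]])
    fix k
    have q2: "0 < q\<^sup>2" "q\<^sup>2 \<le> 1" using q by (auto simp: power_le_one)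
    have "(q\<^sup>2) ^ nat \<bar>i - 1 - k\<bar> + (q\<^sup>2) ^ nat \<bar>i + 1 - k\<bar> \<le> (q\<^sup>2 + 1 / q\<^sup>2) * (q\<^sup>2) ^ nat \<bar>i - k\<bar>"
      by (rule geometric_neighbours_le[OF q2])
    also have "\<dots> \<le> (2 + \<epsilon>) * (q\<^sup>2) ^ nat \<bar>i - k\<bar>"
      by (rule mult_right_mono[OF \<epsilon>]) simp
    finally have "((q\<^sup>2) ^ nat \<bar>i - 1 - k\<bar> + (q\<^sup>2) ^ nat \<bar>i + 1 - k\<bar>) * (coord u k)\<^sup>2
        \<le> ((2 + \<epsilon>) * (q\<^sup>2) ^ nat \<bar>i - k\<bar>) * (coord u k)\<^sup>2"
      by (rule mult_right_mono) simp
    then show "(q\<^sup>2) ^ nat \<bar>i - 1 - k\<bar> * (coord u k)\<^sup>2 + (q\<^sup>2) ^ nat \<bar>i + 1 - k\<bar> * (coord u k)\<^sup>2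
        \<le> (2 + \<epsilon>) * ((q\<^sup>2) ^ nat \<bar>i - k\<bar> * (coord u k)\<^sup>2)"
      by (simp add: algebra_simps)
  qed
qed

lemma sum_geometric_int_le:
  fixes x :: real and J :: "int set"
  assumes x: "0 \<le> x" "x < 1" and J: "finite J"
  shows "(\<Sum>i\<in>J. x ^ nat \<bar>i - k\<bar>) \<le> 2 / (1 - x)"
proof -
  have half: "(\<Sum>i\<in>K. x ^ nat \<bar>i - k\<bar>) \<le> 1 / (1 - x)" if K: "finite K" "inj_on (\<lambda>i. nat \<bar>i - k\<bar>) K" for K
  proof -
    have "(\<Sum>i\<in>K. x ^ nat \<bar>i - k\<bar>) = (\<Sum>n\<in>(\<lambda>i. nat \<bar>i - k\<bar>) ` K. x ^ n)"
      by (simp add: sum.reindex[OF K(2)])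
    also have "\<dots> \<le> (\<Sum>n. x ^ n)"
      by (rule sum_le_suminf) (use x K in \<open>auto intro!: summable_geometric\<close>)
    also have "\<dots> = 1 / (1 - x)" by (rule suminf_geometric) (use x in auto)
    finally show ?thesis .
  qed
  have "(\<Sum>i\<in>J. x ^ nat \<bar>i - k\<bar>) = (\<Sum>i\<in>J\<inter>{k..}. x ^ nat \<bar>i - k\<bar>) + (\<Sum>i\<in>J-{k..}. x ^ nat \<bar>i - k\<bar>)"
    by (rule sum.Int_Diff[OF J])
  also have "\<dots> \<le> 1 / (1 - x) + 1 / (1 - x)"
    by (intro add_mono half) (use J in \<open>auto simp: inj_on_def\<close>)
  finally show ?thesis by simp
qed

text \<open>Exchanging the sums leaves for each \<open>k\<close> the total weight of a two-sided
  geometric series, so spreading costs only a constant factor in the squared norm.\<close>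

lemma sum_spread_le:
  assumes q: "0 < q" "q < 1" and J: "finite J"
  shows "(\<Sum>i\<in>J. spread q u i) \<le> 2 / (1 - q\<^sup>2) * (norm u)\<^sup>2"
proof -
  have S: "((\<lambda>k. \<Sum>i\<in>J. (q\<^sup>2) ^ nat \<bar>i - k\<bar> * (coord u k)\<^sup>2) has_sum (\<Sum>i\<in>J. spread q u i)) UNIV"
    using J
  proof (induction J rule: finite_induct)
    case (insert i J)
    then show ?case using has_sum_add[OF spread_has_sum[of q i u]] q by (simp add: less_imp_le)
  qed simp
  have N: "((\<lambda>k. (coord u k)\<^sup>2) has_sum (norm u)\<^sup>2) UNIV"
    unfolding norm_sq_ell2 by (rule has_sum_infsum[OF coord_summable])
  show ?thesis
  proof (rule has_sum_mono[OF S has_sum_cmult_right[OF N]])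
    fix k
    have "(\<Sum>i\<in>J. (q\<^sup>2) ^ nat \<bar>i - k\<bar>) \<le> 2 / (1 - q\<^sup>2)"
      by (rule sum_geometric_int_le) (use q J in \<open>auto simp: power_less_one_iff\<close>)
    then have "(\<Sum>i\<in>J. (q\<^sup>2) ^ nat \<bar>i - k\<bar>) * (coord u k)\<^sup>2 \<le> 2 / (1 - q\<^sup>2) * (coord u k)\<^sup>2"
      by (rule mult_right_mono) simp
    then show "(\<Sum>i\<in>J. (q\<^sup>2) ^ nat \<bar>i - k\<bar> * (coord u k)\<^sup>2) \<le> 2 / (1 - q\<^sup>2) * (coord u k)\<^sup>2"
      by (simp add: sum_distrib_right)
  qed
qed

lemma spread_parameter:
  assumes "0 < (\<epsilon>::real)"
  obtains q where "0 < q" "q < 1" "q\<^sup>2 + 1 / q\<^sup>2 \<le> 2 + \<epsilon>"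
proof -
  define \<delta> where "\<delta> = min 1 \<epsilon>"
  have \<delta>: "0 < \<delta>" "\<delta> \<le> 1" "\<delta> \<le> \<epsilon>" using assms by (auto simp: \<delta>_def)
  define q where "q = sqrt (1 / (1 + \<delta>))"
  have q2: "q\<^sup>2 = 1 / (1 + \<delta>)" using \<delta> by (simp add: q_def)
  \<comment> \<open>This gives
    \<open>1 / (1 + \<delta>) \<le> 1 - \<delta> + \<delta> * \<delta>\<close>, so in
    \<open>q\<^sup>2 + 1 / q\<^sup>2\<close> the first-order terms cancel and at most
    \<open>2 + \<delta> * \<delta>\<close> remains.\<close>
  have "(1 - \<delta> + \<delta> * \<delta>) * (1 + \<delta>) = 1 + \<delta> * \<delta> * \<delta>" by (simp add: algebra_simps)
  then have "1 / (1 + \<delta>) \<le> 1 - \<delta> + \<delta> * \<delta>"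
    using \<delta> by (simp add: pos_divide_le_eq)
  moreover have "\<delta> * \<delta> \<le> \<epsilon>" using \<delta> by (metis mult_left_le order_trans less_imp_le)
  ultimately have "q\<^sup>2 + 1 / q\<^sup>2 \<le> 2 + \<epsilon>" by (simp add: q2)
  moreover have "0 < q" "q < 1" using \<delta> by (auto simp: q_def)
  ultimately show ?thesis by (rule that[rotated 2])
qed

section \<open>The nonlinearity with cut-off argument\<close>

definition clip :: "real \<Rightarrow> real \<Rightarrow> real"
  where "clip R x = max (- R) (min R x)"

lemma clip_eq: "\<bar>x\<bar> \<le> R \<Longrightarrow> clip R x = x"
  by (auto simp: clip_def)

lemma abs_clip_le: "0 \<le> R \<Longrightarrow> \<bar>clip R x\<bar> \<le> R"
  by (auto simp: clip_def)

lemma abs_clip_diff_le: "\<bar>clip R x - clip R y\<bar> \<le> \<bar>x - y\<bar>"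
  by (auto simp: clip_def max_def min_def)

lemma continuous_on_clip [continuous_intros]: "continuous_on S h \<Longrightarrow> continuous_on S (\<lambda>x. clip R (h x))"
  unfolding clip_def by (intro continuous_intros)

text \<open>The cut-off acts on \<open>exp (z t) * x\<close>, the argument of \<open>f\<close>,
  because the derivative of \<open>f\<close> is bounded, uniformly over the sites, on bounded
  intervals of that variable. Where \<open>\<bar>exp (z t) * x\<bar> \<le> R\<close> nothing is
  changed.\<close>

definition reaction ::
  "(int \<Rightarrow> real \<Rightarrow> real \<Rightarrow> real) \<Rightarrow> (real \<Rightarrow> ell2) \<Rightarrow> (real \<Rightarrow> real) \<Rightarrow> real \<Rightarrow> int \<Rightarrow> real \<Rightarrow> real \<Rightarrow> real"
  where "reaction f g z R i x t =
    z t * x - exp (- z t) * f i (clip R (exp (z t) * x)) t + exp (- z t) * coord (g t) i"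

text \<open>Naming the witnesses of the existential assumptions allows weights, kernels and radii to
  be definitions depending on them.\<close>

locale lattice_system =
  fixes \<nu> lam :: "int \<Rightarrow> real \<Rightarrow> real" and f :: "int \<Rightarrow> real \<Rightarrow> real \<Rightarrow> real" and g :: "real \<Rightarrow> ell2"
    and lam_lo lam_hi nu_hi :: real and \<alpha> :: "real \<Rightarrow> ell2" and \<zeta> :: "real \<Rightarrow> real \<Rightarrow> real"
  assumes \<nu>_int: "\<And>i a b. \<nu> i absolutely_integrable_on {a..b}"
    and lam_int: "\<And>i a b. lam i absolutely_integrable_on {a..b}"
    and \<nu>_bounds: "\<And>i t. 0 \<le> \<nu> i t" "\<And>i t. \<nu> i t \<le> nu_hi"
    and lam_lo: "0 < lam_lo" and lam_bounds: "\<And>i t. lam_lo \<le> lam i t" "\<And>i t. lam i t \<le> lam_hi"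
    and nu_hi: "0 < nu_hi"
    and f_cont: "\<And>i. continuous_on UNIV (\<lambda>(x, t). f i x t)"
    and f_diff: "\<And>i x t. (\<lambda>y. f i y t) differentiable (at x)"
    and f_zero: "\<And>i t. f i 0 t = 0"
    and \<alpha>: "\<alpha> \<in> bcontfun" and f_sign: "\<And>i x t. x * f i x t \<ge> - (coord (\<alpha> t) i)\<^sup>2"
    and \<zeta>_cont: "continuous_on ({0..} \<times> UNIV) (\<lambda>(\<iota>, t). \<zeta> \<iota> t)"
    and f_deriv: "\<And>\<iota> t i x. 0 \<le> \<iota> \<Longrightarrow> x \<in> {-\<iota>..\<iota>} \<Longrightarrow> \<bar>deriv (\<lambda>y. f i y t) x\<bar> \<le> \<zeta> \<iota> t"
    and g: "g \<in> bcontfun"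
begin

lemma f_lipschitz:
  assumes R: "0 \<le> R" and "\<bar>x\<bar> \<le> R" "\<bar>y\<bar> \<le> R"
  shows "\<bar>f i x t - f i y t\<bar> \<le> \<zeta> R t * \<bar>x - y\<bar>"
proof -
  have "norm (f i x t - f i y t) \<le> \<zeta> R t * norm (x - y)"
  proof (rule field_differentiable_bound[where S = "{-R..R}"])
    fix z assume z: "z \<in> {-R..R}"
    have "((\<lambda>y. f i y t) has_field_derivative deriv (\<lambda>y. f i y t) z) (at z)"
      using f_diff[of i t z] by (simp add: DERIV_deriv_iff_real_differentiable)
    then show "((\<lambda>y. f i y t) has_field_derivative deriv (\<lambda>y. f i y t) z) (at z within {-R..R})"
      by (rule has_field_derivative_at_within)
    show "norm (deriv (\<lambda>y. f i y t) z) \<le> \<zeta> R t" using f_deriv[OF R z] by simp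
  qed (use assms in auto)
  then show ?thesis by simp
qed

lemma continuous_f: "continuous_on S a \<Longrightarrow> continuous_on S b \<Longrightarrow> continuous_on S (\<lambda>p. f i (a p) (b p))"
  using continuous_on_compose2[OF f_cont[of i], of S "\<lambda>p. (a p, b p)"] by (simp add: continuous_on_Pair)

lemma continuous_g: "continuous_on S g" and continuous_\<alpha>: "continuous_on S \<alpha>"
  using g \<alpha> by (auto simp: bcontfun_def intro: continuous_on_subset)

lemma lattice_field_reaction:
  assumes z: "continuous_on UNIV z" and R: "0 \<le> R"
  shows "lattice_field \<nu> lam (reaction f g z R) nu_hi lam_hi (\<lambda>t. exp (- z t) *\<^sub>R g t)"
proof
  have zc: "continuous_on S z" for S using z continuous_on_subset by blast
  show "continuous_on UNIV (\<lambda>(x, t). reaction f g z R i x t)" for i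
  proof -
    have zs: "continuous_on UNIV (\<lambda>p::real\<times>real. z (snd p))"
      by (rule continuous_on_compose2[OF z]) (auto intro: continuous_intros)
    have gs: "continuous_on UNIV (\<lambda>p::real\<times>real. coord (g (snd p)) i)"
      by (rule continuous_on_coord, rule continuous_on_compose2[OF continuous_g[of UNIV]]) (auto intro: continuous_intros)
    show ?thesis unfolding case_prod_beta' reaction_def
      by (intro continuous_intros continuous_f zs gs)
  qed
  show "reaction f g z R i 0 t = coord (exp (- z t) *\<^sub>R g t) i" for i t
    using R by (simp add: reaction_def clip_eq f_zero coord_simps)
  show "continuous_on UNIV (\<lambda>t. exp (- z t) *\<^sub>R g t)"
    by (intro continuous_intros z continuous_g)
  fix a b :: real
  have "bounded (z ` {a..b})" by (intro compact_imp_bounded compact_continuous_image zc) auto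
  then obtain Z where Z: "\<forall>t\<in>{a..b}. \<bar>z t\<bar> \<le> Z" by (auto simp: bounded_iff)
  have "continuous_on {a..b} (\<lambda>t. (R, t))"
    by (rule continuous_on_Pair[OF continuous_on_const continuous_on_id])
  then have "continuous_on {a..b} (\<lambda>t. \<zeta> R t)"
    using continuous_on_compose2[OF \<zeta>_cont, of "{a..b}" "\<lambda>t. (R, t)"] R by auto
  then have "bounded ((\<lambda>t. \<zeta> R t) ` {a..b})" by (intro compact_imp_bounded compact_continuous_image) auto
  then obtain Y where Y: "\<forall>t\<in>{a..b}. \<bar>\<zeta> R t\<bar> \<le> Y" by (auto simp: bounded_iff)
  show "\<exists>L\<ge>0. \<forall>t\<in>{a..b}. \<forall>i x y. \<bar>reaction f g z R i x t - reaction f g z R i y t\<bar> \<le> L * \<bar>x - y\<bar>"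
  proof (intro exI[of _ "\<bar>Z\<bar> + \<bar>Y\<bar>"] conjI ballI allI)
    fix t i x y assume t: "t \<in> {a..b}"
    let ?c = "\<lambda>x. clip R (exp (z t) * x)"
    have "\<bar>f i (?c x) t - f i (?c y) t\<bar> \<le> \<zeta> R t * \<bar>?c x - ?c y\<bar>"
      by (rule f_lipschitz) (use R in \<open>auto simp: abs_clip_le\<close>)
    also have "\<dots> \<le> \<bar>Y\<bar> * \<bar>exp (z t) * x - exp (z t) * y\<bar>"
      using Y[rule_format, OF t] by (intro mult_mono abs_clip_diff_le) auto
    also have "\<dots> = \<bar>Y\<bar> * exp (z t) * \<bar>x - y\<bar>" by (simp add: right_diff_distrib[symmetric] abs_mult)
    \<comment> \<open>The factor \<open>exp (z t)\<close> from the argument of \<open>f\<close>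
      cancels against \<open>exp (- z t)\<close> in front of it.\<close>
    finally have "exp (- z t) * \<bar>f i (?c x) t - f i (?c y) t\<bar> \<le> exp (- z t) * (\<bar>Y\<bar> * exp (z t) * \<bar>x - y\<bar>)"
      by (rule mult_left_mono) simp
    also have "\<dots> = \<bar>Y\<bar> * \<bar>x - y\<bar>" by (simp add: exp_minus)
    finally have 1: "\<bar>exp (- z t) * (f i (?c x) t - f i (?c y) t)\<bar> \<le> \<bar>Y\<bar> * \<bar>x - y\<bar>" by (simp add: abs_mult)
    have 2: "\<bar>z t * (x - y)\<bar> \<le> \<bar>Z\<bar> * \<bar>x - y\<bar>"
      unfolding abs_mult using Z[rule_format, OF t] by (intro mult_right_mono) auto
    have "reaction f g z R i x t - reaction f g z R i y t
      = z t * (x - y) - exp (- z t) * (f i (?c x) t - f i (?c y) t)"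
      by (simp add: reaction_def algebra_simps)
    then show "\<bar>reaction f g z R i x t - reaction f g z R i y t\<bar> \<le> (\<bar>Z\<bar> + \<bar>Y\<bar>) * \<bar>x - y\<bar>"
      using 1 2 unfolding distrib_right by linarith
  qed simp
qed (use \<nu>_int lam_int \<nu>_bounds lam_bounds lam_lo in \<open>auto intro: order_trans[of 0 lam_lo]\<close>)

text \<open>The factor \<open>1 + \<bar>x\<bar>\<close> makes the bound uniform in the truncation level \<open>R\<close>, so that the a priori
  estimate for the truncated systems shows that the truncation becomes inactive.\<close>

lemma clipped_sign:
  assumes R: "1 \<le> R"
  shows "x * f i (clip R x) t \<ge> - (coord (\<alpha> t) i)\<^sup>2 * (1 + \<bar>x\<bar>)"
proof (cases "\<bar>x\<bar> \<le> R")
  case True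
  have "- (coord (\<alpha> t) i)\<^sup>2 * (1 + \<bar>x\<bar>) \<le> - (coord (\<alpha> t) i)\<^sup>2 * 1"
    by (rule mult_left_mono_neg) auto
  then show ?thesis using f_sign[where i=i and x=x and t=t] True by (simp add: clip_eq)
next
  case False
  define y where "y = clip R x"
  \<comment> \<open>Beyond the cut-off \<open>x\<close> is a positive multiple of its clipped value,
    so the sign condition at \<open>y\<close> only has to be rescaled.\<close>
  have y: "x = (\<bar>x\<bar> / R) * y" using False R by (cases "0 \<le> x") (auto simp: y_def clip_def min_def max_def)
  have "- (coord (\<alpha> t) i)\<^sup>2 * (1 + \<bar>x\<bar>) \<le> - (coord (\<alpha> t) i)\<^sup>2 * (\<bar>x\<bar> / R)"
  proof (rule mult_left_mono_neg)
    have "\<bar>x\<bar> / R \<le> \<bar>x\<bar>" using R by (simp add: divide_le_eq mult_le_cancel_left1)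
    then show "\<bar>x\<bar> / R \<le> 1 + \<bar>x\<bar>" by simp
  qed simp
  also have "\<dots> \<le> (y * f i y t) * (\<bar>x\<bar> / R)"
    by (rule mult_right_mono[OF f_sign]) (use R in simp)
  also have "\<dots> = ((\<bar>x\<bar> / R) * y) * f i y t" by (simp only: mult_ac)
  also have "\<dots> = x * f i y t" by (simp only: y[symmetric])
  finally show ?thesis by (simp add: y_def)
qed

definition C\<alpha> :: real where "C\<alpha> = (SUP t. norm (\<alpha> t))"

lemma norm_\<alpha>_le: "norm (\<alpha> t) \<le> C\<alpha>"
proof -
  have "bounded (range \<alpha>)" using \<alpha> by (simp add: bcontfun_def)
  then obtain B where "\<forall>u\<in>range \<alpha>. norm u \<le> B" unfolding bounded_iff by blast
  then have "bdd_above (range (\<lambda>t. norm (\<alpha> t)))" by (intro bdd_aboveI[of _ B]) auto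
  then show ?thesis unfolding C\<alpha>_def by (rule cSUP_upper[OF UNIV_I])
qed

definition Cg :: real where "Cg = (SUP t. norm (g t))"

lemma norm_g_le: "norm (g t) \<le> Cg"
proof -
  have "bounded (range g)" using g by (simp add: bcontfun_def)
  then obtain B where "\<forall>u\<in>range g. norm u \<le> B" unfolding bounded_iff by blast
  then have "bdd_above (range (\<lambda>t. norm (g t)))" by (intro bdd_aboveI[of _ B]) auto
  then show ?thesis unfolding Cg_def by (rule cSUP_upper[OF UNIV_I])
qed

text \<open>The 2 covers the term coming directly from the sign condition, the quotient comes from
  completing the square with weight \<open>lam_lo / 2\<close>, and \<open>C\<alpha>\<^sup>2\<close>
  bounds one of the two factors of a fourth power of \<open>\<alpha>\<close>.\<close>

definition c0 :: real where "c0 = 2 + (2 * C\<alpha>\<^sup>2 + 2) / (lam_lo / 2)"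

lemma c0_pos: "0 < c0"
  unfolding c0_def using lam_lo by (intro add_pos_nonneg divide_nonneg_pos) auto

text \<open>The terms linear in \<open>\<bar>x\<bar>\<close>, from the forcing and from the factor
  \<open>1 + \<bar>x\<bar>\<close> in \<open>clipped_sign\<close>, are absorbed by Young's
  inequality at the price \<open>lam_lo / 2 * x\<^sup>2\<close>. This leaves a fourth power of
  \<open>\<alpha>\<close>, which its uniform bound reduces to a square, so that the remainder is
  summable over the sites.\<close>

lemma reaction_dissipative:
  assumes R: "1 \<le> R"
  shows "2 * x * reaction f g z R i x t \<le> (2 * z t + lam_lo / 2) * x\<^sup>2
    + exp (- 2 * z t) * c0 * ((coord (\<alpha> t) i)\<^sup>2 + (coord (g t) i)\<^sup>2)"
proof -
  define e a c \<eta> where "e = exp (- z t)" and "a = (coord (\<alpha> t) i)\<^sup>2" and "c = coord (g t) i" and "\<eta> = lam_lo / 2"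
  have e: "0 < e" "exp (z t) = 1 / e" "exp (- 2 * z t) = e\<^sup>2"
    by (auto simp: e_def exp_minus inverse_eq_divide power2_eq_square exp_add[symmetric])
  have \<eta>: "0 < \<eta>" using lam_lo by (simp add: \<eta>_def)
  have a: "0 \<le> a" by (simp add: a_def)
  define F where "F = f i (clip R (x / e)) t"
  have "(x / e) * F \<ge> - a * (1 + \<bar>x / e\<bar>)"
    unfolding F_def a_def by (rule clipped_sign[OF R])
  then have "e\<^sup>2 * ((x / e) * F) \<ge> e\<^sup>2 * (- a * (1 + \<bar>x / e\<bar>))" by (rule mult_left_mono) simp
  moreover have "e\<^sup>2 * ((x / e) * F) = x * (e * F)" using e by (simp add: power2_eq_square)
  moreover have "e\<^sup>2 * (- a * (1 + \<bar>x / e\<bar>)) = - (e\<^sup>2 * a) - e * a * \<bar>x\<bar>"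
    using e by (simp add: power2_eq_square abs_divide field_simps)
  ultimately have 1: "- (x * (e * F)) \<le> e\<^sup>2 * a + e * a * \<bar>x\<bar>" by linarith
  have 2: "x * (e * c) \<le> e * \<bar>c\<bar> * \<bar>x\<bar>"
    using e by (metis abs_ge_self abs_mult abs_of_pos mult.commute mult.left_commute)
  have 3: "2 * (e * (a + \<bar>c\<bar>)) * \<bar>x\<bar> \<le> \<eta> * x\<^sup>2 + (e * (a + \<bar>c\<bar>))\<^sup>2 / \<eta>"
  proof -
    have "0 \<le> (\<eta> * \<bar>x\<bar> - e * (a + \<bar>c\<bar>))\<^sup>2 / \<eta>" using \<eta> by simp
    also have "\<dots> = \<eta> * x\<^sup>2 - 2 * (e * (a + \<bar>c\<bar>)) * \<bar>x\<bar> + (e * (a + \<bar>c\<bar>))\<^sup>2 / \<eta>"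
    proof -
      have "(\<eta> * X - E)\<^sup>2 / \<eta> = \<eta> * X\<^sup>2 - 2 * E * X + E\<^sup>2 / \<eta>" for X E
        using \<eta> by (simp add: power2_eq_square field_simps)
      from this[of "\<bar>x\<bar>"] show ?thesis by simp
    qed
    finally show ?thesis by linarith
  qed
  have "a \<le> C\<alpha>\<^sup>2"
    unfolding a_def using abs_coord_le_norm[of "\<alpha> t" i] norm_\<alpha>_le[of t]
    by (metis abs_le_square_iff abs_of_nonneg norm_ge_zero order_trans)
  then have "a\<^sup>2 \<le> C\<alpha>\<^sup>2 * a" using a by (simp add: power2_eq_square mult_right_mono)
  moreover have "(a + \<bar>c\<bar>)\<^sup>2 \<le> 2 * a\<^sup>2 + 2 * c\<^sup>2"
    using zero_le_power2[of "a - \<bar>c\<bar>"] unfolding power2_diff power2_sum power2_abs by linarith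
  ultimately have "(a + \<bar>c\<bar>)\<^sup>2 \<le> 2 * C\<alpha>\<^sup>2 * a + 2 * c\<^sup>2" by linarith
  also have "\<dots> \<le> (2 * C\<alpha>\<^sup>2 + 2) * (a + c\<^sup>2)" using a by (simp add: algebra_simps)
  finally have "(a + \<bar>c\<bar>)\<^sup>2 / \<eta> \<le> (2 * C\<alpha>\<^sup>2 + 2) * (a + c\<^sup>2) / \<eta>" using \<eta> by (simp add: divide_right_mono)
  moreover have "c0 * (a + c\<^sup>2) = 2 * a + 2 * c\<^sup>2 + (2 * C\<alpha>\<^sup>2 + 2) * (a + c\<^sup>2) / \<eta>"
    unfolding c0_def \<eta>_def[symmetric] by (simp add: distrib_right)
  moreover have "0 \<le> c\<^sup>2" by simp
  ultimately have "2 * a + (a + \<bar>c\<bar>)\<^sup>2 / \<eta> \<le> c0 * (a + c\<^sup>2)" by linarith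
  then have 4: "e\<^sup>2 * (2 * a + (a + \<bar>c\<bar>)\<^sup>2 / \<eta>) \<le> e\<^sup>2 * (c0 * (a + c\<^sup>2))" by (rule mult_left_mono) simp
  have "2 * x * reaction f g z R i x t = 2 * z t * x\<^sup>2 - 2 * (x * (e * F)) + 2 * (x * (e * c))"
    using e by (simp add: reaction_def e_def[symmetric] c_def[symmetric] F_def power2_eq_square algebra_simps)
  also have "\<dots> \<le> 2 * z t * x\<^sup>2 + 2 * (e\<^sup>2 * a) + 2 * (e * (a + \<bar>c\<bar>)) * \<bar>x\<bar>"
    using 1 2 by (simp add: algebra_simps)
  also have "\<dots> \<le> 2 * z t * x\<^sup>2 + \<eta> * x\<^sup>2 + e\<^sup>2 * (2 * a + (a + \<bar>c\<bar>)\<^sup>2 / \<eta>)"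
  proof -
    have "(e * (a + \<bar>c\<bar>))\<^sup>2 / \<eta> = e\<^sup>2 * ((a + \<bar>c\<bar>)\<^sup>2 / \<eta>)" by (simp add: power_mult_distrib)
    then show ?thesis using 3 unfolding distrib_left[of "e\<^sup>2"] by linarith
  qed
  also have "\<dots> \<le> 2 * z t * x\<^sup>2 + \<eta> * x\<^sup>2 + e\<^sup>2 * (c0 * (a + c\<^sup>2))"
    using 4 by linarith
  finally show ?thesis unfolding e(3) by (simp add: \<eta>_def a_def c_def algebra_simps)
qed

end


section \<open>Removing the truncation\<close>

lemma integral_mult_const_le:
  fixes h :: "real \<Rightarrow> real"
  assumes "continuous_on {a..b} h" "\<And>s. s \<in> {a..b} \<Longrightarrow> h s \<le> C" "a \<le> b"
  shows "integral {a..b} h \<le> C * (b - a)"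
proof -
  have "integral {a..b} h \<le> integral {a..b} (\<lambda>_. C)"
    by (rule integral_le) (use assms in \<open>auto intro: integrable_continuous_real\<close>)
  then show ?thesis using assms(3) by (simp add: mult.commute)
qed

context lattice_system
begin

text \<open>The loss \<open>\<epsilon> = lam_lo / (2 * nu_hi)\<close> is the one for which
  \<open>nu_hi * \<epsilon> = lam_lo / 2\<close>.\<close>

definition qc :: real
  where "qc = (SOME q. 0 < q \<and> q < 1 \<and> q\<^sup>2 + 1 / q\<^sup>2 \<le> 2 + lam_lo / (2 * nu_hi))"

lemma qc: "0 < qc" "qc < 1" "qc\<^sup>2 + 1 / qc\<^sup>2 \<le> 2 + lam_lo / (2 * nu_hi)"
proof -
  have "0 < lam_lo / (2 * nu_hi)" using lam_lo nu_hi by simp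
  then have "\<exists>q. 0 < q \<and> q < 1 \<and> q\<^sup>2 + 1 / q\<^sup>2 \<le> 2 + lam_lo / (2 * nu_hi)"
    using spread_parameter by blast
  from someI_ex[OF this] show "0 < qc" "qc < 1" "qc\<^sup>2 + 1 / qc\<^sup>2 \<le> 2 + lam_lo / (2 * nu_hi)"
    unfolding qc_def by auto
qed

definition Cq :: real where "Cq = 2 / (1 - qc\<^sup>2)"

lemma Cq_pos: "0 < Cq"
  unfolding Cq_def using qc by (simp add: power_less_one_iff)

text \<open>Dominates \<open>c0\<close> times the squared data at each site, yet satisfies the
  neighbour condition that \<open>solves_on_sq_le\<close> demands of a source and has a bounded sum
  over the sites.\<close>

definition src :: "real \<Rightarrow> int \<Rightarrow> real"
  where "src s i = c0 * (spread qc (\<alpha> s) i + spread qc (g s) i)"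

lemma src_nonneg: "0 \<le> src s i"
  using c0_pos by (simp add: src_def spread_nonneg)

lemma continuous_src: "continuous_on S (\<lambda>s. src s i)"
  unfolding src_def by (intro continuous_intros continuous_on_spread continuous_g continuous_\<alpha>) (use qc in auto)

definition c1 :: real where "c1 = c0 * (Cq * (C\<alpha>\<^sup>2 + Cg\<^sup>2))"

lemma c1_nonneg: "0 \<le> c1"
  unfolding c1_def using c0_pos Cq_pos by simp

lemma sum_src_le:
  assumes "finite J"
  shows "(\<Sum>i\<in>J. src s i) \<le> c1"
proof -
  have "(\<Sum>i\<in>J. spread qc (\<alpha> s) i) \<le> Cq * (norm (\<alpha> s))\<^sup>2" "(\<Sum>i\<in>J. spread qc (g s) i) \<le> Cq * (norm (g s))\<^sup>2"
    unfolding Cq_def by (rule sum_spread_le[OF qc(1,2) assms])+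
  moreover have "Cq * (norm (\<alpha> s))\<^sup>2 \<le> Cq * C\<alpha>\<^sup>2" "Cq * (norm (g s))\<^sup>2 \<le> Cq * Cg\<^sup>2"
    using Cq_pos by (auto intro!: mult_left_mono power_mono norm_\<alpha>_le norm_g_le)
  ultimately have "(\<Sum>i\<in>J. spread qc (\<alpha> s) i) + (\<Sum>i\<in>J. spread qc (g s) i) \<le> Cq * (C\<alpha>\<^sup>2 + Cg\<^sup>2)"
    by (simp add: distrib_left)
  then show ?thesis
    unfolding src_def c1_def sum_distrib_left[symmetric] sum.distrib
    using c0_pos by (intro mult_left_mono) auto
qed

text \<open>What is left of \<open>2 * z r - 2 * lam_lo\<close> after \<open>lam_lo / 2\<close> has
  been spent on the reaction and forcing and another \<open>lam_lo / 2\<close> on the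
  coupling.\<close>

definition rate :: "(real \<Rightarrow> real) \<Rightarrow> real \<Rightarrow> real"
  where "rate z r = 2 * z r - lam_lo"

text \<open>The variation-of-constants kernel from \<open>s\<close> to \<open>t\<close>, including
  the factor \<open>exp (- 2 * z s)\<close> that the change of variables puts on the squared
  data.\<close>

definition kern :: "(real \<Rightarrow> real) \<Rightarrow> real \<Rightarrow> real \<Rightarrow> real"
  where "kern z t s = exp (integral {s..t} (rate z) - 2 * z s)"

lemma continuous_rate: "continuous_on S z \<Longrightarrow> continuous_on S (rate z)"
  unfolding rate_def by (intro continuous_intros)

lemma continuous_kern:
  assumes "continuous_on UNIV z"
  shows "continuous_on {\<tau>..t} (kern z t)"
proof -
  have z: "continuous_on S z" for S using assms continuous_on_subset by blast
  have "continuous_on {\<tau>..t} (\<lambda>s. integral {s..t} (rate z))"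
    by (intro indefinite_integral_continuous_1' integrable_continuous_real continuous_rate z)
  then show ?thesis unfolding kern_def by (intro continuous_intros z)
qed

lemma kern_nonneg: "0 \<le> kern z t s"
  by (simp add: kern_def)

definition site_bound :: "(real \<Rightarrow> real) \<Rightarrow> real \<Rightarrow> real \<Rightarrow> ell2 \<Rightarrow> int \<Rightarrow> real"
  where "site_bound z \<tau> t u i =
    exp (integral {\<tau>..t} (rate z)) * spread qc u i + integral {\<tau>..t} (\<lambda>s. kern z t s * src s i)"

text \<open>An instance of \<open>solves_on_sq_le\<close> with \<open>k = 2 * z + lam_lo / 2\<close>
  from \<open>reaction_dissipative\<close> and with the spread data. The bound does not contain
  \<open>R\<close>, which is what later removes the cut-off.\<close>

lemma truncated_site_bound:
  assumes z: "continuous_on UNIV z" and R: "1 \<le> R"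
    and sol: "solves_on \<nu> lam (reaction f g z R) \<tau> T u v" and t: "t \<in> {\<tau>..T}"
  shows "(coord (v t) i)\<^sup>2 \<le> site_bound z \<tau> t u i"
proof -
  interpret LF: lattice_field \<nu> lam "reaction f g z R" nu_hi lam_hi "\<lambda>t. exp (- z t) *\<^sub>R g t"
    using lattice_field_reaction[OF z, of R] R by simp
  have zc: "continuous_on S z" for S using z continuous_on_subset by blast
  define h where "h i t = exp (- 2 * z t) * src t i" for i t
  define \<epsilon> where "\<epsilon> = lam_lo / (2 * nu_hi)"
  have \<epsilon>: "0 \<le> \<epsilon>" "nu_hi * \<epsilon> = lam_lo / 2" using lam_lo nu_hi by (auto simp: \<epsilon>_def)
  note qc' = qc(3)[folded \<epsilon>_def]
  have "(coord (v t) i)\<^sup>2 \<le> exp (integral {\<tau>..t} (rate z)) *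
      (spread qc u i + integral {\<tau>..t} (\<lambda>s. exp (- integral {\<tau>..s} (rate z)) * h i s))"
  proof (rule LF.solves_on_sq_le[OF sol t, where k = "\<lambda>t. 2 * z t + lam_lo / 2" and \<epsilon> = \<epsilon>])
    show "lam_lo \<le> lam i t" for i t by (rule lam_bounds)
    show "2 * x * reaction f g z R i x t \<le> (2 * z t + lam_lo / 2) * x\<^sup>2 + h i t" for i x t
    proof -
      have "(coord (\<alpha> t) i)\<^sup>2 + (coord (g t) i)\<^sup>2 \<le> spread qc (\<alpha> t) i + spread qc (g t) i"
        using qc by (intro add_mono coord_sq_le_spread) auto
      then have "exp (- 2 * z t) * c0 * ((coord (\<alpha> t) i)\<^sup>2 + (coord (g t) i)\<^sup>2) \<le> h i t"
        unfolding h_def src_def mult.assoc[symmetric] using c0_pos by (intro mult_left_mono) auto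
      then show ?thesis using reaction_dissipative[OF R, of x z i t] by linarith
    qed
    show "continuous_on {\<tau>..T} (\<lambda>t. 2 * z t + lam_lo / 2)" by (intro continuous_intros zc)
    show "continuous_on {\<tau>..T} (rate z)" by (intro continuous_rate zc)
    show "continuous_on {\<tau>..T} (h i)" for i unfolding h_def by (intro continuous_intros zc continuous_src)
    show "0 \<le> h i t" for i t by (simp add: h_def src_nonneg)
    show "h (i - 1) t + h (i + 1) t \<le> (2 + \<epsilon>) * h i t" for i t
    proof -
      have "spread qc (\<alpha> t) (i - 1) + spread qc (\<alpha> t) (i + 1) \<le> (2 + \<epsilon>) * spread qc (\<alpha> t) i"
        "spread qc (g t) (i - 1) + spread qc (g t) (i + 1) \<le> (2 + \<epsilon>) * spread qc (g t) i"
        using qc by (intro spread_neighbours_le qc'; simp)+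
      then have "spread qc (\<alpha> t) (i - 1) + spread qc (g t) (i - 1) + (spread qc (\<alpha> t) (i + 1) + spread qc (g t) (i + 1))
        \<le> (2 + \<epsilon>) * (spread qc (\<alpha> t) i + spread qc (g t) i)" by (simp add: distrib_left)
      then have "(exp (- 2 * z t) * c0) * (spread qc (\<alpha> t) (i - 1) + spread qc (g t) (i - 1) + (spread qc (\<alpha> t) (i + 1) + spread qc (g t) (i + 1)))
        \<le> (exp (- 2 * z t) * c0) * ((2 + \<epsilon>) * (spread qc (\<alpha> t) i + spread qc (g t) i))"
        using c0_pos by (intro mult_left_mono) auto
      then show ?thesis unfolding h_def src_def by (simp only: distrib_left mult_ac)
    qed
    show "(coord u i)\<^sup>2 \<le> spread qc u i" for i using qc by (intro coord_sq_le_spread) auto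
    show "spread qc u (i - 1) + spread qc u (i + 1) \<le> (2 + \<epsilon>) * spread qc u i" for i
      using qc by (intro spread_neighbours_le qc') auto
    show "0 \<le> \<epsilon>" by (rule \<epsilon>)
    show "2 * z t + lam_lo / 2 - 2 * lam_lo + nu_hi * \<epsilon> \<le> rate z t" for t
      by (simp add: \<epsilon>(2) rate_def)
  qed
  also have "\<dots> = exp (integral {\<tau>..t} (rate z)) * spread qc u i
      + integral {\<tau>..t} (\<lambda>s. exp (integral {\<tau>..t} (rate z)) * (exp (- integral {\<tau>..s} (rate z)) * h i s))"
    by (simp add: distrib_left)
  \<comment> \<open>Combining the exponents leaves the integral of the rate from \<open>s\<close> to
    \<open>t\<close>; in the source term the initial time is then only a lower limit and may tend to
    \<open>- \<infinity>\<close>.\<close>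
  also have "integral {\<tau>..t} (\<lambda>s. exp (integral {\<tau>..t} (rate z)) * (exp (- integral {\<tau>..s} (rate z)) * h i s))
    = integral {\<tau>..t} (\<lambda>s. kern z t s * src s i)"
  proof (rule integral_cong)
    fix s assume s: "s \<in> {\<tau>..t}"
    have "integral {\<tau>..s} (rate z) + integral {s..t} (rate z) = integral {\<tau>..t} (rate z)"
      using s by (intro Henstock_Kurzweil_Integration.integral_combine integrable_continuous_real continuous_rate zc) auto
    then have "kern z t s = exp (integral {\<tau>..t} (rate z) + - integral {\<tau>..s} (rate z) + (- 2 * z s))"
      unfolding kern_def by (intro arg_cong[of _ _ exp]) linarith
    then have "kern z t s = exp (integral {\<tau>..t} (rate z)) * (exp (- integral {\<tau>..s} (rate z)) * exp (- 2 * z s))"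
      by (simp only: exp_add mult.assoc)
    then show "exp (integral {\<tau>..t} (rate z)) * (exp (- integral {\<tau>..s} (rate z)) * h i s) = kern z t s * src s i"
      by (simp add: h_def)
  qed
  finally show ?thesis by (simp add: site_bound_def)
qed

lemma sum_integral_src_le:
  assumes z: "continuous_on UNIV z" and J: "finite J"
  shows "(\<Sum>i\<in>J. integral {\<tau>..t} (\<lambda>s. kern z t s * src s i)) \<le> c1 * integral {\<tau>..t} (kern z t)"
proof -
  have int: "(\<lambda>s. kern z t s * src s i) integrable_on {\<tau>..t}" for i
    by (intro integrable_continuous_real continuous_intros continuous_kern z continuous_src)
  have "(\<Sum>i\<in>J. integral {\<tau>..t} (\<lambda>s. kern z t s * src s i)) = integral {\<tau>..t} (\<lambda>s. \<Sum>i\<in>J. kern z t s * src s i)"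
    by (rule integral_sum[OF J int, symmetric])
  also have "\<dots> \<le> integral {\<tau>..t} (\<lambda>s. c1 * kern z t s)"
  proof (rule integral_le)
    show "(\<lambda>s. \<Sum>i\<in>J. kern z t s * src s i) integrable_on {\<tau>..t}" by (rule integrable_sum[OF J int])
    show "(\<lambda>s. c1 * kern z t s) integrable_on {\<tau>..t}"
      by (intro integrable_continuous_real continuous_intros continuous_kern z)
    show "(\<Sum>i\<in>J. kern z t s * src s i) \<le> c1 * kern z t s" for s
      unfolding sum_distrib_left[symmetric]
      using mult_left_mono[OF sum_src_le[OF J] kern_nonneg] by (simp add: mult.commute)
  qed
  finally show ?thesis by simp
qed

lemma sum_site_bound_le:
  assumes z: "continuous_on UNIV z" and J: "finite J"
  shows "(\<Sum>i\<in>J. site_bound z \<tau> t u i)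
    \<le> exp (integral {\<tau>..t} (rate z)) * (Cq * (norm u)\<^sup>2) + c1 * integral {\<tau>..t} (kern z t)"
proof -
  have "exp (integral {\<tau>..t} (rate z)) * (\<Sum>i\<in>J. spread qc u i) \<le> exp (integral {\<tau>..t} (rate z)) * (Cq * (norm u)\<^sup>2)"
    unfolding Cq_def by (intro mult_left_mono sum_spread_le qc J) auto
  then show ?thesis
    using sum_integral_src_le[OF z J, of \<tau> t]
    unfolding site_bound_def sum.distrib sum_distrib_left[symmetric] by linarith
qed

text \<open>Uniformity in the level serves to remove the cut-off, uniformity over a ball of initial
  values to prove continuity in the initial value.\<close>

lemma apriori_bound:
  assumes z: "continuous_on UNIV z"
  obtains B where "0 \<le> B"
    "\<And>R u v t. 1 \<le> R \<Longrightarrow> norm u \<le> \<rho> \<Longrightarrow> solves_on \<nu> lam (reaction f g z R) \<tau> T u v \<Longrightarrow> t \<in> {\<tau>..T} \<Longrightarrow> norm (v t) \<le> B"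
proof -
  have zc: "continuous_on S z" for S using z continuous_on_subset by blast
  have "bounded (rate z ` {\<tau>..T})" "bounded (z ` {\<tau>..T})"
    by (intro compact_imp_bounded compact_continuous_image continuous_rate zc; simp)+
  then obtain Y Z where Y: "\<forall>t\<in>{\<tau>..T}. \<bar>rate z t\<bar> \<le> Y" and Z: "\<forall>t\<in>{\<tau>..T}. \<bar>z t\<bar> \<le> Z"
    unfolding bounded_iff by auto
  define D where "D = \<bar>Y\<bar> * (T - \<tau>)"
  define B where "B = sqrt (exp D * (Cq * \<rho>\<^sup>2) + c1 * (exp (D + 2 * \<bar>Z\<bar>) * (T - \<tau>)))"
  have I: "integral {s..t} (rate z) \<le> D" if "\<tau> \<le> s" "s \<le> t" "t \<le> T" for s t
  proof -
    have "integral {s..t} (rate z) \<le> \<bar>Y\<bar> * (t - s)"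
    proof (rule integral_mult_const_le[OF continuous_rate[OF zc]])
      show "rate z r \<le> \<bar>Y\<bar>" if "r \<in> {s..t}" for r
        using bspec[OF Y, of r] that \<open>\<tau> \<le> s\<close> \<open>t \<le> T\<close> by auto
    qed (rule that)
    also have "\<dots> \<le> D" unfolding D_def using that by (intro mult_left_mono) auto
    finally show ?thesis .
  qed
  have main: "norm (v t) \<le> B" if R: "1 \<le> R" and u: "norm u \<le> \<rho>"
    and s: "solves_on \<nu> lam (reaction f g z R) \<tau> T u v" and t: "t \<in> {\<tau>..T}" for R u v t
  proof -
    have 1: "exp (integral {\<tau>..t} (rate z)) * (Cq * (norm u)\<^sup>2) \<le> exp D * (Cq * \<rho>\<^sup>2)"
      using I[of \<tau> t] t u Cq_pos by (intro mult_mono mult_left_mono power_mono) auto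
    have "integral {\<tau>..t} (kern z t) \<le> exp (D + 2 * \<bar>Z\<bar>) * (t - \<tau>)"
    proof (rule integral_mult_const_le[OF continuous_kern[OF z]])
      fix s assume s: "s \<in> {\<tau>..t}"
      then have "\<bar>z s\<bar> \<le> Z" using Z t by auto
      then show "kern z t s \<le> exp (D + 2 * \<bar>Z\<bar>)" using I[of s t] s t by (simp add: kern_def)
    qed (use t in auto)
    also have "\<dots> \<le> exp (D + 2 * \<bar>Z\<bar>) * (T - \<tau>)" using t by (intro mult_left_mono) auto
    finally have 2: "c1 * integral {\<tau>..t} (kern z t) \<le> c1 * (exp (D + 2 * \<bar>Z\<bar>) * (T - \<tau>))"
      by (rule mult_left_mono[OF _ c1_nonneg])
    have B: "0 \<le> exp D * (Cq * \<rho>\<^sup>2) + c1 * (exp (D + 2 * \<bar>Z\<bar>) * (T - \<tau>))"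
      using Cq_pos c1_nonneg t by (intro add_nonneg_nonneg mult_nonneg_nonneg) auto
    show "norm (v t) \<le> B"
    proof (rule ell2_normI)
      show "0 \<le> B" using B by (simp add: B_def)
      fix J :: "int set" assume J: "finite J"
      have "(\<Sum>i\<in>J. (coord (v t) i)\<^sup>2) \<le> (\<Sum>i\<in>J. site_bound z \<tau> t u i)"
        by (rule sum_mono) (rule truncated_site_bound[OF z R s t])
      also have "\<dots> \<le> exp D * (Cq * \<rho>\<^sup>2) + c1 * (exp (D + 2 * \<bar>Z\<bar>) * (T - \<tau>))"
        using sum_site_bound_le[OF z J, of \<tau> t u] 1 2 by linarith
      also have "\<dots> = B\<^sup>2" using B by (simp add: B_def)
      finally show "(\<Sum>i\<in>J. (coord (v t) i)\<^sup>2) \<le> B\<^sup>2" .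
    qed
  qed
  show ?thesis
  proof (rule that[of "max 0 B"])
    show "norm (v t) \<le> max 0 B" if "1 \<le> R" "norm u \<le> \<rho>"
      "solves_on \<nu> lam (reaction f g z R) \<tau> T u v" "t \<in> {\<tau>..T}" for R u v t
      using main[OF that] by simp
  qed simp
qed

lemma lattice_rhs_eq_lrhs:
  assumes "\<bar>exp (ou (\<theta> t \<omega>)) * coord v i\<bar> \<le> R"
  shows "lattice_rhs \<nu> lam f g \<omega> t v i = lrhs \<nu> lam (reaction f g (\<lambda>t. ou (\<theta> t \<omega>)) R) t v i"
  using assms by (simp add: lattice_rhs_def lrhs_def reaction_def clip_eq)

lemma lrhs_reaction_cong:
  assumes "\<bar>exp (z t) * coord v i\<bar> \<le> R" "\<bar>exp (z t) * coord v i\<bar> \<le> R'"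
  shows "lrhs \<nu> lam (reaction f g z R) t v i = lrhs \<nu> lam (reaction f g z R') t v i"
  using assms by (simp add: lrhs_def reaction_def clip_eq)

lemma solves_on_reaction_cong:
  assumes "solves_on \<nu> lam (reaction f g z R) \<tau> T u v"
    and "\<And>t i. t \<in> {\<tau>..T} \<Longrightarrow> \<bar>exp (z t) * coord (v t) i\<bar> \<le> min R R'"
  shows "solves_on \<nu> lam (reaction f g z R') \<tau> T u v"
proof -
  have "integral {\<tau>..t} (\<lambda>s. lrhs \<nu> lam (reaction f g z R) s (v s) i) = integral {\<tau>..t} (\<lambda>s. lrhs \<nu> lam (reaction f g z R') s (v s) i)"
    if "t \<in> {\<tau>..T}" for t i
    by (rule integral_cong, rule lrhs_reaction_cong) (use assms(2)[of _ i] that in force)+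
  then show ?thesis using assms(1) by (simp add: solves_on_def)
qed

text \<open>Written as a limit of Picard iterates with the path as an argument, so that
  measurability in the path can be read off.\<close>

definition trunc_sol :: "(real \<Rightarrow> real) \<Rightarrow> real \<Rightarrow> real \<Rightarrow> ell2 \<Rightarrow> real \<Rightarrow> ell2"
  where "trunc_sol z R \<tau> u t = lim (\<lambda>n. picard \<nu> lam (reaction f g z R) \<tau> u n t)"

text \<open>For continuous \<open>z\<close> and \<open>t \<ge> \<tau>\<close> the sequence is
  eventually constant, see \<open>truncation_inactive\<close>; the limit over integer levels avoids
  choosing a level that depends on the path.\<close>

definition glob_sol :: "(real \<Rightarrow> real) \<Rightarrow> real \<Rightarrow> ell2 \<Rightarrow> real \<Rightarrow> ell2"
  where "glob_sol z \<tau> u t = lim (\<lambda>n. trunc_sol z (real n) \<tau> u t)"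

lemma trunc_sol:
  assumes "continuous_on UNIV z" "0 \<le> R"
  shows "solves_on \<nu> lam (reaction f g z R) \<tau> T u (trunc_sol z R \<tau> u)"
    and "\<tau> \<le> t \<Longrightarrow> (\<lambda>n. picard \<nu> lam (reaction f g z R) \<tau> u n t) \<longlonglongrightarrow> trunc_sol z R \<tau> u t"
proof -
  interpret LF: lattice_field \<nu> lam "reaction f g z R" nu_hi lam_hi "\<lambda>t. exp (- z t) *\<^sub>R g t"
    by (rule lattice_field_reaction[OF assms])
  have "trunc_sol z R \<tau> u = LF.sol \<tau> u" by (simp add: trunc_sol_def LF.sol_def fun_eq_iff)
  then show "solves_on \<nu> lam (reaction f g z R) \<tau> T u (trunc_sol z R \<tau> u)"
    "\<tau> \<le> t \<Longrightarrow> (\<lambda>n. picard \<nu> lam (reaction f g z R) \<tau> u n t) \<longlonglongrightarrow> trunc_sol z R \<tau> u t"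
    using LF.solves_on_sol LF.picard_tendsto_sol by auto
qed

lemma trunc_sol_unique:
  assumes "continuous_on UNIV z" "0 \<le> R" "solves_on \<nu> lam (reaction f g z R) \<tau> T u v" "t \<in> {\<tau>..T}"
  shows "v t = trunc_sol z R \<tau> u t"
proof -
  interpret LF: lattice_field \<nu> lam "reaction f g z R" nu_hi lam_hi "\<lambda>t. exp (- z t) *\<^sub>R g t"
    by (rule lattice_field_reaction[OF assms(1,2)])
  show ?thesis by (rule LF.solves_on_unique[OF assms(3) trunc_sol(1)[OF assms(1,2)] assms(4)])
qed

text \<open>By the a priori bound every truncated solution stays below one level \<open>R0\<close>.
  A solution at level \<open>R \<ge> R0\<close> therefore also solves the system at level
  \<open>R0\<close>, and uniqueness identifies the two.\<close>

lemma truncation_inactive: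
  assumes z: "continuous_on UNIV z"
  obtains R0 where "1 \<le> R0"
    "\<And>R u t. R0 \<le> R \<Longrightarrow> norm u \<le> \<rho> \<Longrightarrow> t \<in> {\<tau>..T} \<Longrightarrow> trunc_sol z R \<tau> u t = glob_sol z \<tau> u t"
    "\<And>u t i. norm u \<le> \<rho> \<Longrightarrow> t \<in> {\<tau>..T} \<Longrightarrow> \<bar>exp (z t) * coord (glob_sol z \<tau> u t) i\<bar> \<le> R0"
    "\<And>u t. norm u \<le> \<rho> \<Longrightarrow> t \<in> {\<tau>..T} \<Longrightarrow> (\<lambda>n. trunc_sol z (real n) \<tau> u t) \<longlonglongrightarrow> glob_sol z \<tau> u t"
proof -
  obtain B where B: "0 \<le> B"
    "\<And>R u v t. 1 \<le> R \<Longrightarrow> norm u \<le> \<rho> \<Longrightarrow> solves_on \<nu> lam (reaction f g z R) \<tau> T u v \<Longrightarrow> t \<in> {\<tau>..T} \<Longrightarrow> norm (v t) \<le> B"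
    by (rule apriori_bound[OF z, of \<rho> \<tau> T]) (rule that)
  have "bounded ((\<lambda>t. exp (z t)) ` {\<tau>..T})"
    by (intro compact_imp_bounded compact_continuous_image continuous_intros continuous_on_subset[OF z]) auto
  then obtain E where E: "\<forall>t\<in>{\<tau>..T}. exp (z t) \<le> E" unfolding bounded_iff by auto
  define R0 where "R0 = max 1 (\<bar>E\<bar> * B)"
  have R0: "1 \<le> R0" by (simp add: R0_def)
  have bd: "\<bar>exp (z t) * coord (trunc_sol z R \<tau> u t) i\<bar> \<le> R0"
    if "1 \<le> R" "norm u \<le> \<rho>" "t \<in> {\<tau>..T}" for R u t i
  proof -
    have "norm (trunc_sol z R \<tau> u t) \<le> B"
      using B(2)[OF that(1,2) trunc_sol(1)[OF z] that(3)] that by simp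
    then have "\<bar>coord (trunc_sol z R \<tau> u t) i\<bar> \<le> B" using abs_coord_le_norm order_trans by blast
    moreover have "exp (z t) \<le> \<bar>E\<bar>" using E that(3) by force
    ultimately have "exp (z t) * \<bar>coord (trunc_sol z R \<tau> u t) i\<bar> \<le> \<bar>E\<bar> * B" by (intro mult_mono) auto
    then show ?thesis by (simp add: R0_def abs_mult)
  qed
  have eq: "trunc_sol z R \<tau> u t = trunc_sol z R0 \<tau> u t"
    if R: "R0 \<le> R" and u: "norm u \<le> \<rho>" and t: "t \<in> {\<tau>..T}" for R u t
  proof (rule trunc_sol_unique[OF z _ _ t])
    have "solves_on \<nu> lam (reaction f g z R) \<tau> T u (trunc_sol z R \<tau> u)"
      by (rule trunc_sol(1)[OF z]) (use R R0 in simp)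
    then show "solves_on \<nu> lam (reaction f g z R0) \<tau> T u (trunc_sol z R \<tau> u)"
      by (rule solves_on_reaction_cong) (use bd[of R u] R R0 u in auto)
  qed (use R0 in simp)
  have lim: "(\<lambda>n. trunc_sol z (real n) \<tau> u t) \<longlonglongrightarrow> trunc_sol z R0 \<tau> u t"
    if "norm u \<le> \<rho>" "t \<in> {\<tau>..T}" for u t
  proof (rule tendsto_eventually)
    show "\<forall>\<^sub>F n in sequentially. trunc_sol z (real n) \<tau> u t = trunc_sol z R0 \<tau> u t"
    proof (rule eventually_sequentiallyI[of "nat \<lceil>R0\<rceil>"], rule eq[OF _ that])
      show "R0 \<le> real n" if "nat \<lceil>R0\<rceil> \<le> n" for n using that by linarith
    qed
  qed
  have glob: "glob_sol z \<tau> u t = trunc_sol z R0 \<tau> u t" if "norm u \<le> \<rho>" "t \<in> {\<tau>..T}" for u t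
    unfolding glob_sol_def using lim[OF that] by (rule limI)
  show ?thesis
  proof (rule that[OF R0])
    show "trunc_sol z R \<tau> u t = glob_sol z \<tau> u t" if "R0 \<le> R" "norm u \<le> \<rho>" "t \<in> {\<tau>..T}" for R u t
      by (rule trans[OF eq[OF that] glob[OF that(2,3), symmetric]])
    show "\<bar>exp (z t) * coord (glob_sol z \<tau> u t) i\<bar> \<le> R0" if "norm u \<le> \<rho>" "t \<in> {\<tau>..T}" for u t i
      unfolding glob[OF that] by (rule bd[OF R0 that])
    show "(\<lambda>n. trunc_sol z (real n) \<tau> u t) \<longlonglongrightarrow> glob_sol z \<tau> u t" if "norm u \<le> \<rho>" "t \<in> {\<tau>..T}" for u t
      unfolding glob[OF that] by (rule lim[OF that])
  qed
qed

end


section \<open>Mild solutions\<close>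

lemma solves_on_cong:
  assumes "solves_on \<nu> lam N \<tau> T u v" "\<And>t. t \<in> {\<tau>..T} \<Longrightarrow> w t = v t"
  shows "solves_on \<nu> lam N \<tau> T u w"
proof -
  have "continuous_on {\<tau>..T} w"
    using assms by (subst continuous_on_cong[OF refl assms(2)]) (auto simp: solves_on_def)
  moreover have "integral {\<tau>..t} (\<lambda>s. lrhs \<nu> lam N s (w s) i) = integral {\<tau>..t} (\<lambda>s. lrhs \<nu> lam N s (v s) i)"
    if "t \<in> {\<tau>..T}" for t i
    using that assms(2) by (intro integral_cong) auto
  ultimately show ?thesis using assms by (simp add: solves_on_def)
qed

lemma continuous_on_atLeastI:
  fixes v :: "real \<Rightarrow> 'a::topological_space"
  assumes "\<And>T. continuous_on {\<tau>..T} v"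
  shows "continuous_on {\<tau>..} v"
  unfolding continuous_on_eq_continuous_within
proof
  fix x assume x: "x \<in> {\<tau>..}"
  have "at x within {\<tau>..} = at x within {\<tau>..x + 1}"
    by (rule at_within_nhd[of x "{..<x + 1}"]) auto
  moreover have "continuous (at x within {\<tau>..x + 1}) v"
    using assms[of "x + 1"] x by (simp add: continuous_on_eq_continuous_within)
  ultimately show "continuous (at x within {\<tau>..}) v" by simp
qed

context lattice_system
begin

lemma glob_sol_solves:
  assumes z: "continuous_on UNIV z"
  obtains R0 where "1 \<le> R0" "\<And>R. R0 \<le> R \<Longrightarrow> solves_on \<nu> lam (reaction f g z R) \<tau> T u (glob_sol z \<tau> u)"
    "\<And>t i. t \<in> {\<tau>..T} \<Longrightarrow> \<bar>exp (z t) * coord (glob_sol z \<tau> u t) i\<bar> \<le> R0"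
proof (rule truncation_inactive[OF z, of "norm u" \<tau> T])
  fix R0 assume R0: "1 \<le> R0"
    and eq: "\<And>R u' t. R0 \<le> R \<Longrightarrow> norm u' \<le> norm u \<Longrightarrow> t \<in> {\<tau>..T} \<Longrightarrow> trunc_sol z R \<tau> u' t = glob_sol z \<tau> u' t"
    and bd: "\<And>u' t i. norm u' \<le> norm u \<Longrightarrow> t \<in> {\<tau>..T} \<Longrightarrow> \<bar>exp (z t) * coord (glob_sol z \<tau> u' t) i\<bar> \<le> R0"
  show thesis
  proof (rule that[OF R0])
    show "solves_on \<nu> lam (reaction f g z R) \<tau> T u (glob_sol z \<tau> u)" if R: "R0 \<le> R" for R
    proof (rule solves_on_cong)
      show "solves_on \<nu> lam (reaction f g z R) \<tau> T u (trunc_sol z R \<tau> u)"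
        by (rule trunc_sol(1)[OF z]) (use R R0 in simp)
      show "glob_sol z \<tau> u t = trunc_sol z R \<tau> u t" if "t \<in> {\<tau>..T}" for t
        by (rule eq[OF R order_refl that, symmetric])
    qed
    show "\<bar>exp (z t) * coord (glob_sol z \<tau> u t) i\<bar> \<le> R0" if "t \<in> {\<tau>..T}" for t i
      by (rule bd[OF order_refl that])
  qed
qed

lemma glob_sol_unique:
  assumes z: "continuous_on UNIV z"
    and w: "\<And>R. R1 \<le> R \<Longrightarrow> solves_on \<nu> lam (reaction f g z R) \<tau> T u w" and t: "t \<in> {\<tau>..T}"
  shows "w t = glob_sol z \<tau> u t"
proof (rule glob_sol_solves[OF z, of \<tau> T u])
  fix R0 assume R0: "1 \<le> R0" and s: "\<And>R. R0 \<le> R \<Longrightarrow> solves_on \<nu> lam (reaction f g z R) \<tau> T u (glob_sol z \<tau> u)"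
  define R where "R = max R0 R1"
  have R: "0 \<le> R" "R0 \<le> R" "R1 \<le> R" using R0 by (auto simp: R_def)
  show "w t = glob_sol z \<tau> u t"
    using trunc_sol_unique[OF z R(1) w[OF R(3)] t] trunc_sol_unique[OF z R(1) s[OF R(2)] t] by simp
qed

lemma glob_sol_initial:
  assumes "continuous_on UNIV z"
  shows "glob_sol z \<tau> u \<tau> = u"
proof (rule glob_sol_solves[OF assms, of \<tau> \<tau> u])
  fix R0 assume "\<And>R. R0 \<le> R \<Longrightarrow> solves_on \<nu> lam (reaction f g z R) \<tau> \<tau> u (glob_sol z \<tau> u)"
  from this[of R0] show "glob_sol z \<tau> u \<tau> = u" by (auto simp: solves_on_def intro!: ell2_ext)
qed

lemma glob_sol_continuous:
  assumes z: "continuous_on UNIV z"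
  shows "continuous_on {\<tau>..} (glob_sol z \<tau> u)"
proof (rule continuous_on_atLeastI)
  fix T show "continuous_on {\<tau>..T} (glob_sol z \<tau> u)"
  proof (rule glob_sol_solves[OF z, of \<tau> T u])
    fix R0 assume "\<And>R. R0 \<le> R \<Longrightarrow> solves_on \<nu> lam (reaction f g z R) \<tau> T u (glob_sol z \<tau> u)"
    from this[of R0] show ?thesis by (simp add: solves_on_def)
  qed
qed

lemma glob_sol_flow:
  assumes z: "continuous_on UNIV z" and st: "\<tau> \<le> s" "s \<le> t"
  shows "glob_sol z s (glob_sol z \<tau> u s) t = glob_sol z \<tau> u t"
proof (rule glob_sol_solves[OF z, of \<tau> t u])
  let ?v = "glob_sol z \<tau> u"
  fix R0 assume R0: "1 \<le> R0" and s: "\<And>R. R0 \<le> R \<Longrightarrow> solves_on \<nu> lam (reaction f g z R) \<tau> t u ?v"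
  have "?v t = glob_sol z s (?v s) t"
  proof (rule glob_sol_unique[OF z])
    fix R assume R: "R0 \<le> R"
    interpret LF: lattice_field \<nu> lam "reaction f g z R" nu_hi lam_hi "\<lambda>t. exp (- z t) *\<^sub>R g t"
      by (rule lattice_field_reaction[OF z]) (use R R0 in simp)
    note sR = s[OF R, unfolded solves_on_def]
    have cv: "continuous_on {\<tau>..t} ?v" using sR by blast
    show "solves_on \<nu> lam (reaction f g z R) s t (?v s) ?v"
      unfolding solves_on_def
    proof (intro conjI ballI allI)
      show "continuous_on {s..t} ?v" by (rule continuous_on_subset[OF cv]) (use st in auto)
      fix r i assume r: "r \<in> {s..t}"
      have "integral {\<tau>..s} (\<lambda>s. lrhs \<nu> lam (reaction f g z R) s (?v s) i)
          + integral {s..r} (\<lambda>s. lrhs \<nu> lam (reaction f g z R) s (?v s) i)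
        = integral {\<tau>..r} (\<lambda>s. lrhs \<nu> lam (reaction f g z R) s (?v s) i)"
        using r st by (intro Henstock_Kurzweil_Integration.integral_combine LF.lrhs_integrable_on continuous_on_subset[OF cv]) auto
      then show "coord (?v r) i = coord (?v s) i + integral {s..r} (\<lambda>s. lrhs \<nu> lam (reaction f g z R) s (?v s) i)"
        using sR r st by auto
    qed
  qed (use st in auto)
  then show ?thesis by simp
qed

lemma glob_sol_site_bound:
  assumes z: "continuous_on UNIV z" and t: "\<tau> \<le> t"
  shows "(coord (glob_sol z \<tau> u t) i)\<^sup>2 \<le> site_bound z \<tau> t u i"
proof (rule glob_sol_solves[OF z, of \<tau> t u])
  fix R0 assume R0: "1 \<le> R0" and s: "\<And>R. R0 \<le> R \<Longrightarrow> solves_on \<nu> lam (reaction f g z R) \<tau> t u (glob_sol z \<tau> u)"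
  show ?thesis by (rule truncated_site_bound[OF z R0 s[OF order_refl]]) (use t in simp)
qed

text \<open>On the unit ball around \<open>u0\<close> a single level serves all initial values, so
  the Lipschitz dependence of one truncated system carries over.\<close>

lemma continuous_glob_sol_initial:
  assumes z: "continuous_on UNIV z" and t: "\<tau> \<le> t"
  shows "continuous_on UNIV (\<lambda>u. glob_sol z \<tau> u t)"
  unfolding continuous_on_eq_continuous_at[OF open_UNIV]
proof
  fix u0 :: ell2
  show "isCont (\<lambda>u. glob_sol z \<tau> u t) u0"
  proof (rule truncation_inactive[OF z, of "norm u0 + 1" \<tau> t])
    fix R0 assume R0: "1 \<le> R0"
      and eq: "\<And>R u' t'. R0 \<le> R \<Longrightarrow> norm u' \<le> norm u0 + 1 \<Longrightarrow> t' \<in> {\<tau>..t} \<Longrightarrow> trunc_sol z R \<tau> u' t' = glob_sol z \<tau> u' t'"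
    have R0': "0 \<le> R0" using R0 by simp
    interpret LF: lattice_field \<nu> lam "reaction f g z R0" nu_hi lam_hi "\<lambda>t. exp (- z t) *\<^sub>R g t"
      by (rule lattice_field_reaction[OF z R0'])
    have tt: "t \<in> {\<tau>..t}" using t by simp
    show "isCont (\<lambda>u. glob_sol z \<tau> u t) u0"
    proof (rule LF.solves_on_dependence[of \<tau> t])
      fix L assume L: "0 \<le> L" "\<And>u u' v v' r. solves_on \<nu> lam (reaction f g z R0) \<tau> t u v \<Longrightarrow>
        solves_on \<nu> lam (reaction f g z R0) \<tau> t u' v' \<Longrightarrow> r \<in> {\<tau>..t} \<Longrightarrow> norm (v r - v' r) \<le> L * norm (u - u')"
      have le: "norm (trunc_sol z R0 \<tau> u t - trunc_sol z R0 \<tau> u0 t) \<le> L * norm (u - u0)" for u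
        by (rule L(2)[OF trunc_sol(1)[OF z R0'] trunc_sol(1)[OF z R0'] tt])
      have "((\<lambda>u. trunc_sol z R0 \<tau> u t - trunc_sol z R0 \<tau> u0 t) \<longlongrightarrow> 0) (at u0)"
      proof (rule Lim_null_comparison[OF always_eventually[OF allI[OF le]]])
        show "((\<lambda>u. L * norm (u - u0)) \<longlongrightarrow> 0) (at u0)" by (auto intro!: tendsto_eq_intros)
      qed
      then have "isCont (\<lambda>u. trunc_sol z R0 \<tau> u t) u0" by (simp add: isCont_def LIM_zero_iff)
      moreover have "\<forall>\<^sub>F u in nhds u0. trunc_sol z R0 \<tau> u t = glob_sol z \<tau> u t"
      proof (rule eventually_nhds_metric[THEN iffD2], intro exI[of _ 1] conjI allI impI)
        fix u assume "dist u u0 < 1"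
        then have "norm u \<le> norm u0 + 1" using norm_triangle_ineq2[of u u0] by (simp add: dist_norm)
        then show "trunc_sol z R0 \<tau> u t = glob_sol z \<tau> u t" by (rule eq[OF order_refl _ tt])
      qed simp
      ultimately show ?thesis by (simp cong: isCont_cong)
    qed
  qed
qed

text \<open>A mild solution is bounded on \<open>{\<tau>..T}\<close> by continuity in the norm, so a
  large enough cut-off leaves its equation unchanged; uniqueness of mild solutions is thereby
  reduced to the truncated systems.\<close>

lemma mild_solution_solves_on:
  fixes \<omega> :: "real \<Rightarrow> real"
  defines "z \<equiv> \<lambda>t. ou (\<theta> t \<omega>)"
  assumes z: "continuous_on UNIV z" and w: "mild_solution \<nu> lam f g \<tau> \<omega> u w"
  obtains R1 where "\<And>R. R1 \<le> R \<Longrightarrow> solves_on \<nu> lam (reaction f g z R) \<tau> T u w"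
proof -
  have "continuous_on {\<tau>..} w" using w unfolding mild_solution_def by (rule conjunct1)
  then have cw: "continuous_on {\<tau>..T} w" by (rule continuous_on_subset) auto
  have "bounded ((\<lambda>t. exp (z t) * norm (w t)) ` {\<tau>..T})"
    by (intro compact_imp_bounded compact_continuous_image continuous_intros cw continuous_on_subset[OF z]) auto
  then obtain R1 where R1: "\<forall>t\<in>{\<tau>..T}. exp (z t) * norm (w t) \<le> R1" unfolding bounded_iff by auto
  have "solves_on \<nu> lam (reaction f g z R) \<tau> T u w" if R: "R1 \<le> R" for R
    unfolding solves_on_def
  proof (intro conjI ballI allI cw)
    fix t i assume t: "t \<in> {\<tau>..T}"
    have "lattice_rhs \<nu> lam f g \<omega> s (w s) i = lrhs \<nu> lam (reaction f g z R) s (w s) i" if s: "s \<in> {\<tau>..t}" for s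
      unfolding z_def
    proof (rule lattice_rhs_eq_lrhs)
      have "exp (z s) * \<bar>coord (w s) i\<bar> \<le> exp (z s) * norm (w s)" by (intro mult_left_mono abs_coord_le_norm) simp
      also have "\<dots> \<le> R" using R1 R s t by force
      finally show "\<bar>exp (ou (\<theta> s \<omega>)) * coord (w s) i\<bar> \<le> R" by (simp add: abs_mult z_def)
    qed
    then have "integral {\<tau>..t} (\<lambda>s. lattice_rhs \<nu> lam f g \<omega> s (w s) i) = integral {\<tau>..t} (\<lambda>s. lrhs \<nu> lam (reaction f g z R) s (w s) i)"
      by (rule integral_cong)
    then show "coord (w t) i = coord u i + integral {\<tau>..t} (\<lambda>s. lrhs \<nu> lam (reaction f g z R) s (w s) i)"
      using w t unfolding mild_solution_def by auto
  qed
  then show ?thesis by (rule that)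
qed

lemma mild_solution_glob_sol:
  fixes \<omega> :: "real \<Rightarrow> real"
  defines "z \<equiv> \<lambda>t. ou (\<theta> t \<omega>)"
  assumes z: "continuous_on UNIV z"
  shows "mild_solution \<nu> lam f g \<tau> \<omega> u (glob_sol z \<tau> u)"
  unfolding mild_solution_def
proof (intro conjI allI impI)
  let ?v = "glob_sol z \<tau> u"
  show "continuous_on {\<tau>..} ?v" by (rule glob_sol_continuous[OF z])
  show "?v \<tau> = u" by (rule glob_sol_initial[OF z])
  fix i t assume t: "\<tau> \<le> t"
  have "(\<lambda>s. lattice_rhs \<nu> lam f g \<omega> s (?v s) i) absolutely_integrable_on {\<tau>..t} \<and>
    coord (?v t) i = coord u i + integral {\<tau>..t} (\<lambda>s. lattice_rhs \<nu> lam f g \<omega> s (?v s) i)"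
  proof (rule glob_sol_solves[OF z, of \<tau> t u])
    fix R0 assume R0: "1 \<le> R0" and s: "\<And>R. R0 \<le> R \<Longrightarrow> solves_on \<nu> lam (reaction f g z R) \<tau> t u ?v"
      and bd: "\<And>r i. r \<in> {\<tau>..t} \<Longrightarrow> \<bar>exp (z r) * coord (?v r) i\<bar> \<le> R0"
    interpret LF: lattice_field \<nu> lam "reaction f g z R0" nu_hi lam_hi "\<lambda>t. exp (- z t) *\<^sub>R g t"
      by (rule lattice_field_reaction[OF z]) (use R0 in simp)
    have eq: "lattice_rhs \<nu> lam f g \<omega> s (?v s) i = lrhs \<nu> lam (reaction f g z R0) s (?v s) i" if "s \<in> {\<tau>..t}" for s
      using lattice_rhs_eq_lrhs[of s \<omega> "?v s" i R0] bd[OF that, of i] by (simp add: z_def)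
    note s0 = s[OF order_refl, unfolded solves_on_def]
    have "(\<lambda>s. lrhs \<nu> lam (reaction f g z R0) s (?v s) i) absolutely_integrable_on {\<tau>..t}"
      using s0 by (intro LF.lrhs_integrable) blast
    then have "(\<lambda>s. lattice_rhs \<nu> lam f g \<omega> s (?v s) i) absolutely_integrable_on {\<tau>..t}"
      by (rule absolutely_integrable_spike[where S="{}"]) (auto simp: eq)
    moreover have "integral {\<tau>..t} (\<lambda>s. lattice_rhs \<nu> lam f g \<omega> s (?v s) i) = integral {\<tau>..t} (\<lambda>s. lrhs \<nu> lam (reaction f g z R0) s (?v s) i)"
      by (rule integral_cong) (rule eq)
    ultimately show ?thesis using s0 t by auto
  qed
  then show "(\<lambda>s. lattice_rhs \<nu> lam f g \<omega> s (?v s) i) absolutely_integrable_on {\<tau>..t}"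
    "coord (?v t) i = coord u i + integral {\<tau>..t} (\<lambda>s. lattice_rhs \<nu> lam f g \<omega> s (?v s) i)" by auto
qed

text \<open>All mild solutions take the same value at \<open>t\<close>, which gives the description
  operator a value.\<close>

lemma solution_eq_glob_sol:
  fixes \<omega> :: "real \<Rightarrow> real"
  defines "z \<equiv> \<lambda>t. ou (\<theta> t \<omega>)"
  assumes z: "continuous_on UNIV z" and t: "\<tau> \<le> t"
  shows "solution \<nu> lam f g t \<tau> \<omega> u = glob_sol z \<tau> u t"
  unfolding solution_def
proof (rule the_equality)
  show "\<exists>v. mild_solution \<nu> lam f g \<tau> \<omega> u v \<and> glob_sol z \<tau> u t = v t"
    using mild_solution_glob_sol[of \<omega> \<tau> u] z unfolding z_def by blast
  fix y assume "\<exists>v. mild_solution \<nu> lam f g \<tau> \<omega> u v \<and> y = v t"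
  then obtain v where v: "mild_solution \<nu> lam f g \<tau> \<omega> u v" "y = v t" by blast
  have "v t = glob_sol z \<tau> u t"
  proof (rule mild_solution_solves_on[OF z[unfolded z_def] v(1), of t])
    fix R1 assume "\<And>R. R1 \<le> R \<Longrightarrow> solves_on \<nu> lam (reaction f g (\<lambda>t. ou (\<theta> t \<omega>)) R) \<tau> t u v"
    from glob_sol_unique[OF z[unfolded z_def] this] t show ?thesis by (simp add: z_def)
  qed
  then show "y = glob_sol z \<tau> u t" using v by simp
qed

section \<open>Measurability of the solution in the path\<close>

lemma measurable_reaction:
  assumes "(\<lambda>\<omega>. z \<omega> t) \<in> borel_measurable M" "X \<in> borel_measurable M"
  shows "(\<lambda>\<omega>. reaction f g (z \<omega>) R i (X \<omega>) t) \<in> borel_measurable M"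
proof -
  have "(\<lambda>x. f i x t) \<in> borel_measurable borel"
    by (intro borel_measurable_continuous_onI continuous_f continuous_intros)
  moreover have "(\<lambda>\<omega>. clip R (exp (z \<omega> t) * X \<omega>)) \<in> borel_measurable M"
    using assms unfolding clip_def by measurable
  ultimately have "(\<lambda>\<omega>. f i (clip R (exp (z \<omega> t) * X \<omega>)) t) \<in> borel_measurable M"
    by (rule measurable_compose[rotated])
  then show ?thesis using assms unfolding reaction_def by measurable
qed

text \<open>Induction for all coordinates and times at once: one step splits into three integrals of
  a deterministic coefficient times a factor continuous in time and measurable in
  \<open>\<omega>\<close>.\<close>

lemma measurable_picard:
  assumes z: "\<And>\<omega>. \<omega> \<in> space M \<Longrightarrow> continuous_on UNIV (z \<omega>)" and zm: "\<And>s. (\<lambda>\<omega>. z \<omega> s) \<in> borel_measurable M"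
    and R: "0 \<le> R" and t: "\<tau> \<le> t"
  shows "(\<lambda>\<omega>. coord (picard \<nu> lam (reaction f g (z \<omega>) R) \<tau> u n t) i) \<in> borel_measurable M"
  using t
proof (induction n arbitrary: t i)
  case (Suc n)
  let ?N = "\<lambda>\<omega>. reaction f g (z \<omega>) R"
  let ?p = "\<lambda>\<omega>. picard \<nu> lam (?N \<omega>) \<tau> u n"
  note IH = Suc.IH
  have cp: "continuous_on {\<tau>..t} (?p \<omega>)" if "\<omega> \<in> space M" for \<omega>
  proof -
    interpret LF: lattice_field \<nu> lam "?N \<omega>" nu_hi lam_hi "\<lambda>t. exp (- z \<omega> t) *\<^sub>R g t"
      by (rule lattice_field_reaction[OF z[OF that] R])
    show ?thesis by (rule LF.continuous_picard)
  qed
  have cN: "continuous_on {\<tau>..t} (\<lambda>s. ?N \<omega> i (coord (?p \<omega> s) i) s)" if w: "\<omega> \<in> space M" for \<omega>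
  proof -
    interpret LF: lattice_field \<nu> lam "?N \<omega>" nu_hi lam_hi "\<lambda>t. exp (- z \<omega> t) *\<^sub>R g t"
      by (rule lattice_field_reaction[OF z[OF w] R])
    have "continuous_on {\<tau>..t} (\<lambda>s. (coord (?p \<omega> s) i, s))"
      by (intro continuous_intros continuous_on_coord cp w)
    from continuous_on_compose2[OF LF.N_cont[of i] this] show ?thesis by auto
  qed
  \<comment> \<open>The factor 1 gives the reaction term the form coefficient times continuous
    function that \<open>borel_measurable_integral_Caratheodory\<close> expects.\<close>
  have "(\<lambda>\<omega>. coord u i + (integral {\<tau>..t} (\<lambda>s. \<nu> i s * - lap (coord (?p \<omega> s)) i)
      + integral {\<tau>..t} (\<lambda>s. lam i s * - coord (?p \<omega> s) i)
      + integral {\<tau>..t} (\<lambda>s. 1 * ?N \<omega> i (coord (?p \<omega> s) i) s))) \<in> borel_measurable M"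
  proof (intro borel_measurable_add borel_measurable_const)
    show "(\<lambda>\<omega>. integral {\<tau>..t} (\<lambda>s. \<nu> i s * - lap (coord (?p \<omega> s)) i)) \<in> borel_measurable M"
      unfolding lap_def using IH
      by (intro borel_measurable_integral_Caratheodory \<nu>_int continuous_intros continuous_on_coord cp)
        (auto intro!: borel_measurable_add borel_measurable_diff borel_measurable_uminus borel_measurable_times)
    show "(\<lambda>\<omega>. integral {\<tau>..t} (\<lambda>s. lam i s * - coord (?p \<omega> s) i)) \<in> borel_measurable M"
      using IH by (intro borel_measurable_integral_Caratheodory lam_int continuous_intros continuous_on_coord cp) auto
    show "(\<lambda>\<omega>. integral {\<tau>..t} (\<lambda>s. 1 * ?N \<omega> i (coord (?p \<omega> s) i) s)) \<in> borel_measurable M"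
      using IH by (intro borel_measurable_integral_Caratheodory cN measurable_reaction zm absolutely_integrable_continuous_real continuous_intros) auto
  qed
  moreover have "coord (picard \<nu> lam (?N \<omega>) \<tau> u (Suc n) t) i = coord u i +
      (integral {\<tau>..t} (\<lambda>s. \<nu> i s * - lap (coord (?p \<omega> s)) i)
      + integral {\<tau>..t} (\<lambda>s. lam i s * - coord (?p \<omega> s) i)
      + integral {\<tau>..t} (\<lambda>s. 1 * ?N \<omega> i (coord (?p \<omega> s) i) s))" if w: "\<omega> \<in> space M" for \<omega>
  proof -
    interpret LF: lattice_field \<nu> lam "?N \<omega>" nu_hi lam_hi "\<lambda>t. exp (- z \<omega> t) *\<^sub>R g t"
      by (rule lattice_field_reaction[OF z[OF w] R])
    have ai: "(\<lambda>s. \<nu> i s * - lap (coord (?p \<omega> s)) i) absolutely_integrable_on {\<tau>..t}"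
      "(\<lambda>s. lam i s * - coord (?p \<omega> s) i) absolutely_integrable_on {\<tau>..t}"
      unfolding lap_def
      by (intro absolutely_integrable_mult_continuous \<nu>_int lam_int continuous_intros continuous_on_coord cp w)+
    have i: "(\<lambda>s. \<nu> i s * - lap (coord (?p \<omega> s)) i) integrable_on {\<tau>..t}"
      "(\<lambda>s. lam i s * - coord (?p \<omega> s) i) integrable_on {\<tau>..t}"
      "(\<lambda>s. 1 * ?N \<omega> i (coord (?p \<omega> s) i) s) integrable_on {\<tau>..t}"
      using ai cN[OF w] by (auto simp: absolutely_integrable_on_def intro: integrable_continuous_real)
    have "coord (picard \<nu> lam (?N \<omega>) \<tau> u (Suc n) t) i = coord u i + integral {\<tau>..t} (\<lambda>s. lrhs \<nu> lam (?N \<omega>) s (?p \<omega> s) i)"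
      unfolding LF.picard_Suc using LF.coord_pic[OF cp[OF w], of t u] Suc.prems by simp
    also have "(\<lambda>s. lrhs \<nu> lam (?N \<omega>) s (?p \<omega> s) i) = (\<lambda>s. \<nu> i s * - lap (coord (?p \<omega> s)) i
        + lam i s * - coord (?p \<omega> s) i + 1 * ?N \<omega> i (coord (?p \<omega> s) i) s)"
      by (simp add: lrhs_def fun_eq_iff)
    also have "integral {\<tau>..t} \<dots> = integral {\<tau>..t} (\<lambda>s. \<nu> i s * - lap (coord (?p \<omega> s)) i)
      + integral {\<tau>..t} (\<lambda>s. lam i s * - coord (?p \<omega> s) i)
      + integral {\<tau>..t} (\<lambda>s. 1 * ?N \<omega> i (coord (?p \<omega> s) i) s)"
      by (simp only: integral_add[OF integrable_add[OF i(1,2)] i(3)] integral_add[OF i(1,2)])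
    finally show ?thesis .
  qed
  ultimately show ?case by (subst measurable_cong)
qed simp

text \<open>A double limit: over the iterates at each integer level, then over the levels.\<close>

lemma measurable_glob_sol:
  assumes z: "\<And>\<omega>. \<omega> \<in> space M \<Longrightarrow> continuous_on UNIV (z \<omega>)" and zm: "\<And>s. (\<lambda>\<omega>. z \<omega> s) \<in> borel_measurable M"
    and t: "\<tau> \<le> t"
  shows "(\<lambda>\<omega>. coord (glob_sol (z \<omega>) \<tau> u t) i) \<in> borel_measurable M"
proof (rule borel_measurable_LIMSEQ_real)
  show "(\<lambda>\<omega>. coord (trunc_sol (z \<omega>) (real n) \<tau> u t) i) \<in> borel_measurable M" for n
  proof (rule borel_measurable_LIMSEQ_real)
    show "(\<lambda>\<omega>. coord (picard \<nu> lam (reaction f g (z \<omega>) (real n)) \<tau> u k t) i) \<in> borel_measurable M" for k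
      by (rule measurable_picard[OF z zm _ t]) auto
    show "(\<lambda>k. coord (picard \<nu> lam (reaction f g (z \<omega>) (real n)) \<tau> u k t) i) \<longlonglongrightarrow> coord (trunc_sol (z \<omega>) (real n) \<tau> u t) i"
      if "\<omega> \<in> space M" for \<omega>
      by (intro tendsto_coord trunc_sol(2) z that t) simp
  qed
  show "(\<lambda>n. coord (trunc_sol (z \<omega>) (real n) \<tau> u t) i) \<longlonglongrightarrow> coord (glob_sol (z \<omega>) \<tau> u t) i"
    if w: "\<omega> \<in> space M" for \<omega>
  proof (rule tendsto_coord, rule truncation_inactive[OF z[OF w], of "norm u" \<tau> t])
    fix R0 assume "\<And>u' t'. norm u' \<le> norm u \<Longrightarrow> t' \<in> {\<tau>..t} \<Longrightarrow>
      (\<lambda>n. trunc_sol (z \<omega>) (real n) \<tau> u' t') \<longlonglongrightarrow> glob_sol (z \<omega>) \<tau> u' t'"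
    then show "(\<lambda>n. trunc_sol (z \<omega>) (real n) \<tau> u t) \<longlonglongrightarrow> glob_sol (z \<omega>) \<tau> u t" using t by auto
  qed
qed

end


section \<open>Pullback attractors of absorbed cocycles\<close>

lemma shift_shift: "\<theta> a (\<theta> b \<omega>) = \<theta> (a + b) \<omega>"
  by (simp add: shift_def fun_eq_iff add.commute add.left_commute)

lemma shift_zero: "\<omega> 0 = 0 \<Longrightarrow> \<theta> 0 \<omega> = \<omega>"
  by (simp add: shift_def)

lemma tendsto_zero_ennrealI:
  fixes h :: "'a \<Rightarrow> ennreal"
  assumes "\<And>e. 0 < e \<Longrightarrow> \<forall>\<^sub>F x in F. h x \<le> ennreal e"
  shows "(h \<longlongrightarrow> 0) F"
proof (rule order_tendstoI)
  fix a :: ennreal assume "0 < a"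
  then obtain b where b: "0 < b" "b < a" using dense by blast
  then obtain e where e: "b = ennreal e" "0 \<le> e" by (metis ennreal_cases not_top_less order_less_le_trans top_greatest order_less_imp_le)
  with b have "0 < e" by simp
  from assms[OF this] show "\<forall>\<^sub>F x in F. h x < a"
    by eventually_elim (use b e in auto)
qed simp

lemma hausdorff_semidist_le:
  "(\<And>y. y \<in> Y \<Longrightarrow> infdist y Z \<le> e) \<Longrightarrow> hausdorff_semidist Y Z \<le> ennreal e"
  unfolding hausdorff_semidist_def by (intro SUP_least ennreal_leI)

lemma infdist_less_of_hausdorff_semidist:
  assumes "hausdorff_semidist Y Z < ennreal e" "y \<in> Y"
  shows "infdist y Z < e"
proof -
  have "ennreal (infdist y Z) \<le> hausdorff_semidist Y Z"
    unfolding hausdorff_semidist_def by (rule SUP_upper[OF assms(2)])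
  then have "ennreal (infdist y Z) < ennreal e" using assms(1) by (rule order_le_less_trans)
  then show ?thesis by (simp add: ennreal_less_iff infdist_nonneg)
qed

lemma tempered_families_subset:
  assumes C: "C \<in> tempered_families \<Omega>" and inv: "\<And>t \<omega>. \<omega> \<in> \<Omega> \<Longrightarrow> \<theta> t \<omega> \<in> \<Omega>"
    and A: "\<And>\<tau> \<omega>. \<omega> \<in> \<Omega> \<Longrightarrow> A \<tau> \<omega> \<subseteq> C \<tau> \<omega>" "\<And>\<tau> \<omega>. \<omega> \<in> \<Omega> \<Longrightarrow> A \<tau> \<omega> \<noteq> {}"
  shows "A \<in> tempered_families \<Omega>"
proof -
  have bdC: "bounded (C \<tau> \<omega>)" if "\<omega> \<in> \<Omega>" for \<tau> \<omega> using C that by (simp add: tempered_families_def)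
  have le: "0 \<le> set_norm (A \<tau> \<omega>) \<and> set_norm (A \<tau> \<omega>) \<le> set_norm (C \<tau> \<omega>)" if w: "\<omega> \<in> \<Omega>" for \<tau> \<omega>
  proof -
    obtain B where "\<forall>u\<in>C \<tau> \<omega>. norm u \<le> B" using bdC[OF w] unfolding bounded_iff by blast
    then have bdd: "bdd_above (norm ` C \<tau> \<omega>)" by (intro bdd_aboveI[of _ B]) auto
    obtain u where u: "u \<in> A \<tau> \<omega>" using A(2)[OF w] by blast
    have "bdd_above (norm ` A \<tau> \<omega>)" by (rule bdd_above_mono[OF bdd]) (use A(1)[OF w] in auto)
    then have "norm u \<le> set_norm (A \<tau> \<omega>)" unfolding set_norm_def by (rule cSUP_upper[OF u])
    then have "0 \<le> set_norm (A \<tau> \<omega>)" using norm_ge_zero order_trans by blast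
    moreover have "set_norm (A \<tau> \<omega>) \<le> set_norm (C \<tau> \<omega>)"
      unfolding set_norm_def by (rule cSUP_subset_mono[OF A(2)[OF w] bdd A(1)[OF w]]) simp
    ultimately show ?thesis by simp
  qed
  have "((\<lambda>s. exp (- \<gamma> * s) * (set_norm (A (\<tau> - s) (\<theta> (- s) \<omega>)))\<^sup>2) \<longlongrightarrow> 0) at_top"
    if w: "\<omega> \<in> \<Omega>" and \<gamma>: "0 < \<gamma>" for \<tau> \<omega> \<gamma>
  proof (rule tendsto_sandwich[where f="\<lambda>_. 0"])
    show "((\<lambda>s. exp (- \<gamma> * s) * (set_norm (C (\<tau> - s) (\<theta> (- s) \<omega>)))\<^sup>2) \<longlongrightarrow> 0) at_top"
      using C w \<gamma> by (simp add: tempered_families_def)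
    show "\<forall>\<^sub>F s in at_top. 0 \<le> exp (- \<gamma> * s) * (set_norm (A (\<tau> - s) (\<theta> (- s) \<omega>)))\<^sup>2" by simp
    show "\<forall>\<^sub>F s in at_top. exp (- \<gamma> * s) * (set_norm (A (\<tau> - s) (\<theta> (- s) \<omega>)))\<^sup>2
        \<le> exp (- \<gamma> * s) * (set_norm (C (\<tau> - s) (\<theta> (- s) \<omega>)))\<^sup>2"
      using le[OF inv[OF w]] by (intro always_eventually allI mult_left_mono power_mono) auto
  qed simp
  then show ?thesis
    using A(2) bounded_subset[OF bdC A(1)] by (simp add: tempered_families_def)
qed

text \<open>Two families with different tasks: \<open>C\<close> absorbs every tempered family but
  need not be compact, while the compact \<open>K\<close> only has to attract
  \<open>C\<close>.\<close>

locale absorbed_cocycle =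
  fixes \<Omega> :: "(real \<Rightarrow> real) set" and \<Phi> :: "real \<Rightarrow> real \<Rightarrow> (real \<Rightarrow> real) \<Rightarrow> ell2 \<Rightarrow> ell2"
    and C K :: family
  assumes shift_mem: "\<And>t \<omega>. \<omega> \<in> \<Omega> \<Longrightarrow> \<theta> t \<omega> \<in> \<Omega>"
    and path_zero: "\<And>\<omega>. \<omega> \<in> \<Omega> \<Longrightarrow> \<omega> 0 = 0"
    and cocycle_law: "\<And>s t \<tau> \<omega> u. 0 \<le> s \<Longrightarrow> 0 \<le> t \<Longrightarrow> \<omega> \<in> \<Omega> \<Longrightarrow>
      \<Phi> (t + s) \<tau> \<omega> u = \<Phi> t (\<tau> + s) (\<theta> s \<omega>) (\<Phi> s \<tau> \<omega> u)"
    and cocycle_cont: "\<And>t \<tau> \<omega>. 0 \<le> t \<Longrightarrow> \<omega> \<in> \<Omega> \<Longrightarrow> continuous_on UNIV (\<Phi> t \<tau> \<omega>)"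
    and C_tempered: "C \<in> tempered_families \<Omega>"
    and C_absorbs: "\<And>B \<tau> \<omega>. B \<in> tempered_families \<Omega> \<Longrightarrow> \<omega> \<in> \<Omega> \<Longrightarrow>
      \<forall>\<^sub>F t in at_top. \<Phi> t (\<tau> - t) (\<theta> (- t) \<omega>) ` B (\<tau> - t) (\<theta> (- t) \<omega>) \<subseteq> C \<tau> \<omega>"
    and K_compact: "\<And>\<tau> \<omega>. \<omega> \<in> \<Omega> \<Longrightarrow> compact (K \<tau> \<omega>)"
    and K_nonempty: "\<And>\<tau> \<omega>. \<omega> \<in> \<Omega> \<Longrightarrow> K \<tau> \<omega> \<noteq> {}"
    and K_subset: "\<And>\<tau> \<omega>. \<omega> \<in> \<Omega> \<Longrightarrow> K \<tau> \<omega> \<subseteq> C \<tau> \<omega>"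
    and K_attracts: "\<And>\<tau> \<omega> e. \<omega> \<in> \<Omega> \<Longrightarrow> 0 < e \<Longrightarrow>
      \<forall>\<^sub>F t in at_top. \<forall>x\<in>C (\<tau> - t) (\<theta> (- t) \<omega>). infdist (\<Phi> t (\<tau> - t) (\<theta> (- t) \<omega>) x) (K \<tau> \<omega>) < e"
begin

definition pull :: "real \<Rightarrow> real \<Rightarrow> (real \<Rightarrow> real) \<Rightarrow> ell2 \<Rightarrow> ell2"
  where "pull t \<tau> \<omega> = \<Phi> t (\<tau> - t) (\<theta> (- t) \<omega>)"

definition Cpast :: "real \<Rightarrow> real \<Rightarrow> (real \<Rightarrow> real) \<Rightarrow> ell2 set"
  where "Cpast t \<tau> \<omega> = C (\<tau> - t) (\<theta> (- t) \<omega>)"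

text \<open>The pullback omega-limit set of \<open>C\<close>: the intersection over \<open>T\<close>
  of the closures of the union of all images started at times \<open>t \<ge> T\<close> back.\<close>

definition att :: family
  where "att \<tau> \<omega> = {y. \<forall>T e. 0 < e \<longrightarrow> (\<exists>t\<ge>T. \<exists>x\<in>Cpast t \<tau> \<omega>. dist (pull t \<tau> \<omega> x) y < e)}"

lemma K_attracts': "\<omega> \<in> \<Omega> \<Longrightarrow> 0 < e \<Longrightarrow>
    \<forall>\<^sub>F t in at_top. \<forall>x\<in>Cpast t \<tau> \<omega>. infdist (pull t \<tau> \<omega> x) (K \<tau> \<omega>) < e"
  using K_attracts by (simp add: pull_def Cpast_def)

lemma att_sequence:
  assumes "y \<in> att \<tau> \<omega>"
  obtains t x where "filterlim t at_top sequentially" "\<And>n. 0 \<le> t n" "\<And>n. x n \<in> Cpast (t n) \<tau> \<omega>"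
    "(\<lambda>n::nat. pull (t n) \<tau> \<omega> (x n)) \<longlonglongrightarrow> y"
proof -
  have "\<forall>n. \<exists>t x. real n \<le> t \<and> x \<in> Cpast t \<tau> \<omega> \<and> dist (pull t \<tau> \<omega> x) y < 1 / real (Suc n)"
  proof
    fix n show "\<exists>t x. real n \<le> t \<and> x \<in> Cpast t \<tau> \<omega> \<and> dist (pull t \<tau> \<omega> x) y < 1 / real (Suc n)"
      using assms unfolding att_def mem_Collect_eq by (metis of_nat_0_less_iff zero_less_Suc zero_less_divide_1_iff)
  qed
  then obtain t x where tx: "\<And>n. real n \<le> t n" "\<And>n. x n \<in> Cpast (t n) \<tau> \<omega>"
    "\<And>n. dist (pull (t n) \<tau> \<omega> (x n)) y < 1 / real (Suc n)" by metis
  show ?thesis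
  proof (rule that)
    show "filterlim t at_top sequentially"
      by (rule filterlim_at_top_mono[OF filterlim_real_sequentially]) (simp add: tx)
    show "0 \<le> t n" for n using tx(1)[of n] of_nat_0_le_iff order_trans by blast
    show "(\<lambda>n. pull (t n) \<tau> \<omega> (x n)) \<longlonglongrightarrow> y"
    proof (rule tendsto_dist_iff[THEN iffD2], rule tendsto_sandwich[OF _ _ tendsto_const])
      show "(\<lambda>n. 1 / real (Suc n)) \<longlonglongrightarrow> 0" using LIMSEQ_inverse_real_of_nat by (simp add: inverse_eq_divide)
      show "\<forall>\<^sub>F n in sequentially. dist (pull (t n) \<tau> \<omega> (x n)) y \<le> 1 / real (Suc n)"
        using tx(3) less_imp_le by (intro always_eventually allI) blast
    qed simp
  qed (rule tx)
qed

lemma att_sequenceI: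
  assumes t: "filterlim t at_top sequentially" and x: "\<And>n. x n \<in> Cpast (t n) \<tau> \<omega>"
    and lim: "(\<lambda>n::nat. pull (t n) \<tau> \<omega> (x n)) \<longlonglongrightarrow> y"
  shows "y \<in> att \<tau> \<omega>"
  unfolding att_def
proof (intro CollectI allI impI)
  fix T e :: real assume e: "0 < e"
  have "\<forall>\<^sub>F n in sequentially. T \<le> t n \<and> dist (pull (t n) \<tau> \<omega> (x n)) y < e"
    using t lim e by (intro eventually_conj) (auto simp: filterlim_at_top dest: tendstoD)
  then obtain n where "T \<le> t n" "dist (pull (t n) \<tau> \<omega> (x n)) y < e"
    using eventually_happens' sequentially_bot by blast
  then show "\<exists>t\<ge>T. \<exists>x\<in>Cpast t \<tau> \<omega>. dist (pull t \<tau> \<omega> x) y < e" using x by blast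
qed

text \<open>Pullback asymptotic compactness: the images come close to \<open>K\<close>, their
  nearest points in \<open>K\<close> have a convergent subsequence, and the images follow
  it.\<close>

lemma pull_subsequence:
  assumes w: "\<omega> \<in> \<Omega>" and t: "filterlim t at_top sequentially" and x: "\<And>n::nat. x n \<in> Cpast (t n) \<tau> \<omega>"
  obtains r y where "strict_mono r" "(\<lambda>n. pull (t (r n)) \<tau> \<omega> (x (r n))) \<longlonglongrightarrow> y" "y \<in> att \<tau> \<omega>"
proof -
  let ?p = "\<lambda>n. pull (t n) \<tau> \<omega> (x n)"
  have "\<exists>k\<in>K \<tau> \<omega>. infdist (?p n) (K \<tau> \<omega>) = dist (?p n) k" for n
  proof -
    have "continuous_on (K \<tau> \<omega>) (dist (?p n))" by (intro continuous_intros)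
    then obtain k where k: "k \<in> K \<tau> \<omega>" "\<And>y. y \<in> K \<tau> \<omega> \<Longrightarrow> dist (?p n) k \<le> dist (?p n) y"
      using continuous_attains_inf[OF K_compact[OF w, of \<tau>] K_nonempty[OF w, of \<tau>]] by blast
    have "dist (?p n) k \<le> infdist (?p n) (K \<tau> \<omega>)"
      unfolding infdist_notempty[OF K_nonempty[OF w]] by (rule cINF_greatest[OF K_nonempty[OF w] k(2)])
    then show ?thesis using infdist_le[OF k(1), of "?p n"] k(1) by force
  qed
  then obtain k where k: "\<And>n. k n \<in> K \<tau> \<omega>" "\<And>n. infdist (?p n) (K \<tau> \<omega>) = dist (?p n) (k n)" by metis
  have d: "(\<lambda>n. dist (?p n) (k n)) \<longlonglongrightarrow> 0"
  proof (rule tendstoI)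
    fix e :: real assume "0 < e"
    from eventually_compose_filterlim[OF K_attracts'[OF w this, of \<tau>] t]
    have "\<forall>\<^sub>F n in sequentially. \<forall>z\<in>Cpast (t n) \<tau> \<omega>. infdist (pull (t n) \<tau> \<omega> z) (K \<tau> \<omega>) < e"
      .
    then show "\<forall>\<^sub>F n in sequentially. dist (dist (?p n) (k n)) 0 < e"
      by eventually_elim (use x k in force)
  qed
  obtain y r where yr: "y \<in> K \<tau> \<omega>" "strict_mono r" "(k \<circ> r) \<longlonglongrightarrow> y"
    using K_compact[OF w, of \<tau>] k(1) unfolding compact_def by blast
  have "(\<lambda>n. dist (?p (r n)) (k (r n))) \<longlonglongrightarrow> 0"
    using LIMSEQ_subseq_LIMSEQ[OF d yr(2)] by (simp add: o_def)
  moreover have "(\<lambda>n. dist (k (r n)) y) \<longlonglongrightarrow> 0" using yr(3) unfolding o_def by (rule tendsto_dist_iff[THEN iffD1])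
  ultimately have "(\<lambda>n. dist (?p (r n)) (k (r n)) + dist (k (r n)) y) \<longlonglongrightarrow> 0"
    by (rule tendsto_add_zero)
  then have "(\<lambda>n. dist (?p (r n)) y) \<longlonglongrightarrow> 0"
    by (rule tendsto_sandwich[OF always_eventually always_eventually tendsto_const, rotated 2])
      (simp_all add: dist_triangle)
  then have lim: "(\<lambda>n. ?p (r n)) \<longlonglongrightarrow> y" by (rule tendsto_dist_iff[THEN iffD2])
  have "y \<in> att \<tau> \<omega>"
    by (rule att_sequenceI[of "\<lambda>n. t (r n)" "\<lambda>n. x (r n)", OF _ _ lim])
      (use filterlim_compose[OF t filterlim_subseq[OF yr(2)]] x in auto)
  then show ?thesis using that[OF yr(2) lim] by blast
qed

lemma att_subset_K:
  assumes w: "\<omega> \<in> \<Omega>"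
  shows "att \<tau> \<omega> \<subseteq> K \<tau> \<omega>"
proof
  fix y assume "y \<in> att \<tau> \<omega>"
  then have y: "\<exists>t\<ge>T. \<exists>x\<in>Cpast t \<tau> \<omega>. dist (pull t \<tau> \<omega> x) y < e" if "0 < e" for T e
    using that by (simp add: att_def)
  have "infdist y (K \<tau> \<omega>) \<le> e" if e: "0 < e" for e
  proof -
    obtain T where T: "\<And>t x. T \<le> t \<Longrightarrow> x \<in> Cpast t \<tau> \<omega> \<Longrightarrow> infdist (pull t \<tau> \<omega> x) (K \<tau> \<omega>) < e/2"
      using K_attracts'[OF w half_gt_zero[OF e], of \<tau>] unfolding eventually_at_top_linorder by blast
    obtain t x where tx: "T \<le> t" "x \<in> Cpast t \<tau> \<omega>" "dist (pull t \<tau> \<omega> x) y < e/2"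
      using y[OF half_gt_zero[OF e], of T] by blast
    have "infdist y (K \<tau> \<omega>) \<le> infdist (pull t \<tau> \<omega> x) (K \<tau> \<omega>) + dist y (pull t \<tau> \<omega> x)"
      by (rule infdist_triangle)
    then show ?thesis using T[OF tx(1,2)] tx(3) by (simp add: dist_commute)
  qed
  then have "infdist y (K \<tau> \<omega>) = 0" using infdist_nonneg[of y "K \<tau> \<omega>"] by (meson dense_ge order_antisym)
  then show "y \<in> K \<tau> \<omega>"
    using in_closed_iff_infdist_zero[OF compact_imp_closed[OF K_compact[OF w]] K_nonempty[OF w]] by blast
qed

lemma closed_att: "closed (att \<tau> \<omega>)"
  unfolding closed_sequential_limits
proof (intro allI impI, elim conjE)
  fix Y y assume Y: "\<forall>n. Y n \<in> att \<tau> \<omega>" "Y \<longlonglongrightarrow> y"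
  show "y \<in> att \<tau> \<omega>" unfolding att_def
  proof (intro CollectI allI impI)
    fix T e :: real assume e: "0 < e"
    obtain n where n: "dist (Y n) y < e/2" using Y(2) half_gt_zero[OF e] unfolding lim_sequentially by blast
    obtain t x where tx: "T \<le> t" "x \<in> Cpast t \<tau> \<omega>" "dist (pull t \<tau> \<omega> x) (Y n) < e/2"
      using Y(1) half_gt_zero[OF e] unfolding att_def by blast
    have "dist (pull t \<tau> \<omega> x) y < e"
      using dist_triangle[of "pull t \<tau> \<omega> x" y "Y n"] n tx(3) by linarith
    then show "\<exists>t\<ge>T. \<exists>x\<in>Cpast t \<tau> \<omega>. dist (pull t \<tau> \<omega> x) y < e" using tx by blast
  qed
qed

lemma compact_att: "\<omega> \<in> \<Omega> \<Longrightarrow> compact (att \<tau> \<omega>)"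
  using compact_Int_closed[OF K_compact closed_att] att_subset_K by (metis inf.absorb2)

lemma att_subset_C: "\<omega> \<in> \<Omega> \<Longrightarrow> att \<tau> \<omega> \<subseteq> C \<tau> \<omega>"
  using att_subset_K K_subset by blast

lemma Cpast_nonempty: "\<omega> \<in> \<Omega> \<Longrightarrow> Cpast t \<tau> \<omega> \<noteq> {}"
  using C_tempered shift_mem by (simp add: Cpast_def tempered_families_def)

lemma att_nonempty:
  assumes w: "\<omega> \<in> \<Omega>"
  shows "att \<tau> \<omega> \<noteq> {}"
proof -
  have "\<forall>n. \<exists>x. x \<in> Cpast (real n) \<tau> \<omega>" using Cpast_nonempty[OF w] by blast
  then have "\<exists>x. \<forall>n. x n \<in> Cpast (real n) \<tau> \<omega>" by (rule choice)
  then obtain x where "\<And>n. x n \<in> Cpast (real n) \<tau> \<omega>" by blast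
  from pull_subsequence[OF w filterlim_real_sequentially this] show ?thesis by blast
qed

lemma att_tempered: "att \<in> tempered_families \<Omega>"
  by (rule tempered_families_subset[OF C_tempered shift_mem att_subset_C att_nonempty])

text \<open>Otherwise images staying at distance at least \<open>e\<close> from the limit set would,
  by \<open>pull_subsequence\<close>, accumulate at one of its points.\<close>

lemma att_attracts_C:
  assumes w: "\<omega> \<in> \<Omega>" and e: "0 < e"
  shows "\<forall>\<^sub>F t in at_top. \<forall>x\<in>Cpast t \<tau> \<omega>. infdist (pull t \<tau> \<omega> x) (att \<tau> \<omega>) < e"
proof (rule ccontr)
  assume "\<not> ?thesis"
  then have "\<forall>n::nat. \<exists>t x. real n \<le> t \<and> x \<in> Cpast t \<tau> \<omega> \<and> e \<le> infdist (pull t \<tau> \<omega> x) (att \<tau> \<omega>)"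
    unfolding eventually_at_top_linorder by (meson not_le)
  then obtain t x where tx: "\<And>n. real n \<le> t n" "\<And>n. x n \<in> Cpast (t n) \<tau> \<omega>"
    "\<And>n. e \<le> infdist (pull (t n) \<tau> \<omega> (x n)) (att \<tau> \<omega>)" by metis
  have t: "filterlim t at_top sequentially"
    by (rule filterlim_at_top_mono[OF filterlim_real_sequentially]) (simp add: tx)
  obtain r y where "(\<lambda>n. pull (t (r n)) \<tau> \<omega> (x (r n))) \<longlonglongrightarrow> y" and y: "y \<in> att \<tau> \<omega>"
    by (rule pull_subsequence[OF w t tx(2)]) (rule that)
  then have "\<forall>\<^sub>F n in sequentially. dist (pull (t (r n)) \<tau> \<omega> (x (r n))) y < e" using e by (auto dest: tendstoD)
  then obtain n where "dist (pull (t (r n)) \<tau> \<omega> (x (r n))) y < e"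
    using eventually_happens' sequentially_bot by blast
  then show False using infdist_le[OF y, of "pull (t (r n)) \<tau> \<omega> (x (r n))"] tx(3)[of "r n"] by linarith
qed

lemma pull_add:
  assumes w: "\<omega> \<in> \<Omega>" and "0 \<le> s" "0 \<le> t"
  shows "pull (s + t) \<tau> \<omega> u = pull s \<tau> \<omega> (pull t (\<tau> - s) (\<theta> (- s) \<omega>) u)"
  using cocycle_law[OF \<open>0 \<le> t\<close> \<open>0 \<le> s\<close> shift_mem[OF w], of "\<tau> - (s + t)" "- (s + t)" u]
  by (simp add: pull_def shift_shift algebra_simps)

text \<open>Two stages: \<open>s\<close> is fixed such that the image of \<open>C\<close> over time
  \<open>s\<close> lies within \<open>e\<close> of the limit set; going further back,
  \<open>B\<close> is absorbed by \<open>C\<close> in the fibre at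
  \<open>\<tau> - s\<close>.\<close>

lemma att_attracts:
  assumes B: "B \<in> tempered_families \<Omega>" and w: "\<omega> \<in> \<Omega>"
  shows "((\<lambda>t. hausdorff_semidist (\<Phi> t (\<tau> - t) (\<theta> (- t) \<omega>) ` B (\<tau> - t) (\<theta> (- t) \<omega>)) (att \<tau> \<omega>)) \<longlongrightarrow> 0) at_top"
proof (rule tendsto_zero_ennrealI)
  fix e :: real assume e: "0 < e"
  have "\<forall>\<^sub>F s in at_top. (\<forall>x\<in>Cpast s \<tau> \<omega>. infdist (pull s \<tau> \<omega> x) (att \<tau> \<omega>) < e) \<and> 0 \<le> s"
    by (intro eventually_conj att_attracts_C w e eventually_ge_at_top)
  then obtain s where s: "\<And>x. x \<in> Cpast s \<tau> \<omega> \<Longrightarrow> infdist (pull s \<tau> \<omega> x) (att \<tau> \<omega>) < e" "0 \<le> s"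
    using eventually_happens'[OF trivial_limit_at_top_linorder] by blast
  obtain T where T: "\<And>t. T \<le> t \<Longrightarrow> pull t (\<tau> - s) (\<theta> (- s) \<omega>) ` B (\<tau> - s - t) (\<theta> (- t) (\<theta> (- s) \<omega>)) \<subseteq> C (\<tau> - s) (\<theta> (- s) \<omega>)"
    using C_absorbs[OF B shift_mem[OF w], of "\<tau> - s" "- s"] unfolding eventually_at_top_linorder pull_def by blast
  show "\<forall>\<^sub>F t in at_top. hausdorff_semidist (\<Phi> t (\<tau> - t) (\<theta> (- t) \<omega>) ` B (\<tau> - t) (\<theta> (- t) \<omega>)) (att \<tau> \<omega>) \<le> ennreal e"
    unfolding eventually_at_top_linorder
  proof (intro exI[of _ "s + max 0 T"] allI impI hausdorff_semidist_le)
    fix t y assume t: "s + max 0 T \<le> t" and "y \<in> \<Phi> t (\<tau> - t) (\<theta> (- t) \<omega>) ` B (\<tau> - t) (\<theta> (- t) \<omega>)"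
    then obtain x where x: "x \<in> B (\<tau> - t) (\<theta> (- t) \<omega>)" "y = pull t \<tau> \<omega> x" by (auto simp: pull_def)
    define r where "r = t - s"
    have r: "t = s + r" "0 \<le> r" "T \<le> r" using t by (auto simp: r_def)
    have "x \<in> B (\<tau> - s - r) (\<theta> (- r) (\<theta> (- s) \<omega>))" using x(1) by (simp add: r(1) shift_shift algebra_simps)
    then have "pull r (\<tau> - s) (\<theta> (- s) \<omega>) x \<in> Cpast s \<tau> \<omega>" using T[OF r(3)] by (auto simp: Cpast_def)
    then show "infdist y (att \<tau> \<omega>) \<le> e"
      using s(1) by (simp add: x(2) r(1) pull_add[OF w s(2) r(2)] less_imp_le)
  qed
qed

lemma att_invariant:
  assumes w: "\<omega> \<in> \<Omega>" and t: "0 \<le> t"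
  shows "\<Phi> t \<tau> \<omega> ` att \<tau> \<omega> = att (\<tau> + t) (\<theta> t \<omega>)"
proof (intro equalityI subsetI)
  have \<Phi>_eq: "\<Phi> t \<tau> \<omega> = pull t (\<tau> + t) (\<theta> t \<omega>)"
    using path_zero[OF w] by (simp add: pull_def shift_shift shift_zero)
  have pb: "\<theta> (- t) (\<theta> t \<omega>) = \<omega>" using path_zero[OF w] by (simp add: shift_shift shift_zero)
  \<comment> \<open>Pulling to \<open>\<tau> + t\<close> over time \<open>t + s\<close> is pulling
    to \<open>\<tau>\<close> over time \<open>s\<close> followed by \<open>\<Phi> t\<close>, with
    the same initial sets; both inclusions transport sequences along this identity.\<close>
  have comp: "pull (t + s) (\<tau> + t) (\<theta> t \<omega>) u = \<Phi> t \<tau> \<omega> (pull s \<tau> \<omega> u)" if "0 \<le> s" for s u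
    using pull_add[OF shift_mem[OF w] t that, of "\<tau> + t" t u] by (simp add: \<Phi>_eq pb)
  have past: "Cpast (t + s) (\<tau> + t) (\<theta> t \<omega>) = Cpast s \<tau> \<omega>" for s
    by (simp add: Cpast_def shift_shift)
  have cont: "isCont (\<Phi> t \<tau> \<omega>) y" for y
    using cocycle_cont[OF t w] by (simp add: continuous_on_eq_continuous_at)
  {
    fix z assume "z \<in> \<Phi> t \<tau> \<omega> ` att \<tau> \<omega>"
    then obtain y where y: "y \<in> att \<tau> \<omega>" "z = \<Phi> t \<tau> \<omega> y" by blast
    obtain s x where s: "filterlim s at_top sequentially" "\<And>n. 0 \<le> s n" "\<And>n. x n \<in> Cpast (s n) \<tau> \<omega>"
      "(\<lambda>n. pull (s n) \<tau> \<omega> (x n)) \<longlonglongrightarrow> y"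
      by (rule att_sequence[OF y(1)]) (rule that)
    show "z \<in> att (\<tau> + t) (\<theta> t \<omega>)"
    proof (rule att_sequenceI[of "\<lambda>n. t + s n" x])
      show "filterlim (\<lambda>n. t + s n) at_top sequentially"
        by (rule filterlim_tendsto_add_at_top[OF tendsto_const s(1)])
      show "x n \<in> Cpast (t + s n) (\<tau> + t) (\<theta> t \<omega>)" for n by (simp add: past s)
      show "(\<lambda>n. pull (t + s n) (\<tau> + t) (\<theta> t \<omega>) (x n)) \<longlonglongrightarrow> z"
        unfolding comp[OF s(2)] y(2) by (rule isCont_tendsto_compose[OF cont s(4)])
    qed
  next
    fix z assume "z \<in> att (\<tau> + t) (\<theta> t \<omega>)"
    then obtain s x where s: "filterlim s at_top sequentially" "\<And>n. x n \<in> Cpast (s n) (\<tau> + t) (\<theta> t \<omega>)"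
      "(\<lambda>n. pull (s n) (\<tau> + t) (\<theta> t \<omega>) (x n)) \<longlonglongrightarrow> z"
      by (rule att_sequence) (rule that)
    have "\<forall>\<^sub>F n in sequentially. t \<le> s n" using s(1) by (simp add: filterlim_at_top)
    then obtain N where N: "\<And>n. N \<le> n \<Longrightarrow> t \<le> s n" unfolding eventually_sequentially by blast
    \<comment> \<open>Dropping the first \<open>N\<close> terms makes \<open>s n - t\<close>
      nonnegative, so the cocycle law applies; the shortened pulls accumulate at a point of
      \<open>att \<tau> \<omega>\<close>, which continuity of \<open>\<Phi> t\<close> sends to
      \<open>z\<close>.\<close>
    define s' x' where "s' n = s (n + N) - t" and "x' n = x (n + N)" for n
    have s'0: "0 \<le> s' n" for n using N[of "n + N"] by (simp add: s'_def)
    have se: "s (n + N) = t + s' n" for n by (simp add: s'_def)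
    have sN: "filterlim (\<lambda>n. s (n + N)) at_top sequentially"
      by (rule filterlim_compose[OF s(1)]) (rule filterlim_add_const_nat_at_top)
    have s': "filterlim s' at_top sequentially"
      using filterlim_tendsto_add_at_top[OF tendsto_const sN, of "- t"] by (simp add: s'_def[abs_def] add.commute)
    have x': "x' n \<in> Cpast (s' n) \<tau> \<omega>" for n
      using s(2)[of "n + N"] by (simp only: se past x'_def)
    obtain r y where r: "strict_mono r" "(\<lambda>n. pull (s' (r n)) \<tau> \<omega> (x' (r n))) \<longlonglongrightarrow> y" "y \<in> att \<tau> \<omega>"
      by (rule pull_subsequence[OF w s' x']) (rule that)
    have "(\<lambda>n. pull (s (n + N)) (\<tau> + t) (\<theta> t \<omega>) (x (n + N))) \<longlonglongrightarrow> z"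
      using LIMSEQ_ignore_initial_segment[OF s(3)] .
    then have "(\<lambda>n. \<Phi> t \<tau> \<omega> (pull (s' n) \<tau> \<omega> (x' n))) \<longlonglongrightarrow> z"
      by (simp only: se comp[OF s'0] x'_def)
    from LIMSEQ_subseq_LIMSEQ[OF this r(1)]
    have "(\<lambda>n. \<Phi> t \<tau> \<omega> (pull (s' (r n)) \<tau> \<omega> (x' (r n)))) \<longlonglongrightarrow> z" by (simp add: o_def)
    moreover have "(\<lambda>n. \<Phi> t \<tau> \<omega> (pull (s' (r n)) \<tau> \<omega> (x' (r n)))) \<longlonglongrightarrow> \<Phi> t \<tau> \<omega> y"
      by (rule isCont_tendsto_compose[OF cont r(2)])
    ultimately have "z = \<Phi> t \<tau> \<omega> y" by (rule LIMSEQ_unique)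
    then show "z \<in> \<Phi> t \<tau> \<omega> ` att \<tau> \<omega>" using r(3) by blast
  }
qed

text \<open>Since \<open>att\<close> lies in every pulled-back image of \<open>C\<close> and attracts these images, its distance
  function is a limit of theirs along integer times; this is how measurability is obtained.\<close>

lemma infdist_att_limit:
  assumes w: "\<omega> \<in> \<Omega>"
  shows "(\<lambda>n. infdist x (pull (real n) \<tau> \<omega> ` Cpast (real n) \<tau> \<omega>)) \<longlonglongrightarrow> infdist x (att \<tau> \<omega>)"
proof -
  let ?S = "\<lambda>t. pull t \<tau> \<omega> ` Cpast t \<tau> \<omega>"
  have le: "infdist x (?S t) \<le> infdist x (att \<tau> \<omega>)" if t: "0 \<le> t" for t
  proof (rule infdist_mono[OF _ att_nonempty[OF w]])
    have "att \<tau> \<omega> = pull t \<tau> \<omega> ` att (\<tau> - t) (\<theta> (- t) \<omega>)"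
      using att_invariant[OF shift_mem[OF w] t, of "\<tau> - t" "- t"] path_zero[OF w]
      by (simp add: pull_def shift_shift shift_zero)
    then show "att \<tau> \<omega> \<subseteq> ?S t"
      using att_subset_C[OF shift_mem[OF w], of "\<tau> - t" "- t"] by (auto simp: Cpast_def)
  qed
  have ge: "\<forall>\<^sub>F t in at_top. infdist x (att \<tau> \<omega>) - e \<le> infdist x (?S t)" if e: "0 < e" for e
    using att_attracts_C[OF w e, of \<tau>]
  proof eventually_elim
    case (elim t)
    have ne: "?S t \<noteq> {}" using Cpast_nonempty[OF w] by simp
    have "infdist x (att \<tau> \<omega>) - e \<le> dist x p" if "p \<in> ?S t" for p
      using infdist_triangle[of x "att \<tau> \<omega>" p] elim that by force
    then show ?case unfolding infdist_notempty[OF ne] by (rule cINF_greatest[OF ne])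
  qed
  show ?thesis
  proof (rule tendstoI)
    fix e :: real assume e: "0 < e"
    from eventually_compose_filterlim[OF ge[OF half_gt_zero[OF e]] filterlim_real_sequentially]
    have "\<forall>\<^sub>F n in sequentially. infdist x (att \<tau> \<omega>) - e/2 \<le> infdist x (?S (real n))"
      .
    then show "\<forall>\<^sub>F n in sequentially. dist (infdist x (?S (real n))) (infdist x (att \<tau> \<omega>)) < e"
    proof eventually_elim
      case (elim n)
      then show ?case using le[of "real n"] e by (simp add: dist_real_def)
    qed
  qed
qed

end

text \<open>\<open>A'\<close> is itself tempered, hence attracted by \<open>A\<close>; by invariance
  its pulled-back images equal \<open>A' \<tau> \<omega>\<close> for every \<open>t \<ge> 0\<close>,
  so this set has distance zero from the compact \<open>A \<tau> \<omega>\<close>. Exchanging the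
  roles gives uniqueness.\<close>

lemma pullback_attractor_subset:
  assumes A: "pullback_attractor P \<Omega> \<Phi> A" and A': "pullback_attractor P \<Omega> \<Phi> A'"
    and inv: "\<And>t \<omega>. \<omega> \<in> \<Omega> \<Longrightarrow> \<theta> t \<omega> \<in> \<Omega>" and zero: "\<And>\<omega>. \<omega> \<in> \<Omega> \<Longrightarrow> \<omega> 0 = 0"
    and w: "\<omega> \<in> \<Omega>"
  shows "A' \<tau> \<omega> \<subseteq> A \<tau> \<omega>"
proof
  fix y assume y: "y \<in> A' \<tau> \<omega>"
  have comp: "compact (A \<tau> \<omega>)" and ne: "A \<tau> \<omega> \<noteq> {}"
    using A w by (auto simp: pullback_attractor_def tempered_families_def)
  have "A' \<in> tempered_families \<Omega>" using A' by (simp add: pullback_attractor_def)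
  then have lim: "((\<lambda>t. hausdorff_semidist (\<Phi> t (\<tau> - t) (\<theta> (- t) \<omega>) ` A' (\<tau> - t) (\<theta> (- t) \<omega>)) (A \<tau> \<omega>)) \<longlongrightarrow> 0) at_top"
    using A w by (simp add: pullback_attractor_def)
  have inva: "\<Phi> t (\<tau> - t) (\<theta> (- t) \<omega>) ` A' (\<tau> - t) (\<theta> (- t) \<omega>) = A' \<tau> \<omega>" if "0 \<le> t" for t
  proof -
    have "\<Phi> t (\<tau> - t) (\<theta> (- t) \<omega>) ` A' (\<tau> - t) (\<theta> (- t) \<omega>) = A' (\<tau> - t + t) (\<theta> t (\<theta> (- t) \<omega>))"
      using A' inv[OF w] that unfolding pullback_attractor_def by blast
    then show ?thesis using zero[OF w] by (simp add: shift_shift shift_zero)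
  qed
  have "infdist y (A \<tau> \<omega>) \<le> e" if e: "0 < e" for e
  proof -
    have "\<forall>\<^sub>F t in at_top. hausdorff_semidist (\<Phi> t (\<tau> - t) (\<theta> (- t) \<omega>) ` A' (\<tau> - t) (\<theta> (- t) \<omega>)) (A \<tau> \<omega>) < ennreal e \<and> 0 \<le> t"
      by (intro eventually_conj order_tendstoD(2)[OF lim] eventually_ge_at_top) (use e in simp)
    then obtain t where t: "hausdorff_semidist (\<Phi> t (\<tau> - t) (\<theta> (- t) \<omega>) ` A' (\<tau> - t) (\<theta> (- t) \<omega>)) (A \<tau> \<omega>) < ennreal e" "0 \<le> t"
      using eventually_happens'[OF trivial_limit_at_top_linorder] by blast
    from infdist_less_of_hausdorff_semidist[OF t(1)[unfolded inva[OF t(2)]] y] show ?thesis by simp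
  qed
  then have "infdist y (A \<tau> \<omega>) = 0" using infdist_nonneg[of y "A \<tau> \<omega>"] by (meson dense_ge order_antisym)
  then show "y \<in> A \<tau> \<omega>" using in_closed_iff_infdist_zero[OF compact_imp_closed[OF comp] ne] by blast
qed


section \<open>Estimates along a path\<close>

text \<open>One constant per \<open>\<tau>\<close> and slope \<open>\<delta>\<close> controls both
  the path and its integral, since both occur in \<open>kern\<close>.\<close>

definition sublinear_past :: "(real \<Rightarrow> real) \<Rightarrow> bool"
  where "sublinear_past z \<longleftrightarrow> continuous_on UNIV z \<and>
    (\<forall>\<tau> \<delta>. 0 < \<delta> \<longrightarrow> (\<exists>C\<ge>0. \<forall>s\<le>\<tau>. \<bar>integral {s..\<tau>} z\<bar> \<le> C + \<delta> * (\<tau> - s) \<and> \<bar>z s\<bar> \<le> C + \<delta> * (\<tau> - s)))"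

lemma sublinear_pastI:
  assumes z: "continuous_on UNIV z"
    and l1: "((\<lambda>t. \<bar>z t\<bar> / \<bar>t\<bar>) \<longlongrightarrow> 0) at_bot"
    and l2: "((\<lambda>t. 1 / t * (LBINT s=0..ereal t. z s)) \<longlongrightarrow> 0) at_bot"
  shows "sublinear_past z"
  unfolding sublinear_past_def
proof (intro conjI allI impI z)
  fix \<tau> \<delta> :: real assume \<delta>: "0 < \<delta>"
  have zc: "continuous_on S z" for S using z continuous_on_subset by blast
  have int: "z integrable_on {a..b}" for a b by (rule integrable_continuous_real[OF zc])
  have lbint: "\<bar>LBINT s=0..ereal t. z s\<bar> = \<bar>integral {t..0} z\<bar>" if "t \<le> 0" for t
  proof -
    have "set_integrable lborel {t..0} z" by (rule borel_integrable_compact[OF _ zc, of "{t..0}", folded set_integrable_def]) simp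
    then have "(LBINT s=ereal t..ereal 0. z s) = integral {t..0} z"
      by (rule interval_integral_eq_integral[OF that])
    then show ?thesis
      by (subst interval_integral_endpoints_reverse) (simp add: zero_ereal_def)
  qed
  have "\<forall>\<^sub>F t in at_bot. \<bar>z t\<bar> / \<bar>t\<bar> < \<delta>" "\<forall>\<^sub>F t in at_bot. \<bar>1 / t * (LBINT s=0..ereal t. z s)\<bar> < \<delta>"
    using tendstoD[OF l1 \<delta>] tendstoD[OF l2 \<delta>] by (auto simp: dist_real_def)
  then have "\<forall>\<^sub>F t in at_bot. \<bar>z t\<bar> / \<bar>t\<bar> < \<delta> \<and> \<bar>1 / t * (LBINT s=0..ereal t. z s)\<bar> < \<delta>" by (rule eventually_conj)
  then obtain T1 where T1: "\<And>t. t \<le> T1 \<Longrightarrow> \<bar>z t\<bar> / \<bar>t\<bar> < \<delta> \<and> \<bar>1 / t * (LBINT s=0..ereal t. z s)\<bar> < \<delta>"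
    unfolding eventually_at_bot_linorder by blast
  \<comment> \<open>Up to \<open>T \<le> - 1\<close> multiplication by \<open>\<bar>t\<bar>\<close>
    turns the limits into bounds; on the compact rest \<open>{T..\<tau>}\<close> continuity
    suffices.\<close>
  define T where "T = min T1 (min \<tau> (- 1))"
  have T: "T \<le> T1" "T \<le> \<tau>" "T \<le> - 1" by (auto simp: T_def)
  have far: "\<bar>z t\<bar> \<le> \<delta> * \<bar>t\<bar>" "\<bar>integral {t..0} z\<bar> \<le> \<delta> * \<bar>t\<bar>" if t: "t \<le> T" for t
  proof -
    have t0: "0 < \<bar>t\<bar>" "t \<le> 0" using t T by auto
    have "\<bar>z t\<bar> / \<bar>t\<bar> < \<delta>" "\<bar>integral {t..0} z\<bar> / \<bar>t\<bar> < \<delta>"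
      using T1[of t] t T lbint[OF t0(2)] by (auto simp: abs_mult)
    then show "\<bar>z t\<bar> \<le> \<delta> * \<bar>t\<bar>" "\<bar>integral {t..0} z\<bar> \<le> \<delta> * \<bar>t\<bar>"
      using t0(1) by (auto simp: pos_divide_less_eq)
  qed
  have "bounded (z ` {T..\<tau>})" "bounded ((\<lambda>s. integral {s..\<tau>} z) ` {T..\<tau>})"
    by (intro compact_imp_bounded compact_continuous_image zc indefinite_integral_continuous_1' int; simp)+
  then obtain C1 C2 where C1: "\<forall>s\<in>{T..\<tau>}. \<bar>z s\<bar> \<le> C1" and C2: "\<forall>s\<in>{T..\<tau>}. \<bar>integral {s..\<tau>} z\<bar> \<le> C2"
    unfolding bounded_iff by auto
  \<comment> \<open>\<open>a1\<close> and \<open>a2\<close> handle the compact part,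
    \<open>a3\<close> and \<open>a4\<close> move the endpoint of the integral from 0 to
    \<open>\<tau>\<close>, and \<open>a5\<close> converts \<open>\<delta> * \<bar>s\<bar>\<close>
    into \<open>\<delta> * (\<tau> - s)\<close>.\<close>
  define a1 a2 a3 a4 a5
    where "a1 = \<bar>C1\<bar>" and "a2 = \<bar>C2\<bar>" and "a3 = \<bar>integral {T..0} z\<bar>" and "a4 = \<bar>integral {T..\<tau>} z\<bar>"
      and "a5 = \<delta> * \<bar>\<tau>\<bar>"
  define C where "C = a1 + a2 + a3 + a4 + a5"
  have nn: "0 \<le> a1" "0 \<le> a2" "0 \<le> a3" "0 \<le> a4" "0 \<le> a5" "C1 \<le> a1" "C2 \<le> a2"
    using \<delta> by (simp_all add: a1_def a2_def a3_def a4_def a5_def)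
  show "\<exists>C\<ge>0. \<forall>s\<le>\<tau>. \<bar>integral {s..\<tau>} z\<bar> \<le> C + \<delta> * (\<tau> - s) \<and> \<bar>z s\<bar> \<le> C + \<delta> * (\<tau> - s)"
  proof (intro exI[of _ C] conjI allI impI)
    show "0 \<le> C" unfolding C_def using nn by linarith
    fix s assume s: "s \<le> \<tau>"
    have ds: "0 \<le> \<delta> * (\<tau> - s)" using s \<delta> by simp
    have "\<bar>integral {s..\<tau>} z\<bar> \<le> C + \<delta> * (\<tau> - s) \<and> \<bar>z s\<bar> \<le> C + \<delta> * (\<tau> - s)"
    proof (cases "s \<le> T")
      case True
      have "\<bar>s\<bar> \<le> (\<tau> - s) + \<bar>\<tau>\<bar>" using s by linarith
      then have a: "\<delta> * \<bar>s\<bar> \<le> \<delta> * (\<tau> - s) + a5"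
        unfolding a5_def using \<delta> by (metis distrib_left less_imp_le mult_left_mono)
      have b: "\<delta> * \<bar>s\<bar> + a3 + a4 \<le> C + \<delta> * (\<tau> - s)" "\<delta> * \<bar>s\<bar> \<le> C + \<delta> * (\<tau> - s)"
        using add_right_mono[OF a, of "a3 + a4"] a nn unfolding C_def by simp_all
      have "integral {s..T} z + integral {T..0} z = integral {s..0} z"
        "integral {s..T} z + integral {T..\<tau>} z = integral {s..\<tau>} z"
        using True T by (intro Henstock_Kurzweil_Integration.integral_combine int; simp)+
      then have "\<bar>integral {s..\<tau>} z\<bar> \<le> \<bar>integral {s..0} z\<bar> + a3 + a4" unfolding a3_def a4_def by linarith
      also have "\<dots> \<le> \<delta> * \<bar>s\<bar> + a3 + a4" using far(2)[OF True] by simp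
      finally show ?thesis using b far(1)[OF True] order_trans by blast
    next
      case False
      then have "s \<in> {T..\<tau>}" using s by simp
      then have "\<bar>z s\<bar> \<le> C1" "\<bar>integral {s..\<tau>} z\<bar> \<le> C2" using C1 C2 by blast+
      moreover have "C1 \<le> C + \<delta> * (\<tau> - s)" "C2 \<le> C + \<delta> * (\<tau> - s)" using nn ds unfolding C_def by simp_all
      ultimately show ?thesis using order_trans by blast
    qed
    then show "\<bar>integral {s..\<tau>} z\<bar> \<le> C + \<delta> * (\<tau> - s)" "\<bar>z s\<bar> \<le> C + \<delta> * (\<tau> - s)" by auto
  qed
qed

context lattice_system
begin

lemma integral_rate:
  assumes "continuous_on UNIV z" "s \<le> t"
  shows "integral {s..t} (rate z) = 2 * integral {s..t} z - lam_lo * (t - s)"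
proof -
  have "z integrable_on {s..t}" by (rule integrable_continuous_real[OF continuous_on_subset[OF assms(1) subset_UNIV]])
  then have "integral {s..t} (\<lambda>r. 2 * z r - lam_lo) = integral {s..t} (\<lambda>r. 2 * z r) - integral {s..t} (\<lambda>r. lam_lo)"
    by (intro integral_diff integrable_on_mult_right) auto
  then show ?thesis using assms(2) by (simp add: rate_def[abs_def] mult.commute)
qed

text \<open>Integer horizons keep the supremum in \<open>rad\<close> countable, hence measurable in
  the path.\<close>

definition mass :: "(real \<Rightarrow> real) \<Rightarrow> real \<Rightarrow> nat \<Rightarrow> real"
  where "mass z \<tau> n = integral {\<tau> - real n..\<tau>} (kern z \<tau>)"

text \<open>A squared radius. The summand 1 is room for the contribution of the initial value and
  also keeps the radius positive.\<close>

definition rad :: "(real \<Rightarrow> real) \<Rightarrow> real \<Rightarrow> real"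
  where "rad z \<tau> = 1 + c1 * (SUP n. mass z \<tau> n)"

text \<open>With \<open>T = \<tau> - t\<close>, the exponent of the kernel contains twice the
  integral of \<open>z\<close> over \<open>{s..T}\<close> and \<open>- 2 * z s\<close>. At slope
  \<open>\<delta>\<close> these cost \<open>4 * \<delta>\<close> per unit of \<open>T - s\<close>,
  and \<open>\<delta> \<le> lam_lo / 8\<close> leaves the rate \<open>lam_lo / 2\<close>. Splitting
  the integral at \<open>T\<close> and the shift by \<open>t\<close> add up to \<open>6 * C\<close>
  and \<open>6 * \<delta> * t\<close>.\<close>

lemma past_bounds:
  assumes z: "sublinear_past z" and \<delta>: "0 < \<delta>" "\<delta> \<le> lam_lo / 8"
  obtains D where "0 \<le> D"
    "\<And>t. 0 \<le> t \<Longrightarrow> exp (integral {\<tau> - t..\<tau>} (rate z)) \<le> exp (D + 2 * \<delta> * t - lam_lo * t)"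
    "\<And>t n. 0 \<le> t \<Longrightarrow> mass z (\<tau> - t) n \<le> (2 / lam_lo) * exp (D + 6 * \<delta> * t)"
proof -
  have zc: "continuous_on UNIV z" using z by (simp add: sublinear_past_def)
  obtain C where C: "0 \<le> C" "\<And>s. s \<le> \<tau> \<Longrightarrow> \<bar>integral {s..\<tau>} z\<bar> \<le> C + \<delta> * (\<tau> - s)" "\<And>s. s \<le> \<tau> \<Longrightarrow> \<bar>z s\<bar> \<le> C + \<delta> * (\<tau> - s)"
    using z \<delta> unfolding sublinear_past_def by meson
  show ?thesis
  proof (rule that[of "6 * C"])
    show "0 \<le> 6 * C" using C by simp
    show "exp (integral {\<tau> - t..\<tau>} (rate z)) \<le> exp (6 * C + 2 * \<delta> * t - lam_lo * t)" if t: "0 \<le> t" for t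
      using integral_rate[OF zc, of "\<tau> - t" \<tau>] C(2)[of "\<tau> - t"] C(1) t by simp
    fix t n assume t: "0 \<le> (t::real)"
    let ?T = "\<tau> - t"
    have "integral {?T - real n..?T} (kern z ?T) \<le> integral {?T - real n..?T} (\<lambda>s. exp (6 * C + 6 * \<delta> * t) * exp (lam_lo / 2 * (s - ?T)))"
    proof (rule integral_le)
      show "kern z ?T integrable_on {?T - real n..?T}" by (rule integrable_continuous_real[OF continuous_kern[OF zc]])
      show "(\<lambda>s. exp (6 * C + 6 * \<delta> * t) * exp (lam_lo / 2 * (s - ?T))) integrable_on {?T - real n..?T}"
        by (intro integrable_continuous_real continuous_intros)
      fix s assume "s \<in> {?T - real n..?T}"
      then have s: "s \<le> ?T" "s \<le> \<tau>" "?T \<le> \<tau>" using t by auto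
      have "integral {s..?T} z + integral {?T..\<tau>} z = integral {s..\<tau>} z"
        using s by (intro Henstock_Kurzweil_Integration.integral_combine integrable_continuous_real continuous_on_subset[OF zc]) auto
      then have "integral {s..?T} z \<le> 2 * C + \<delta> * (\<tau> - s) + \<delta> * t"
        using C(2)[OF s(2)] C(2)[OF s(3)] by (simp add: abs_le_iff)
      moreover have "- z s \<le> C + \<delta> * (\<tau> - s)" using C(3)[OF s(2)] by linarith
      moreover have "\<delta> * (\<tau> - s) = \<delta> * t + \<delta> * (?T - s)" by (simp add: algebra_simps)
      moreover have "\<delta> * (?T - s) \<le> lam_lo / 8 * (?T - s)" using \<delta> s by (intro mult_right_mono) auto
      moreover have "integral {s..?T} (rate z) = 2 * integral {s..?T} z - lam_lo * (?T - s)" by (rule integral_rate[OF zc s(1)])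
      moreover have "lam_lo / 2 * (s - ?T) = 4 * (lam_lo / 8 * (?T - s)) - lam_lo * (?T - s)" by (simp add: field_simps)
      ultimately have "integral {s..?T} (rate z) - 2 * z s \<le> (6 * C + 6 * \<delta> * t) + lam_lo / 2 * (s - ?T)" by linarith
      then show "kern z ?T s \<le> exp (6 * C + 6 * \<delta> * t) * exp (lam_lo / 2 * (s - ?T))"
        unfolding kern_def exp_add[symmetric] by simp
    qed
    also have "\<dots> = exp (6 * C + 6 * \<delta> * t) * integral {?T - real n..?T} (\<lambda>s. exp (lam_lo / 2 * (s - ?T)))" by simp
    also have "\<dots> \<le> exp (6 * C + 6 * \<delta> * t) * (exp (lam_lo / 2 * (?T - ?T)) / (lam_lo / 2))"
      by (intro mult_left_mono integral_exp_le) (use lam_lo in auto)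
    finally show "mass z ?T n \<le> (2 / lam_lo) * exp (6 * C + 6 * \<delta> * t)" by (simp add: mass_def mult.commute)
  qed
qed

lemma integral_past_mono:
  fixes h :: "real \<Rightarrow> real"
  assumes "\<And>a. continuous_on {a..\<tau>} h" "\<And>s. 0 \<le> h s" "b \<le> a"
  shows "integral {a..\<tau>} h \<le> integral {b..\<tau>} h"
  by (rule integral_subset_le) (use assms in \<open>auto intro: integrable_continuous_real\<close>)

lemma mass_bdd:
  assumes z: "sublinear_past z"
  shows "bdd_above (range (mass z \<tau>))"
proof (rule past_bounds[OF z, of "lam_lo / 8" \<tau>])
  fix D assume "\<And>t n. 0 \<le> t \<Longrightarrow> mass z (\<tau> - t) n \<le> (2 / lam_lo) * exp (D + 6 * (lam_lo / 8) * t)"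
  from this[of 0] show ?thesis by (intro bdd_aboveI[of _ "(2 / lam_lo) * exp D"]) auto
qed (use lam_lo in auto)

lemma mass_le_SUP: "sublinear_past z \<Longrightarrow> mass z \<tau> n \<le> (SUP n. mass z \<tau> n)"
  by (rule cSUP_upper[OF UNIV_I mass_bdd])

lemma mass_nonneg: "continuous_on UNIV z \<Longrightarrow> 0 \<le> mass z \<tau> n"
  unfolding mass_def by (intro integral_nonneg integrable_continuous_real continuous_kern kern_nonneg)

lemma rad_ge_1: "sublinear_past z \<Longrightarrow> 1 \<le> rad z \<tau>"
  unfolding rad_def using mass_le_SUP[of z \<tau> 0] mass_nonneg[of z \<tau> 0] c1_nonneg
  by (simp add: sublinear_past_def)

lemma integral_kern_le_rad:
  assumes z: "sublinear_past z"
  shows "c1 * integral {\<tau> - t..\<tau>} (kern z \<tau>) \<le> rad z \<tau> - 1"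
proof -
  have zc: "continuous_on UNIV z" using z by (simp add: sublinear_past_def)
  have "integral {\<tau> - t..\<tau>} (kern z \<tau>) \<le> mass z \<tau> (nat \<lceil>t\<rceil>)"
    unfolding mass_def by (intro integral_past_mono continuous_kern zc kern_nonneg) linarith
  also have "\<dots> \<le> (SUP n. mass z \<tau> n)" by (rule mass_le_SUP[OF z])
  finally show ?thesis unfolding rad_def using c1_nonneg by (simp add: mult_left_mono)
qed

text \<open>As \<open>\<delta>\<close> may be taken arbitrarily small, the squared radius grows into
  the past slower than any given exponential, which is temperedness of the absorbing ball.\<close>

lemma rad_past_le:
  assumes z: "sublinear_past z" and \<delta>: "0 < \<delta>" "\<delta> \<le> lam_lo / 8"
  obtains D where "0 \<le> D"
    "\<And>t. 0 \<le> t \<Longrightarrow> exp (integral {\<tau> - t..\<tau>} (rate z)) \<le> exp (D + 2 * \<delta> * t - lam_lo * t)"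
    "\<And>t. 0 \<le> t \<Longrightarrow> rad z (\<tau> - t) \<le> D * exp (6 * \<delta> * t)"
proof (rule past_bounds[OF z \<delta>, of \<tau>])
  fix D assume D: "0 \<le> D" "\<And>t. 0 \<le> t \<Longrightarrow> exp (integral {\<tau> - t..\<tau>} (rate z)) \<le> exp (D + 2 * \<delta> * t - lam_lo * t)"
    "\<And>t n. 0 \<le> t \<Longrightarrow> mass z (\<tau> - t) n \<le> (2 / lam_lo) * exp (D + 6 * \<delta> * t)"
  define D' where "D' = D + 1 + c1 * ((2 / lam_lo) * exp D)"
  have c: "0 \<le> c1 * ((2 / lam_lo) * exp D)" using c1_nonneg lam_lo by simp
  show ?thesis
  proof (rule that[of D'])
    show "0 \<le> D'" unfolding D'_def using D(1) c by linarith
    show "exp (integral {\<tau> - t..\<tau>} (rate z)) \<le> exp (D' + 2 * \<delta> * t - lam_lo * t)" if "0 \<le> t" for t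
    proof (rule order_trans[OF D(2)[OF that]])
      show "exp (D + 2 * \<delta> * t - lam_lo * t) \<le> exp (D' + 2 * \<delta> * t - lam_lo * t)"
        unfolding D'_def exp_le_cancel_iff using c by linarith
    qed
    show "rad z (\<tau> - t) \<le> D' * exp (6 * \<delta> * t)" if t: "0 \<le> t" for t
    proof -
      have "(SUP n. mass z (\<tau> - t) n) \<le> (2 / lam_lo) * exp (D + 6 * \<delta> * t)"
        by (rule cSUP_least) (use D(3)[OF t] in auto)
      then have "c1 * (SUP n. mass z (\<tau> - t) n) \<le> c1 * ((2 / lam_lo) * exp (D + 6 * \<delta> * t))"
        by (rule mult_left_mono[OF _ c1_nonneg])
      also have "\<dots> = c1 * ((2 / lam_lo) * exp D) * exp (6 * \<delta> * t)" by (simp add: exp_add)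
      finally have 1: "c1 * (SUP n. mass z (\<tau> - t) n) \<le> c1 * ((2 / lam_lo) * exp D) * exp (6 * \<delta> * t)" .
      have "(1::real) \<le> exp (6 * \<delta> * t)" using \<delta> t by simp
      also have "\<dots> \<le> (D + 1) * exp (6 * \<delta> * t)" using D(1) by simp
      finally have 2: "1 \<le> (D + 1) * exp (6 * \<delta> * t)" .
      show ?thesis unfolding rad_def D'_def distrib_right[of "D + 1"] using 1 2 by linarith
    qed
  qed
qed

section \<open>Limiting site bounds and the compact box\<close>

definition site_mass :: "(real \<Rightarrow> real) \<Rightarrow> real \<Rightarrow> int \<Rightarrow> nat \<Rightarrow> real"
  where "site_mass z \<tau> i n = integral {\<tau> - real n..\<tau>} (\<lambda>s. kern z \<tau> s * src s i)"

definition site_rad :: "(real \<Rightarrow> real) \<Rightarrow> real \<Rightarrow> int \<Rightarrow> real"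
  where "site_rad z \<tau> i = (SUP n. site_mass z \<tau> i n)"

text \<open>The masses increase with the horizon, so each supremum is a limit, and the bound on
  finite sums over the sites, the same for every horizon, passes to the suprema.\<close>

lemma
  assumes z: "sublinear_past z"
  shows sum_site_rad_le: "finite J \<Longrightarrow> (\<Sum>i\<in>J. site_rad z \<tau> i) \<le> rad z \<tau>"
    and site_rad_nonneg: "0 \<le> site_rad z \<tau> i"
    and integral_le_site_rad: "integral {\<tau> - t..\<tau>} (\<lambda>s. kern z \<tau> s * src s i) \<le> site_rad z \<tau> i"
proof -
  have zc: "continuous_on UNIV z" using z by (simp add: sublinear_past_def)
  have ck: "continuous_on {a..\<tau>} (\<lambda>s. kern z \<tau> s * src s i)" for a i
    by (intro continuous_intros continuous_kern zc continuous_src)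
  have nn: "0 \<le> kern z \<tau> s * src s i" for s i by (simp add: kern_nonneg src_nonneg)
  have sum_le: "(\<Sum>i\<in>J. site_mass z \<tau> i n) \<le> rad z \<tau>" if J: "finite J" for J n
    unfolding site_mass_def using sum_integral_src_le[OF zc J, of "\<tau> - real n" \<tau>] integral_kern_le_rad[OF z, of \<tau> "real n"] by linarith
  have bdd: "bdd_above (range (site_mass z \<tau> i))" for i
    using sum_le[of "{i}"] by (intro bdd_aboveI[of _ "rad z \<tau>"]) auto
  have inc: "incseq (site_mass z \<tau> i)" for i
    unfolding incseq_def site_mass_def by (intro allI impI integral_past_mono ck nn) simp
  have lim: "site_mass z \<tau> i \<longlonglongrightarrow> site_rad z \<tau> i" for i
    unfolding site_rad_def by (rule LIMSEQ_incseq_SUP[OF bdd inc])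
  show "(\<Sum>i\<in>J. site_rad z \<tau> i) \<le> rad z \<tau>" if J: "finite J"
    by (rule LIMSEQ_le_const2[OF tendsto_sum[OF lim]]) (use sum_le[OF J] in auto)
  have up: "site_mass z \<tau> i n \<le> site_rad z \<tau> i" for n
    unfolding site_rad_def by (rule cSUP_upper[OF UNIV_I bdd])
  show "0 \<le> site_rad z \<tau> i" using up[of 0] by (simp add: site_mass_def)
  have "integral {\<tau> - t..\<tau>} (\<lambda>s. kern z \<tau> s * src s i) \<le> site_mass z \<tau> i (nat \<lceil>t\<rceil>)"
    unfolding site_mass_def by (intro integral_past_mono ck nn) linarith
  then show "integral {\<tau> - t..\<tau>} (\<lambda>s. kern z \<tau> s * src s i) \<le> site_rad z \<tau> i" using up order_trans by blast
qed

definition box :: "(real \<Rightarrow> real) \<Rightarrow> real \<Rightarrow> ell2 set"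
  where "box z \<tau> = {u. \<forall>i. \<bar>coord u i\<bar> \<le> sqrt (site_rad z \<tau> i)}"

text \<open>Clipping each coordinate at the half-side of the box gives a point of the box. What is
  cut off is controlled by the part of the site bound that carries the initial value, and this part
  is summable over the sites.\<close>

lemma
  assumes z: "sublinear_past z"
  shows compact_box: "compact (box z \<tau>)" and zero_in_box: "0 \<in> box z \<tau>"
    and box_subset: "box z \<tau> \<subseteq> cball 0 (sqrt (rad z \<tau>))"
    and infdist_box: "0 \<le> t \<Longrightarrow> infdist (glob_sol z (\<tau> - t) u \<tau>) (box z \<tau>)
      \<le> sqrt (exp (integral {\<tau> - t..\<tau>} (rate z)) * (Cq * (norm u)\<^sup>2))"
proof -
  have zc: "continuous_on UNIV z" using z by (simp add: sublinear_past_def)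
  note nn = site_rad_nonneg[OF z]
  have "coord (Abs_ell2 (\<lambda>i. sqrt (site_rad z \<tau> i))) = (\<lambda>i. sqrt (site_rad z \<tau> i))"
    by (rule coord_Abs_ell2_bounded[of _ "rad z \<tau>"]) (use sum_site_rad_le[OF z] nn in auto)
  then show "compact (box z \<tau>)" using compact_ell2_box[of "Abs_ell2 (\<lambda>i. sqrt (site_rad z \<tau> i))"] by (simp add: box_def)
  show "0 \<in> box z \<tau>" using nn by (simp add: box_def coord_simps)
  show "box z \<tau> \<subseteq> cball 0 (sqrt (rad z \<tau>))"
  proof
    fix u assume u: "u \<in> box z \<tau>"
    have "norm u \<le> sqrt (rad z \<tau>)"
    proof (rule ell2_normI)
      fix J :: "int set" assume J: "finite J"
      have "(coord u i)\<^sup>2 \<le> site_rad z \<tau> i" for i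
        using u nn by (metis (mono_tags, lifting) box_def mem_Collect_eq real_sqrt_abs real_sqrt_le_iff)
      then have "(\<Sum>i\<in>J. (coord u i)\<^sup>2) \<le> (\<Sum>i\<in>J. site_rad z \<tau> i)" by (rule sum_mono)
      also have "\<dots> \<le> rad z \<tau>" by (rule sum_site_rad_le[OF z J])
      also have "\<dots> = (sqrt (rad z \<tau>))\<^sup>2" using rad_ge_1[OF z, of \<tau>] by simp
      finally show "(\<Sum>i\<in>J. (coord u i)\<^sup>2) \<le> (sqrt (rad z \<tau>))\<^sup>2" .
    qed (use rad_ge_1[OF z, of \<tau>] in simp)
    then show "u \<in> cball 0 (sqrt (rad z \<tau>))" by simp
  qed
  show "infdist (glob_sol z (\<tau> - t) u \<tau>) (box z \<tau>) \<le> sqrt (exp (integral {\<tau> - t..\<tau>} (rate z)) * (Cq * (norm u)\<^sup>2))"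
    if t: "0 \<le> t"
  proof -
    let ?v = "glob_sol z (\<tau> - t) u \<tau>" and ?E = "exp (integral {\<tau> - t..\<tau>} (rate z))"
    define k where "k = Abs_ell2 (\<lambda>i. clip (sqrt (site_rad z \<tau> i)) (coord ?v i))"
    have ck: "coord k = (\<lambda>i. clip (sqrt (site_rad z \<tau> i)) (coord ?v i))"
      unfolding k_def
    proof (rule coord_Abs_ell2_bounded)
      fix J :: "int set" assume J: "finite J"
      have "(clip (sqrt (site_rad z \<tau> i)) (coord ?v i))\<^sup>2 \<le> site_rad z \<tau> i" for i
        using abs_clip_le[of "sqrt (site_rad z \<tau> i)" "coord ?v i"] nn[of \<tau> i]
        by (metis real_sqrt_abs real_sqrt_ge_zero real_sqrt_le_iff)
      then have "(\<Sum>i\<in>J. (clip (sqrt (site_rad z \<tau> i)) (coord ?v i))\<^sup>2) \<le> (\<Sum>i\<in>J. site_rad z \<tau> i)" by (rule sum_mono)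
      also have "\<dots> \<le> rad z \<tau>" by (rule sum_site_rad_le[OF z J])
      finally show "(\<Sum>i\<in>J. (clip (sqrt (site_rad z \<tau> i)) (coord ?v i))\<^sup>2) \<le> rad z \<tau>" .
    qed
    have kb: "k \<in> box z \<tau>" by (simp add: box_def ck abs_clip_le nn)
    have le: "(coord (?v - k) i)\<^sup>2 \<le> ?E * spread qc u i" for i
    proof -
      define a b where "a = coord ?v i" and "b = sqrt (site_rad z \<tau> i)"
      have b: "0 \<le> b" "b\<^sup>2 = site_rad z \<tau> i" using nn by (auto simp: b_def)
      have ab: "a\<^sup>2 \<le> ?E * spread qc u i + b\<^sup>2"
        using glob_sol_site_bound[OF zc, of "\<tau> - t" \<tau> u i] t integral_le_site_rad[OF z, of \<tau> t i]
        unfolding b a_def site_bound_def by linarith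
      have pos: "0 \<le> ?E * spread qc u i" by (simp add: spread_nonneg)
      have "(a - clip b a)\<^sup>2 \<le> ?E * spread qc u i"
      proof (cases "\<bar>a\<bar> \<le> b")
        case True then show ?thesis using pos by (simp add: clip_eq)
      next
        case False
        have "\<bar>a - clip b a\<bar> = \<bar>a\<bar> - b" using False b by (auto simp: clip_def min_def max_def)
        then have "(a - clip b a)\<^sup>2 = (\<bar>a\<bar> - b)\<^sup>2" by (metis power2_abs)
        \<comment> \<open>The square of the excess is at most the excess of the squares, to which
          the site bound applies.\<close>
        also have "\<dots> \<le> a\<^sup>2 - b\<^sup>2"
        proof -
          have "b * b \<le> \<bar>a\<bar> * b" using False b by (intro mult_right_mono) auto
          then show ?thesis unfolding power2_diff power2_abs by (simp add: power2_eq_square)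
        qed
        finally show ?thesis using ab by linarith
      qed
      then show ?thesis by (simp add: coord_simps ck a_def b_def)
    qed
    have "norm (?v - k) \<le> sqrt (?E * (Cq * (norm u)\<^sup>2))"
    proof (rule ell2_normI)
      show "0 \<le> sqrt (?E * (Cq * (norm u)\<^sup>2))" using Cq_pos by simp
      fix J :: "int set" assume J: "finite J"
      have "(\<Sum>i\<in>J. (coord (?v - k) i)\<^sup>2) \<le> ?E * (\<Sum>i\<in>J. spread qc u i)"
        unfolding sum_distrib_left by (intro sum_mono le)
      also have "\<dots> \<le> ?E * (Cq * (norm u)\<^sup>2)"
        unfolding Cq_def by (intro mult_left_mono sum_spread_le qc J) auto
      finally show "(\<Sum>i\<in>J. (coord (?v - k) i)\<^sup>2) \<le> (sqrt (?E * (Cq * (norm u)\<^sup>2)))\<^sup>2"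
        using Cq_pos by simp
    qed
    then show ?thesis using infdist_le[OF kb, of ?v] by (simp add: dist_norm)
  qed
qed

text \<open>Keeps the summand 1 of \<open>rad\<close> free, so that absorption occurs as soon as the
  first term is at most 1.\<close>

lemma norm_glob_sol_sq_le:
  assumes z: "sublinear_past z" and t: "0 \<le> t"
  shows "(norm (glob_sol z (\<tau> - t) u \<tau>))\<^sup>2
    \<le> exp (integral {\<tau> - t..\<tau>} (rate z)) * (Cq * (norm u)\<^sup>2) + (rad z \<tau> - 1)"
  unfolding norm_sq_ell2
proof (rule infsum_le_finite_sums[OF coord_summable])
  have zc: "continuous_on UNIV z" using z by (simp add: sublinear_past_def)
  fix J :: "int set" assume J: "finite J"
  have "(\<Sum>i\<in>J. (coord (glob_sol z (\<tau> - t) u \<tau>) i)\<^sup>2) \<le> (\<Sum>i\<in>J. site_bound z (\<tau> - t) \<tau> u i)"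
    by (intro sum_mono glob_sol_site_bound zc) (use t in simp)
  also have "\<dots> \<le> exp (integral {\<tau> - t..\<tau>} (rate z)) * (Cq * (norm u)\<^sup>2) + (rad z \<tau> - 1)"
    using sum_site_bound_le[OF zc J, of "\<tau> - t" \<tau> u] integral_kern_le_rad[OF z, of \<tau> t] by linarith
  finally show "(\<Sum>i\<in>J. (coord (glob_sol z (\<tau> - t) u \<tau>) i)\<^sup>2)
    \<le> exp (integral {\<tau> - t..\<tau>} (rate z)) * (Cq * (\<Sum>\<^sub>\<infinity>i. (coord u i)\<^sup>2)) + (rad z \<tau> - 1)"
    by (simp add: norm_sq_ell2)
qed

end


section \<open>The random attractor\<close>

lemma borel_measurable_norm_ell2:
  assumes "\<And>i. (\<lambda>\<omega>. coord (v \<omega>) i) \<in> borel_measurable M"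
  shows "(\<lambda>\<omega>. norm (v \<omega>)) \<in> borel_measurable M"
proof -
  have "(\<lambda>\<omega>. (norm (v \<omega>))\<^sup>2) \<in> borel_measurable M"
  proof (rule borel_measurable_LIMSEQ_real)
    show "(\<lambda>\<omega>. \<Sum>i\<in>{- int n..int n}. (coord (v \<omega>) i)\<^sup>2) \<in> borel_measurable M" for n
      using assms by (intro borel_measurable_sum borel_measurable_power)
    \<comment> \<open>Symmetric intervals exhaust the integers, so the unordered sum becomes the
      limit of a sequence of finite sums, as measurability requires.\<close>
    have F: "filterlim (\<lambda>n. {- int n..int n}) (finite_subsets_at_top UNIV) sequentially"
      unfolding filterlim_finite_subsets_at_top
    proof (intro allI impI, elim conjE)
      fix X :: "int set" assume "finite X"
      then have "X \<subseteq> {- int n..int n}" if "nat (Max (insert 0 (abs ` X))) \<le> n" for n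
      proof -
        have "\<bar>x\<bar> \<le> int n" if "x \<in> X" for x
        proof -
          have "\<bar>x\<bar> \<le> Max (insert 0 (abs ` X))" using \<open>finite X\<close> that by (intro Max_ge) auto
          then show ?thesis using \<open>nat (Max (insert 0 (abs ` X))) \<le> n\<close> by linarith
        qed
        then show ?thesis by (auto simp: abs_le_iff minus_le_iff)
      qed
      then show "\<forall>\<^sub>F n in sequentially. finite {- int n..int n} \<and> X \<subseteq> {- int n..int n} \<and> {- int n..int n} \<subseteq> UNIV"
        by (intro eventually_sequentiallyI) auto
    qed
    show "(\<lambda>n. \<Sum>i\<in>{- int n..int n}. (coord (v \<omega>) i)\<^sup>2) \<longlonglongrightarrow> (norm (v \<omega>))\<^sup>2" for \<omega>
      unfolding norm_sq_ell2 by (rule filterlim_compose[OF infsum_tendsto[OF coord_summable] F])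
  qed
  then have "(\<lambda>\<omega>. sqrt ((norm (v \<omega>))\<^sup>2)) \<in> borel_measurable M" by measurable
  then show ?thesis by simp
qed

lemma space_path_sigma_algebra: "space path_sigma_algebra = path_space"
  by (simp add: path_sigma_algebra_def space_measure_of_conv)

lemma borel_measurable_evaluation:
  assumes "sets P = sets path_sigma_algebra"
  shows "(\<lambda>\<omega>. \<omega> t) \<in> borel_measurable P"
proof (rule borel_measurableI)
  fix S :: "real set" assume S: "open S"
  have sp: "space P = path_space"
    using sets_eq_imp_space_eq[OF assms] by (simp add: space_path_sigma_algebra)
  \<comment> \<open>A subbasic set of the compact-open topology, with the singleton
    \<open>{t}\<close> as the compact set.\<close>
  define U where "U = {\<omega> \<in> path_space. \<omega> ` {t} \<subseteq> S}"
  have "openin compact_open_topology U"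
    unfolding compact_open_topology_def U_def
    by (rule topology_generated_by_Basis, intro CollectI exI conjI) (rule refl, simp, rule S)
  moreover have "V \<subseteq> path_space" if "openin compact_open_topology V" for V
  proof -
    have "V \<subseteq> topspace compact_open_topology" using that by (rule openin_subset)
    also have "\<dots> \<subseteq> path_space" by (auto simp: compact_open_topology_def topology_generated_by_topspace)
    finally show ?thesis .
  qed
  ultimately have "U \<in> sets path_sigma_algebra"
    unfolding path_sigma_algebra_def by (intro in_measure_of) auto
  moreover have "(\<lambda>\<omega>. \<omega> t) -` S \<inter> space P = U" by (auto simp: U_def sp)
  ultimately show "(\<lambda>\<omega>. \<omega> t) -` S \<inter> space P \<in> sets P" by (simp add: assms)
qed

lemma borel_measurable_ou_shift:
  assumes "sets P = sets path_sigma_algebra"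
  shows "(\<lambda>\<omega>. ou (\<theta> t \<omega>)) \<in> borel_measurable P"
proof -
  have sp: "space P = path_space"
    using sets_eq_imp_space_eq[OF assms] by (simp add: space_path_sigma_algebra)
  have "(\<lambda>(\<omega>, s). \<theta> t \<omega> s) \<in> borel_measurable (P \<Otimes>\<^sub>M borel)"
  proof (rule borel_measurable_Caratheodory)
    show "continuous_on UNIV (\<lambda>s. \<theta> t \<omega> s)" if "\<omega> \<in> space P" for \<omega>
      using that unfolding sp path_space_def shift_def mem_Collect_eq
      by (intro continuous_intros continuous_on_compose2[of UNIV \<omega> UNIV "\<lambda>s. s + t"]) auto
    show "(\<lambda>\<omega>. \<theta> t \<omega> s) \<in> borel_measurable P" for s
      unfolding shift_def by (intro borel_measurable_diff borel_measurable_evaluation assms)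
  qed
  then have "(\<lambda>(\<omega>, s). indicator {..0} s *\<^sub>R (exp s * \<theta> t \<omega> s)) \<in> borel_measurable (P \<Otimes>\<^sub>M lborel)"
    by (simp add: case_prod_beta')
  then have "(\<lambda>\<omega>. \<integral>s. indicator {..0} s *\<^sub>R (exp s * \<theta> t \<omega> s) \<partial>lborel) \<in> borel_measurable P"
    by (rule lborel.borel_measurable_lebesgue_integral)
  then show ?thesis unfolding ou_def set_lebesgue_integral_def by (rule borel_measurable_uminus)
qed

lemma tendsto_exp_decay:
  fixes c :: real
  assumes "0 < c"
  shows "((\<lambda>t. D * exp (- c * t)) \<longlongrightarrow> 0) at_top"
proof -
  have "filterlim (\<lambda>t. c * t) at_top at_top"
    by (rule filterlim_tendsto_pos_mult_at_top[OF tendsto_const assms filterlim_ident])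
  then have "((\<lambda>t. exp (- (c * t))) \<longlongrightarrow> 0) at_top"
    by (intro filterlim_compose[OF exp_at_bot] filterlim_compose[OF filterlim_uminus_at_bot_at_top])
  from tendsto_mult_right_zero[OF this, of D] show ?thesis by simp
qed

locale lattice_noise = lattice_system +
  fixes P :: "(real \<Rightarrow> real) measure" and \<Omega> :: "(real \<Rightarrow> real) set"
  assumes sets_P: "sets P = sets path_sigma_algebra" and noise: "noise_paths P \<Omega>"
begin

lemma \<Omega>_sets: "\<Omega> \<in> sets P"
  using noise by (simp add: noise_paths_def)

lemma \<Omega>_path_space: "\<omega> \<in> \<Omega> \<Longrightarrow> \<omega> \<in> path_space"
  using sets.sets_into_space[OF \<Omega>_sets] sets_eq_imp_space_eq[OF sets_P] by (auto simp: space_path_sigma_algebra)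

lemma \<Omega>_zero: "\<omega> \<in> \<Omega> \<Longrightarrow> \<omega> 0 = 0"
  using \<Omega>_path_space by (auto simp: path_space_def)

lemma \<Omega>_shift: "\<omega> \<in> \<Omega> \<Longrightarrow> \<theta> t \<omega> \<in> \<Omega>"
  using noise by (auto simp: noise_paths_def)

text \<open>The Ornstein-Uhlenbeck process at absolute time \<open>t\<close> as seen by a solution
  in the fibre \<open>(\<tau>, \<omega>)\<close>. Moving \<open>\<tau>\<close> and
  \<open>\<omega>\<close> together leaves it unchanged, see \<open>ou_path_shift\<close>.\<close>

definition ou_path :: "real \<Rightarrow> (real \<Rightarrow> real) \<Rightarrow> real \<Rightarrow> real"
  where "ou_path \<tau> \<omega> = (\<lambda>t. ou (\<theta> t (\<theta> (- \<tau>) \<omega>)))"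

lemma ou_path_shift: "ou_path (\<tau> + s) (\<theta> s \<omega>) = ou_path \<tau> \<omega>"
  by (simp add: ou_path_def shift_shift fun_eq_iff algebra_simps)

lemma ou_path_past: "ou_path (\<tau> - s) (\<theta> (- s) \<omega>) = ou_path \<tau> \<omega>"
  using ou_path_shift[of \<tau> "- s" \<omega>] by simp

lemma ou_path_sublinear:
  assumes "\<omega> \<in> \<Omega>"
  shows "sublinear_past (ou_path \<tau> \<omega>)"
proof -
  have "\<theta> (- \<tau>) \<omega> \<in> \<Omega>" using assms by (rule \<Omega>_shift)
  then show ?thesis unfolding ou_path_def using noise unfolding noise_paths_def by (intro sublinear_pastI) auto
qed

lemma ou_path_continuous: "\<omega> \<in> \<Omega> \<Longrightarrow> continuous_on UNIV (ou_path \<tau> \<omega>)"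
  using ou_path_sublinear by (simp add: sublinear_past_def)

abbreviation "\<Phi> \<equiv> cocycle \<nu> lam f g"

lemma cocycle_eq:
  assumes "\<omega> \<in> \<Omega>" "0 \<le> t"
  shows "\<Phi> t \<tau> \<omega> u = glob_sol (ou_path \<tau> \<omega>) \<tau> u (t + \<tau>)"
  unfolding cocycle_def ou_path_def
  by (rule solution_eq_glob_sol) (use ou_path_continuous[OF assms(1), of \<tau>] assms in \<open>simp_all add: ou_path_def\<close>)

lemma cocycle_past:
  assumes "\<omega> \<in> \<Omega>" "0 \<le> t"
  shows "\<Phi> t (\<tau> - t) (\<theta> (- t) \<omega>) u = glob_sol (ou_path \<tau> \<omega>) (\<tau> - t) u \<tau>"
  using cocycle_eq[OF \<Omega>_shift[OF assms(1)] assms(2), of "\<tau> - t" "- t" u] by (simp add: ou_path_past)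

section \<open>The absorbing ball and its attraction to the box\<close>

definition absorbing :: family
  where "absorbing \<tau> \<omega> = cball 0 (sqrt (rad (ou_path \<tau> \<omega>) \<tau>))"

lemma absorbing_past: "absorbing (\<tau> - t) (\<theta> (- t) \<omega>) = cball 0 (sqrt (rad (ou_path \<tau> \<omega>) (\<tau> - t)))"
  by (simp add: absorbing_def ou_path_past)

lemma absorbing_tempered: "absorbing \<in> tempered_families \<Omega>"
  unfolding tempered_families_def
proof (intro CollectI allI ballI conjI impI)
  fix \<tau> \<omega> assume w: "\<omega> \<in> \<Omega>"
  note z = ou_path_sublinear[OF w, of \<tau>]
  show "bounded (absorbing \<tau> \<omega>)" by (simp add: absorbing_def)
  show "absorbing \<tau> \<omega> \<noteq> {}" using rad_ge_1[OF z, of \<tau>] by (simp add: absorbing_def)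
  fix \<gamma> :: real assume \<gamma>: "0 < \<gamma>"
  \<comment> \<open>The squared radius grows at rate \<open>6 * \<delta>\<close>, here at most
    \<open>\<gamma> / 2\<close>, so half of the decay \<open>\<gamma>\<close> survives.\<close>
  define \<delta> where "\<delta> = min (\<gamma> / 12) (lam_lo / 8)"
  have \<delta>: "0 < \<delta>" "\<delta> \<le> lam_lo / 8" "\<delta> \<le> \<gamma> / 12" using \<gamma> lam_lo by (auto simp: \<delta>_def)
  show "((\<lambda>s. exp (- \<gamma> * s) * (set_norm (absorbing (\<tau> - s) (\<theta> (- s) \<omega>)))\<^sup>2) \<longlongrightarrow> 0) at_top"
  proof (rule rad_past_le[OF z \<delta>(1,2), of \<tau>])
    fix D assume D: "0 \<le> D" "\<And>t. 0 \<le> t \<Longrightarrow> rad (ou_path \<tau> \<omega>) (\<tau> - t) \<le> D * exp (6 * \<delta> * t)"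
    show ?thesis
    proof (rule tendsto_sandwich[where f = "\<lambda>_. 0"])
      show "\<forall>\<^sub>F s in at_top. exp (- \<gamma> * s) * (set_norm (absorbing (\<tau> - s) (\<theta> (- s) \<omega>)))\<^sup>2 \<le> D * exp (- (\<gamma> / 2) * s)"
        using eventually_ge_at_top[of 0]
      proof eventually_elim
        case (elim s)
        let ?r = "sqrt (rad (ou_path \<tau> \<omega>) (\<tau> - s))"
        have r: "0 \<le> ?r" "1 \<le> rad (ou_path \<tau> \<omega>) (\<tau> - s)" using rad_ge_1[OF z, of "\<tau> - s"] by auto
        have "set_norm (cball (0::ell2) ?r) \<le> ?r"
          unfolding set_norm_def by (rule cSUP_least) (use r in auto)
        moreover have "norm (0::ell2) \<le> set_norm (cball (0::ell2) ?r)"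
          unfolding set_norm_def by (rule cSUP_upper) (use r in \<open>auto intro!: bdd_aboveI[of _ ?r]\<close>)
        ultimately have "(set_norm (cball (0::ell2) ?r))\<^sup>2 \<le> ?r\<^sup>2" by (intro power_mono) auto
        also have "\<dots> \<le> D * exp (6 * \<delta> * s)" using D(2)[OF elim] r by simp
        finally have "exp (- \<gamma> * s) * (set_norm (cball (0::ell2) ?r))\<^sup>2 \<le> exp (- \<gamma> * s) * (D * exp (6 * \<delta> * s))"
          by (rule mult_left_mono) simp
        also have "\<dots> = D * exp (- \<gamma> * s + 6 * \<delta> * s)" by (simp only: exp_add mult_ac)
        also have "\<dots> \<le> D * exp (- (\<gamma> / 2) * s)"
        proof (rule mult_left_mono[OF _ D(1)])
          have "6 * \<delta> * s \<le> 6 * (\<gamma> / 12) * s" using \<delta>(3) elim by (intro mult_right_mono) auto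
          then show "exp (- \<gamma> * s + 6 * \<delta> * s) \<le> exp (- (\<gamma> / 2) * s)" by simp
        qed
        finally show ?case by (simp add: absorbing_past)
      qed
      show "((\<lambda>s. D * exp (- (\<gamma> / 2) * s)) \<longlongrightarrow> 0) at_top" by (rule tendsto_exp_decay) (use \<gamma> in simp)
    qed simp_all
  qed
qed

lemma absorbing_absorbs:
  assumes B: "B \<in> tempered_families \<Omega>" and w: "\<omega> \<in> \<Omega>"
  shows "\<forall>\<^sub>F t in at_top. \<Phi> t (\<tau> - t) (\<theta> (- t) \<omega>) ` B (\<tau> - t) (\<theta> (- t) \<omega>) \<subseteq> absorbing \<tau> \<omega>"
proof -
  note z = ou_path_sublinear[OF w, of \<tau>]
  let ?b = "\<lambda>t. set_norm (B (\<tau> - t) (\<theta> (- t) \<omega>))"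
  show ?thesis
  proof (rule rad_past_le[OF z, of "lam_lo / 8" \<tau>])
    fix D assume E: "\<And>t. 0 \<le> t \<Longrightarrow> exp (integral {\<tau> - t..\<tau>} (rate (ou_path \<tau> \<omega>))) \<le> exp (D + 2 * (lam_lo / 8) * t - lam_lo * t)"
    \<comment> \<open>Slope \<open>lam_lo / 8\<close> leaves a decay of at least
      \<open>lam_lo / 2\<close>. Once the weighted square of \<open>?b t\<close> is below
      \<open>1 / c\<close>, the initial value contributes at most the 1 reserved in
      \<open>rad\<close>.\<close>
    define c where "c = exp D * Cq"
    have c: "0 < c" using Cq_pos by (simp add: c_def)
    have "((\<lambda>t. exp (- (lam_lo / 2) * t) * (?b t)\<^sup>2) \<longlongrightarrow> 0) at_top"
    proof -
      have "\<forall>\<gamma>>0. ((\<lambda>t. exp (- \<gamma> * t) * (?b t)\<^sup>2) \<longlongrightarrow> 0) at_top"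
        using B w unfolding tempered_families_def by blast
      then show ?thesis using lam_lo half_gt_zero by blast
    qed
    then have "\<forall>\<^sub>F t in at_top. exp (- (lam_lo / 2) * t) * (?b t)\<^sup>2 < 1 / c"
      by (rule order_tendstoD) (use c in simp)
    then show ?thesis using eventually_ge_at_top[of 0]
    proof eventually_elim
      case (elim t)
      show ?case
      proof (rule image_subsetI)
        fix u assume u: "u \<in> B (\<tau> - t) (\<theta> (- t) \<omega>)"
        have "bounded (B (\<tau> - t) (\<theta> (- t) \<omega>))" using B \<Omega>_shift[OF w] by (simp add: tempered_families_def)
        then obtain N where "\<forall>u\<in>B (\<tau> - t) (\<theta> (- t) \<omega>). norm u \<le> N" unfolding bounded_iff by blast
        then have "norm u \<le> ?b t"
          unfolding set_norm_def by (intro cSUP_upper[OF u] bdd_aboveI[of _ N]) auto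
        then have nu: "(norm u)\<^sup>2 \<le> (?b t)\<^sup>2" by (intro power_mono) auto
        let ?v = "glob_sol (ou_path \<tau> \<omega>) (\<tau> - t) u \<tau>"
        have "exp (integral {\<tau> - t..\<tau>} (rate (ou_path \<tau> \<omega>))) \<le> exp D * exp (- (lam_lo / 2) * t)"
          using E[OF elim(2)] lam_lo elim(2) unfolding exp_add[symmetric]
          by (elim order_trans) simp
        then have "exp (integral {\<tau> - t..\<tau>} (rate (ou_path \<tau> \<omega>))) * (Cq * (norm u)\<^sup>2)
            \<le> (exp D * exp (- (lam_lo / 2) * t)) * (Cq * (?b t)\<^sup>2)"
          using Cq_pos nu by (intro mult_mono mult_left_mono) auto
        also have "\<dots> = c * (exp (- (lam_lo / 2) * t) * (?b t)\<^sup>2)" by (simp add: c_def)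
        also have "\<dots> \<le> 1" using elim(1) c by (simp add: pos_less_divide_eq mult.commute)
        finally have "(norm ?v)\<^sup>2 \<le> rad (ou_path \<tau> \<omega>) \<tau>"
          using norm_glob_sol_sq_le[OF z elim(2), of \<tau> u] by linarith
        then have "norm ?v \<le> sqrt (rad (ou_path \<tau> \<omega>) \<tau>)" by (rule real_le_rsqrt)
        then show "\<Phi> t (\<tau> - t) (\<theta> (- t) \<omega>) u \<in> absorbing \<tau> \<omega>"
          by (simp add: cocycle_past[OF w elim(2)] absorbing_def)
      qed
    qed
  qed (use lam_lo in auto)
qed

lemma box_attracts:
  assumes w: "\<omega> \<in> \<Omega>" and e: "0 < e"
  shows "\<forall>\<^sub>F t in at_top. \<forall>u\<in>absorbing (\<tau> - t) (\<theta> (- t) \<omega>).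
    infdist (\<Phi> t (\<tau> - t) (\<theta> (- t) \<omega>) u) (box (ou_path \<tau> \<omega>) \<tau>) < e"
proof -
  note z = ou_path_sublinear[OF w, of \<tau>]
  show ?thesis
  \<comment> \<open>At this slope the growth of the squared radius takes 6 and the loss in the rate
    2 sixteenths of \<open>lam_lo\<close>, so half of \<open>lam_lo\<close> remains as
    decay.\<close>
  proof (rule rad_past_le[OF z, of "lam_lo / 16" \<tau>])
    fix D assume D: "0 \<le> D"
      "\<And>t. 0 \<le> t \<Longrightarrow> exp (integral {\<tau> - t..\<tau>} (rate (ou_path \<tau> \<omega>))) \<le> exp (D + 2 * (lam_lo / 16) * t - lam_lo * t)"
      "\<And>t. 0 \<le> t \<Longrightarrow> rad (ou_path \<tau> \<omega>) (\<tau> - t) \<le> D * exp (6 * (lam_lo / 16) * t)"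
    have "((\<lambda>t. (exp D * (Cq * D)) * exp (- (lam_lo / 2) * t)) \<longlongrightarrow> 0) at_top"
      by (rule tendsto_exp_decay) (use lam_lo in simp)
    then have "\<forall>\<^sub>F t in at_top. (exp D * (Cq * D)) * exp (- (lam_lo / 2) * t) < e\<^sup>2"
      by (rule order_tendstoD) (use e in simp)
    then show ?thesis using eventually_ge_at_top[of 0]
    proof eventually_elim
      case (elim t)
      show ?case
      proof
        fix u assume "u \<in> absorbing (\<tau> - t) (\<theta> (- t) \<omega>)"
        then have "norm u \<le> sqrt (rad (ou_path \<tau> \<omega>) (\<tau> - t))" by (simp add: absorbing_past)
        then have "(norm u)\<^sup>2 \<le> (sqrt (rad (ou_path \<tau> \<omega>) (\<tau> - t)))\<^sup>2" by (rule power_mono) simp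
        also have "\<dots> \<le> D * exp (6 * (lam_lo / 16) * t)"
          using D(3)[OF elim(2)] rad_ge_1[OF z, of "\<tau> - t"] by simp
        finally have u: "(norm u)\<^sup>2 \<le> D * exp (6 * (lam_lo / 16) * t)" .
        have "exp (integral {\<tau> - t..\<tau>} (rate (ou_path \<tau> \<omega>))) * (Cq * (norm u)\<^sup>2)
          \<le> exp (D + 2 * (lam_lo / 16) * t - lam_lo * t) * (Cq * (D * exp (6 * (lam_lo / 16) * t)))"
          using D(2)[OF elim(2)] u Cq_pos by (intro mult_mono mult_left_mono) auto
        also have "\<dots> = (Cq * D) * exp ((D + 2 * (lam_lo / 16) * t - lam_lo * t) + 6 * (lam_lo / 16) * t)"
          by (simp only: exp_add mult_ac)
        also have "(D + 2 * (lam_lo / 16) * t - lam_lo * t) + 6 * (lam_lo / 16) * t = D + - (lam_lo / 2) * t"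
          by (simp add: field_simps)
        also have "(Cq * D) * exp (D + - (lam_lo / 2) * t) = (exp D * (Cq * D)) * exp (- (lam_lo / 2) * t)"
          by (simp only: exp_add mult_ac)
        also have "\<dots> < e\<^sup>2" by (rule elim(1))
        finally have "sqrt (exp (integral {\<tau> - t..\<tau>} (rate (ou_path \<tau> \<omega>))) * (Cq * (norm u)\<^sup>2)) < e"
          using e by (intro real_less_lsqrt) auto
        then show "infdist (\<Phi> t (\<tau> - t) (\<theta> (- t) \<omega>) u) (box (ou_path \<tau> \<omega>) \<tau>) < e"
          using infdist_box[OF z elim(2), of \<tau> u] by (simp add: cocycle_past[OF w elim(2)])
      qed
    qed
  qed (use lam_lo in auto)
qed

sublocale absorbed_cocycle \<Omega> \<Phi> absorbing "\<lambda>\<tau> \<omega>. box (ou_path \<tau> \<omega>) \<tau>"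
proof
  show "\<Phi> (t + s) \<tau> \<omega> u = \<Phi> t (\<tau> + s) (\<theta> s \<omega>) (\<Phi> s \<tau> \<omega> u)"
    if "0 \<le> s" "0 \<le> t" "\<omega> \<in> \<Omega>" for s t \<tau> \<omega> u
  proof -
    have "\<Phi> t (\<tau> + s) (\<theta> s \<omega>) (\<Phi> s \<tau> \<omega> u) = glob_sol (ou_path \<tau> \<omega>) (s + \<tau>) (glob_sol (ou_path \<tau> \<omega>) \<tau> u (s + \<tau>)) (t + s + \<tau>)"
      using that by (simp add: cocycle_eq \<Omega>_shift ou_path_shift add_ac)
    also have "\<dots> = glob_sol (ou_path \<tau> \<omega>) \<tau> u (t + s + \<tau>)"
      by (rule glob_sol_flow[OF ou_path_continuous]) (use that in auto)
    finally show ?thesis using that by (simp add: cocycle_eq)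
  qed
  show "continuous_on UNIV (\<Phi> t \<tau> \<omega>)" if "0 \<le> t" "\<omega> \<in> \<Omega>" for t \<tau> \<omega>
    using continuous_glob_sol_initial[OF ou_path_continuous[OF that(2)], of \<tau> "t + \<tau>" \<tau>] that
    by (simp add: cocycle_eq)
  show "box (ou_path \<tau> \<omega>) \<tau> \<noteq> {}" if "\<omega> \<in> \<Omega>" for \<tau> \<omega> using zero_in_box[OF ou_path_sublinear[OF that]] by blast
  show "box (ou_path \<tau> \<omega>) \<tau> \<subseteq> absorbing \<tau> \<omega>" if "\<omega> \<in> \<Omega>" for \<tau> \<omega>
    unfolding absorbing_def by (rule box_subset[OF ou_path_sublinear[OF that]])
qed (use \<Omega>_shift \<Omega>_zero absorbing_tempered absorbing_absorbs box_attracts compact_box ou_path_sublinear in auto)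

section \<open>Measurability of the attractor\<close>

abbreviation "M\<Omega> \<equiv> restrict_space P \<Omega>"

lemma space_M: "space M\<Omega> = \<Omega>"
  using sets.sets_into_space[OF \<Omega>_sets] by (simp add: space_restrict_space Int_absorb2)

lemma measurable_zp: "(\<lambda>\<omega>. ou_path \<tau> \<omega> s) \<in> borel_measurable M\<Omega>"
  unfolding ou_path_def shift_shift
  by (rule measurable_restrict_space1[OF borel_measurable_ou_shift[OF sets_P]])

lemma measurable_kern: "(\<lambda>\<omega>. kern (ou_path \<tau> \<omega>) t s) \<in> borel_measurable M\<Omega>"
proof -
  have "(\<lambda>\<omega>. integral {s..t} (\<lambda>r. 1 * rate (ou_path \<tau> \<omega>) r)) \<in> borel_measurable M\<Omega>"
  proof (rule borel_measurable_integral_Caratheodory)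
    show "continuous_on {s..t} (rate (ou_path \<tau> \<omega>))" if "\<omega> \<in> space M\<Omega>" for \<omega>
      using ou_path_continuous[of \<omega> \<tau>] that by (intro continuous_rate) (auto simp: space_M intro: continuous_on_subset)
    show "(\<lambda>\<omega>. rate (ou_path \<tau> \<omega>) r) \<in> borel_measurable M\<Omega>" for r
      using measurable_zp unfolding rate_def by measurable
  qed (intro absolutely_integrable_continuous_real continuous_intros)
  then have "(\<lambda>\<omega>. integral {s..t} (rate (ou_path \<tau> \<omega>)) - 2 * ou_path \<tau> \<omega> s) \<in> borel_measurable M\<Omega>"
    by (intro borel_measurable_diff borel_measurable_times borel_measurable_const measurable_zp) simp
  then show ?thesis unfolding kern_def by (rule borel_measurable_exp[THEN measurable_compose[rotated]])
qed

lemma measurable_rad: "(\<lambda>\<omega>. rad (ou_path \<tau> \<omega>) t) \<in> borel_measurable M\<Omega>"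
proof -
  have "(\<lambda>\<omega>. integral {t - real n..t} (\<lambda>s. 1 * kern (ou_path \<tau> \<omega>) t s)) \<in> borel_measurable M\<Omega>" for n
    by (rule borel_measurable_integral_Caratheodory)
      (auto simp: space_M intro!: continuous_kern ou_path_continuous measurable_kern absolutely_integrable_continuous_real continuous_intros)
  then have "(\<lambda>\<omega>. mass (ou_path \<tau> \<omega>) t n) \<in> borel_measurable M\<Omega>" for n by (simp add: mass_def)
  then have "(\<lambda>\<omega>. SUP n. mass (ou_path \<tau> \<omega>) t n) \<in> borel_measurable M\<Omega>"
    by (intro borel_measurable_cSUP) (auto simp: space_M intro!: mass_bdd ou_path_sublinear)
  then show ?thesis unfolding rad_def by measurable
qed

text \<open>The image of a random ball under a random map is reduced to countably many points: a
  dense sequence subject to \<open>norm (q k) < r \<omega>\<close>. The strict inequality loses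
  nothing, because the open ball of positive radius is dense in the closed one and the solution is
  continuous in the initial value.\<close>

lemma measurable_infdist_image:
  assumes t: "0 \<le> t"
  shows "(\<lambda>\<omega>. infdist x (pull t \<tau> \<omega> ` Cpast t \<tau> \<omega>)) \<in> borel_measurable M\<Omega>"
proof -
  obtain q :: "nat \<Rightarrow> ell2" where q: "\<And>u e. 0 < e \<Longrightarrow> \<exists>k. dist (q k) u < e" by (rule ell2_separable) (rule that)
  define r where "r \<omega> = sqrt (rad (ou_path \<tau> \<omega>) (\<tau> - t))" for \<omega>
  define S where "S \<omega> u = glob_sol (ou_path \<tau> \<omega>) (\<tau> - t) u \<tau>" for \<omega> u
  have im: "pull t \<tau> \<omega> ` Cpast t \<tau> \<omega> = S \<omega> ` cball 0 (r \<omega>)" if "\<omega> \<in> \<Omega>" for \<omega>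
    using that t by (simp add: pull_def Cpast_def S_def[abs_def] r_def absorbing_past cocycle_past cong: image_cong)
  have r0: "0 < r \<omega>" if "\<omega> \<in> \<Omega>" for \<omega> using rad_ge_1[OF ou_path_sublinear[OF that], of \<tau> "\<tau> - t"] by (simp add: r_def)
  have contS: "continuous_on UNIV (S \<omega>)" if "\<omega> \<in> \<Omega>" for \<omega>
    unfolding S_def[abs_def] by (rule continuous_glob_sol_initial[OF ou_path_continuous[OF that]]) (use t in simp)
  have mS: "(\<lambda>\<omega>. dist x (S \<omega> u)) \<in> borel_measurable M\<Omega>" for u
    unfolding dist_norm
  proof (rule borel_measurable_norm_ell2)
    have "(\<lambda>\<omega>. coord (glob_sol (ou_path \<tau> \<omega>) (\<tau> - t) u \<tau>) i) \<in> borel_measurable M\<Omega>" for i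
      by (rule measurable_glob_sol) (use t in \<open>auto simp: space_M intro!: ou_path_continuous measurable_zp\<close>)
    then show "(\<lambda>\<omega>. coord (x - S \<omega> u) i) \<in> borel_measurable M\<Omega>" for i
      unfolding coord_simps S_def by measurable
  qed
  have mr: "r \<in> borel_measurable M\<Omega>" using measurable_rad unfolding r_def[abs_def] by measurable
  have iff: "infdist x (S \<omega> ` cball 0 (r \<omega>)) < c \<longleftrightarrow> (\<exists>k. norm (q k) < r \<omega> \<and> dist x (S \<omega> (q k)) < c)"
    if w: "\<omega> \<in> \<Omega>" for \<omega> c
  proof
    have ne: "S \<omega> ` cball 0 (r \<omega>) \<noteq> {}" using r0[OF w] by simp
    assume "infdist x (S \<omega> ` cball 0 (r \<omega>)) < c"
    then obtain u where u: "norm u \<le> r \<omega>" "dist x (S \<omega> u) < c"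
      unfolding infdist_notempty[OF ne] using cInf_lessD[of "dist x ` S \<omega> ` cball 0 (r \<omega>)" c] ne by auto
    have "open {y. dist x (S \<omega> y) < c}"
      by (intro open_Collect_less continuous_intros contS[OF w])
    then obtain d where d: "0 < d" "ball u d \<subseteq> {y. dist x (S \<omega> y) < c}" using u(2) unfolding open_contains_ball by blast
    \<comment> \<open>The point \<open>u\<close> may lie on the sphere; it is moved into the open
      ball first and only then to a member of the dense sequence.\<close>
    have "u \<in> closure (ball 0 (r \<omega>))" using u(1) r0[OF w] by simp
    then obtain v where v: "v \<in> ball 0 (r \<omega>)" "dist v u < d" using d(1) unfolding closure_approachable by blast
    define e where "e = min (r \<omega> - norm v) (d - dist v u)"
    have "0 < e" using v by (simp add: e_def)
    then obtain k where k: "dist (q k) v < e" using q by blast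
    have "norm (q k) < r \<omega>" using k norm_triangle_ineq2[of "q k" v] by (simp add: e_def dist_norm)
    moreover have "dist u (q k) < d"
      using dist_triangle[of "q k" u v] k by (simp add: e_def dist_commute)
    ultimately show "\<exists>k. norm (q k) < r \<omega> \<and> dist x (S \<omega> (q k)) < c" using d(2) by auto
  next
    assume "\<exists>k. norm (q k) < r \<omega> \<and> dist x (S \<omega> (q k)) < c"
    then obtain k where "norm (q k) < r \<omega>" "dist x (S \<omega> (q k)) < c" by blast
    then show "infdist x (S \<omega> ` cball 0 (r \<omega>)) < c"
      using infdist_le[of "S \<omega> (q k)" "S \<omega> ` cball 0 (r \<omega>)" x] by force
  qed
  show ?thesis
  proof (rule borel_measurable_iff_less[THEN iffD2], rule allI)
    fix c
    have "{\<omega> \<in> space M\<Omega>. infdist x (pull t \<tau> \<omega> ` Cpast t \<tau> \<omega>) < c}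
      = (\<Union>k. {\<omega> \<in> space M\<Omega>. norm (q k) < r \<omega> \<and> dist x (S \<omega> (q k)) < c})"
      using im iff by (auto simp: space_M)
    also have "\<dots> \<in> sets M\<Omega>"
      using mr mS by measurable
    finally show "{\<omega> \<in> space M\<Omega>. infdist x (pull t \<tau> \<omega> ` Cpast t \<tau> \<omega>) < c} \<in> sets M\<Omega>" .
  qed
qed

lemma measurable_infdist_att: "(\<lambda>\<omega>. infdist x (att \<tau> \<omega>)) \<in> borel_measurable (completion M\<Omega>)"
proof (rule measurable_completion, rule borel_measurable_LIMSEQ_real)
  show "(\<lambda>\<omega>. infdist x (pull (real n) \<tau> \<omega> ` Cpast (real n) \<tau> \<omega>)) \<in> borel_measurable M\<Omega>" for n
    by (rule measurable_infdist_image) simp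
  show "(\<lambda>n. infdist x (pull (real n) \<tau> \<omega> ` Cpast (real n) \<tau> \<omega>)) \<longlonglongrightarrow> infdist x (att \<tau> \<omega>)"
    if "\<omega> \<in> space M\<Omega>" for \<omega>
    using infdist_att_limit that by (simp add: space_M)
qed

lemma pullback_attractor_att: "pullback_attractor P \<Omega> \<Phi> att"
  unfolding pullback_attractor_def
  using att_tempered compact_att measurable_infdist_att att_invariant att_attracts by blast

end

theorem theorem5p4:
  fixes P :: "(real \<Rightarrow> real) measure" and \<Omega> :: "(real \<Rightarrow> real) set"
    and \<nu> lam :: "int \<Rightarrow> real \<Rightarrow> real"
    and f :: "int \<Rightarrow> real \<Rightarrow> real \<Rightarrow> real"
    and g :: "real \<Rightarrow> ell2"
  assumes "wiener_measure P" and "noise_paths P \<Omega>"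
    and "bounded_coefficients \<nu> lam"
    and "dissipative_nonlinearity f"
    and "locally_bounded_derivative f"
    and "g \<in> bcontfun"
  shows "\<exists>A. pullback_attractor P \<Omega> (cocycle \<nu> lam f g) A \<and>
    (\<forall>A'. pullback_attractor P \<Omega> (cocycle \<nu> lam f g) A' \<longrightarrow>
      (\<forall>\<tau>. \<forall>\<omega>\<in>\<Omega>. A' \<tau> \<omega> = A \<tau> \<omega>))"
proof -
  obtain lam_lo lam_hi \<nu>_lo \<nu>_hi where bd: "0 < lam_lo" "0 < \<nu>_lo" "0 < \<nu>_hi"
    "\<forall>i t. lam_lo \<le> lam i t \<and> lam i t \<le> lam_hi \<and> \<nu>_lo \<le> \<nu> i t \<and> \<nu> i t \<le> \<nu>_hi"
    and int: "\<forall>i a b. lam i absolutely_integrable_on {a..b} \<and> \<nu> i absolutely_integrable_on {a..b}"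
    using assms(3) unfolding bounded_coefficients_def by blast
  obtain \<alpha> where \<alpha>: "\<alpha> \<in> bcontfun" "\<forall>i x t. x * f i x t \<ge> - (coord (\<alpha> t) i)\<^sup>2"
    using assms(4) unfolding dissipative_nonlinearity_def by blast
  obtain \<zeta> where \<zeta>: "continuous_on ({0..} \<times> UNIV) (\<lambda>(\<iota>, t). \<zeta> \<iota> t)"
    "\<forall>\<iota>\<ge>0. \<forall>t i. \<forall>x\<in>{-\<iota>..\<iota>}. \<bar>deriv (\<lambda>y. f i y t) x\<bar> \<le> \<zeta> \<iota> t"
    using assms(5) unfolding locally_bounded_derivative_def by blast
  interpret lattice_noise \<nu> lam f g lam_lo lam_hi \<nu>_hi \<alpha> \<zeta> P \<Omega>
  proof
    show "0 \<le> \<nu> i t" for i t using bd(2,4) by (meson less_imp_le order_trans)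
    show "sets P = sets path_sigma_algebra" using assms(1) by (simp add: wiener_measure_def)
  qed (use assms bd int \<alpha> \<zeta> in \<open>auto simp: dissipative_nonlinearity_def\<close>)
  show ?thesis
  proof (intro exI[of _ att] conjI allI impI ballI pullback_attractor_att equalityI)
    fix A' \<tau> \<omega> assume A': "pullback_attractor P \<Omega> (cocycle \<nu> lam f g) A'" and w: "\<omega> \<in> \<Omega>"
    show "A' \<tau> \<omega> \<subseteq> att \<tau> \<omega>"
      by (rule pullback_attractor_subset[OF pullback_attractor_att A' _ _ w]) (rule \<Omega>_shift \<Omega>_zero, assumption)+
    show "att \<tau> \<omega> \<subseteq> A' \<tau> \<omega>"
      by (rule pullback_attractor_subset[OF A' pullback_attractor_att _ _ w]) (rule \<Omega>_shift \<Omega>_zero, assumption)+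
  qed
qed

end
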